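(* Let $\Gamma$ be a connected graph with vertex set $\{1,\dots,N\}$, $1\le m\le N$, $\alpha>0$. Let $f_t$ be a zero-mean stationary gaussian process which is either the white noise (covariance $C_f(s)=\sigma^2\delta(s)$) or has continuous trajectories and integrable covariance $C_f(s)=\langle f_tf_{t+s}\rangle$. Then for any $H\in\mathbf{H}_\Gamma$ with $L_0=L_0(H)=\{0\}$ the following hold for the solution $\psi(t)$ of $$\frac{d\psi}{dt}=A\psi+F_t:$$ (1) there exists a gaussian random $2N$-vector $\psi(\infty)$ such that for any initial condition $\psi(0)$ the distribution of $\psi(t)$ converges, as $t\to\infty$, to that of $\psi(\infty)$; (2) the covariance satisfies $$C_{\psi(\infty)}(s)=\lim_{t\to\infty}\langle\psi(t)\psi^T(t+s)\rangle=W(s)C_G+C_GW(-s)^T,\qquad W(s)=\int_0^{+\infty}e^{\tau A}C_f(\tau+s)\,d\tau .$$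
   Context: $\Gamma$ has at most one edge per unordered vertex pair and contains all loops. $\mathbf{H}_\Gamma$ is the set of real symmetric positive definite $N\times N$ matrices $V$ with $V(i,j)=0$ when $(i,j)$ is not an edge; $V$ is identified with the hamiltonian $H(\psi)=\frac12\sum_ip_i^2+\frac12\sum_{i,j}V(j,i)q_iq_j$, $\psi=(q,p)\in\mathbb{R}^{2N}$ (column vectors). $A=\begin{pmatrix}0&E\\-V&-\alpha D\end{pmatrix}$, $E$ the $N\times N$ identity, $D$ diagonal with $D_{k,k}=1$ for $k\in\{N-m+1,\dots,N\}$ and $0$ otherwise. $F_t$ is the $2N$-vector with $F_{t,k}=0$ for $k\le 2N-m$ and $F_{t,k}$, $k>2N-m$, independent copies of $f_t$ (so only the coordinates $p_k$, $k>N-m$, are damped and forced). The solution is $\psi(t)=e^{tA}(\int_0^te^{-sA}F_sds+\psi(0))$. $L_-=\{\psi:H(e^{tA}\psi)\to0\}$ and $L_0$ is its orthogonal complement. $C_G=C_{G,2\alpha}$ where $C_{G,\beta}=\frac1\beta\begin{pmatrix}V^{-1}&0\\0&E\end{pmatrix}$ is the covariance of the Gibbs distribution $Z^{-1}\exp(-\beta H)$. *)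

theory Defs
  imports "HOL-Analysis.Analysis" "HOL-Probability.Probability"
begin

primrec mpow :: "real^'k^'k \<Rightarrow> nat \<Rightarrow> real^'k^'k" where
  "mpow B 0 = mat 1"
| "mpow B (Suc n) = B ** mpow B n"

definition mexp :: "real^'k^'k \<Rightarrow> real^'k^'k" where
  "mexp B = (\<Sum>k. (1 / fact k) *\<^sub>R mpow B k)"

definition outer :: "real^'k \<Rightarrow> real^'k \<Rightarrow> real^'k^'k" where
  "outer x y = (\<chi> i j. x $ i * y $ j)"

text \<open>Vertices are the elements of a finite linearly ordered type 'n (playing the role
 of {1..N}, N = CARD('n)); phase space R^2N is indexed by 'n + 'n, with
 q_i = psi $ Inl i and p_i = psi $ Inr i.\<close>

definition graph_ok :: "(('n::finite) \<Rightarrow> ('n::finite) \<Rightarrow> bool) \<Rightarrow> bool" where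
  "graph_ok E \<longleftrightarrow> (\<forall>i j. E i j \<longleftrightarrow> E j i) \<and> (\<forall>i. E i i)"

definition graph_connected :: "(('n::finite) \<Rightarrow> ('n::finite) \<Rightarrow> bool) \<Rightarrow> bool" where
  "graph_connected E \<longleftrightarrow> (\<forall>i j. E\<^sup>*\<^sup>* i j)"

definition H_Gamma :: "(('n::finite) \<Rightarrow> ('n::finite) \<Rightarrow> bool) \<Rightarrow> (real^('n::finite)^('n::finite)) set" where
  "H_Gamma E = {V. (\<forall>i j. V $ i $ j = V $ j $ i)
                  \<and> (\<forall>x. x \<noteq> 0 \<longrightarrow> x \<bullet> (V *v x) > 0)
                  \<and> (\<forall>i j. \<not> E i j \<longrightarrow> V $ i $ j = 0)}"

definition hamiltonian :: "real^(('n::finite))^('n::finite) \<Rightarrow> real^(('n::finite) + ('n::finite)) \<Rightarrow> real" where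
  "hamiltonian V \<psi> = (1/2) * (\<Sum>i\<in>UNIV. (\<psi> $ Inr i)^2)
      + (1/2) * (\<Sum>i\<in>UNIV. \<Sum>j\<in>UNIV. V $ j $ i * \<psi> $ Inl i * \<psi> $ Inl j)"

text \<open>Damped coordinates: the last m vertices, i.e. those with fewer than m larger vertices.\<close>
definition damped :: "nat \<Rightarrow> ('n::{finite,linorder}) \<Rightarrow> bool" where
  "damped m k \<longleftrightarrow> card {j. k < j} < m"

definition Amat :: "real \<Rightarrow> nat \<Rightarrow> real^(('n::{finite,linorder}))^('n::{finite,linorder}) \<Rightarrow> real^(('n::{finite,linorder}) + ('n::{finite,linorder}))^(('n::{finite,linorder}) + ('n::{finite,linorder}))" where
  "Amat \<alpha> m V = (\<chi> a b. case (a, b) of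
        (Inl i, Inl j) \<Rightarrow> 0
      | (Inl i, Inr j) \<Rightarrow> (if i = j then 1 else 0)
      | (Inr i, Inl j) \<Rightarrow> - V $ i $ j
      | (Inr i, Inr j) \<Rightarrow> (if i = j \<and> damped m i then - \<alpha> else 0))"

definition L_minus :: "real \<Rightarrow> nat \<Rightarrow> real^(('n::{finite,linorder}))^('n::{finite,linorder}) \<Rightarrow> (real^(('n::{finite,linorder}) + ('n::{finite,linorder}))) set" where
  "L_minus \<alpha> m V = {\<psi>. ((\<lambda>t. hamiltonian V (mexp (t *\<^sub>R Amat \<alpha> m V) *v \<psi>)) \<longlongrightarrow> 0) at_top}"

definition L_zero :: "real \<Rightarrow> nat \<Rightarrow> real^(('n::{finite,linorder}))^('n::{finite,linorder}) \<Rightarrow> (real^(('n::{finite,linorder}) + ('n::{finite,linorder}))) set" where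
  "L_zero \<alpha> m V = {x. \<forall>y\<in>L_minus \<alpha> m V. x \<bullet> y = 0}"

text \<open>Gibbs covariance C_{G,beta} = (1/beta) diag(V^{-1}, E); C_G = C_{G,2 alpha}.\<close>
definition C_Gibbs :: "real \<Rightarrow> real^(('n::finite))^('n::finite) \<Rightarrow> real^(('n::finite) + ('n::finite))^(('n::finite) + ('n::finite))" where
  "C_Gibbs \<beta> V = (1 / \<beta>) *\<^sub>R (\<chi> a b. case (a, b) of
        (Inl i, Inl j) \<Rightarrow> matrix_inv V $ i $ j
      | (Inr i, Inr j) \<Rightarrow> (if i = j then 1 else 0)
      | _ \<Rightarrow> 0)"

definition gaussian_measure :: "real measure \<Rightarrow> bool" where
  "gaussian_measure \<nu> \<longleftrightarrow> (\<exists>\<mu> \<sigma>. \<sigma> \<ge> 0 \<and>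
       \<nu> = (if \<sigma> = 0 then return borel \<mu> else density lborel (normal_density \<mu> \<sigma>)))"

definition gaussian_vec_measure :: "'a::euclidean_space measure \<Rightarrow> bool" where
  "gaussian_vec_measure \<mu> \<longleftrightarrow> prob_space \<mu> \<and> sets \<mu> = sets borel \<and>
       (\<forall>c. gaussian_measure (distr \<mu> borel (\<lambda>x. c \<bullet> x)))"

definition gaussian_process :: "'w measure \<Rightarrow> (real \<Rightarrow> 'w \<Rightarrow> real) \<Rightarrow> bool" where
  "gaussian_process M f \<longleftrightarrow> (\<forall>t. f t \<in> borel_measurable M) \<and>
       (\<forall>T c. finite T \<longrightarrow> gaussian_measure (distr M borel (\<lambda>\<omega>. \<Sum>t\<in>T. c t * f t \<omega>)))"

definition process_law :: "'w measure \<Rightarrow> (real \<Rightarrow> 'w \<Rightarrow> real) \<Rightarrow> (real \<Rightarrow> real) measure" where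
  "process_law M f = distr M (\<Pi>\<^sub>M t\<in>UNIV. borel) (\<lambda>\<omega> t. f t \<omega>)"

definition weak_conv_at_top :: "(real \<Rightarrow> 'a::euclidean_space measure) \<Rightarrow> 'a measure \<Rightarrow> bool" where
  "weak_conv_at_top P \<mu> \<longleftrightarrow> (\<forall>h :: 'a \<Rightarrow> real. continuous_on UNIV h \<and> bounded (range h) \<longrightarrow>
       ((\<lambda>t. \<integral>x. h x \<partial>P t) \<longlongrightarrow> (\<integral>x. h x \<partial>\<mu>)) at_top)"

definition Force :: "nat \<Rightarrow> (('n::{finite,linorder}) \<Rightarrow> real \<Rightarrow> 'w \<Rightarrow> real) \<Rightarrow> real \<Rightarrow> 'w \<Rightarrow> real^(('n::{finite,linorder}) + ('n::{finite,linorder}))" where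
  "Force m g t \<omega> = (\<chi> a. case a of Inl i \<Rightarrow> 0 | Inr k \<Rightarrow> (if damped m k then g k t \<omega> else 0))"

definition solution :: "real \<Rightarrow> nat \<Rightarrow> real^(('n::{finite,linorder}))^('n::{finite,linorder}) \<Rightarrow> (('n::{finite,linorder}) \<Rightarrow> real \<Rightarrow> 'w \<Rightarrow> real)
     \<Rightarrow> real^(('n::{finite,linorder}) + ('n::{finite,linorder})) \<Rightarrow> real \<Rightarrow> 'w \<Rightarrow> real^(('n::{finite,linorder}) + ('n::{finite,linorder}))" where
  "solution \<alpha> m V g \<psi>0 t \<omega> = mexp (t *\<^sub>R Amat \<alpha> m V) *v
      (integral {0..t} (\<lambda>s. mexp ((- s) *\<^sub>R Amat \<alpha> m V) *v Force m g s \<omega>) + \<psi>0)"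

definition Wmat :: "real \<Rightarrow> nat \<Rightarrow> real^(('n::{finite,linorder}))^('n::{finite,linorder}) \<Rightarrow> (real \<Rightarrow> real) \<Rightarrow> real
     \<Rightarrow> real^(('n::{finite,linorder}) + ('n::{finite,linorder}))^(('n::{finite,linorder}) + ('n::{finite,linorder}))" where
  "Wmat \<alpha> m V Cf s = (LINT \<tau>:{0..}|lborel. Cf (\<tau> + s) *\<^sub>R mexp (\<tau> *\<^sub>R Amat \<alpha> m V))"


definition brownian_motion :: "'w measure \<Rightarrow> (real \<Rightarrow> 'w \<Rightarrow> real) \<Rightarrow> bool" where
  "brownian_motion M B \<longleftrightarrow> (\<forall>t\<ge>0. B t \<in> borel_measurable M) \<and>
     (\<forall>T c. finite T \<and> T \<subseteq> {0..} \<longrightarrow> gaussian_measure (distr M borel (\<lambda>\<omega>. \<Sum>t\<in>T. c t * B t \<omega>))) \<and>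
     (\<forall>t\<ge>0. (\<integral>\<omega>. B t \<omega> \<partial>M) = 0) \<and>
     (\<forall>s\<ge>0. \<forall>t\<ge>0. (\<integral>\<omega>. B s \<omega> * B t \<omega> \<partial>M) = min s t) \<and>
     (\<forall>\<omega>\<in>space M. B 0 \<omega> = 0 \<and> continuous_on {0..} (\<lambda>t. B t \<omega>))"

text \<open>sigma times the Brownian motions placed in the damped p-coordinates (the integral of F).\<close>
definition BForce :: "nat \<Rightarrow> real \<Rightarrow> (('n::{finite,linorder}) \<Rightarrow> real \<Rightarrow> 'w \<Rightarrow> real) \<Rightarrow> real \<Rightarrow> 'w \<Rightarrow> real^(('n::{finite,linorder}) + ('n::{finite,linorder}))" where
  "BForce m \<sigma> B t \<omega> = (\<chi> a. case a of Inl i \<Rightarrow> 0 | Inr k \<Rightarrow> (if damped m k then \<sigma> * B k t \<omega> else 0))"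

text \<open>psi(t) = e^{tA}(psi(0) + int_0^t e^{-sA} dW_s), the Wiener integral of the smooth
 deterministic integrand written pathwise via integration by parts:
 int_0^t e^{-sA} dW_s = e^{-tA} W_t + int_0^t e^{-sA} A W_s ds.\<close>
definition solution_white :: "real \<Rightarrow> nat \<Rightarrow> real^(('n::{finite,linorder}))^('n::{finite,linorder}) \<Rightarrow> real \<Rightarrow> (('n::{finite,linorder}) \<Rightarrow> real \<Rightarrow> 'w \<Rightarrow> real)
     \<Rightarrow> real^(('n::{finite,linorder}) + ('n::{finite,linorder})) \<Rightarrow> real \<Rightarrow> 'w \<Rightarrow> real^(('n::{finite,linorder}) + ('n::{finite,linorder}))" where
  "solution_white \<alpha> m V \<sigma> B \<psi>0 t \<omega> = mexp (t *\<^sub>R Amat \<alpha> m V) *v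
      (\<psi>0 + mexp ((- t) *\<^sub>R Amat \<alpha> m V) *v BForce m \<sigma> B t \<omega>
          + integral {0..t} (\<lambda>s. mexp ((- s) *\<^sub>R Amat \<alpha> m V) *v (Amat \<alpha> m V *v BForce m \<sigma> B s \<omega>)))"

text \<open>W(s) = int_0^\<infinity> e^{\<tau>A} sigma^2 delta(\<tau>+s) d\<tau>, the delta at the endpoint \<tau>=0 carrying half its mass.\<close>
definition Wmat_white :: "real \<Rightarrow> nat \<Rightarrow> real^(('n::{finite,linorder}))^('n::{finite,linorder}) \<Rightarrow> real \<Rightarrow> real
     \<Rightarrow> real^(('n::{finite,linorder}) + ('n::{finite,linorder}))^(('n::{finite,linorder}) + ('n::{finite,linorder}))" where
  "Wmat_white \<alpha> m V \<sigma> s = (if s < 0 then \<sigma>^2 *\<^sub>R mexp ((- s) *\<^sub>R Amat \<alpha> m V)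
      else if s = 0 then (\<sigma>^2 / 2) *\<^sub>R mat 1 else 0)"

definition stationary_limit ::
  "'w measure \<Rightarrow> real \<Rightarrow> real^(('n::finite))^('n::finite)
   \<Rightarrow> (real^(('n::finite) + ('n::finite)) \<Rightarrow> real \<Rightarrow> 'w \<Rightarrow> real^(('n::finite) + ('n::finite)))
   \<Rightarrow> (real \<Rightarrow> real^(('n::finite) + ('n::finite))^(('n::finite) + ('n::finite))) \<Rightarrow> bool" where
  "stationary_limit M \<alpha> V sol W \<longleftrightarrow>
     (\<exists>\<mu>. gaussian_vec_measure \<mu> \<and>
            (\<forall>\<psi>0. weak_conv_at_top (\<lambda>t. distr M borel (sol \<psi>0 t)) \<mu>) \<and>
            (\<integral>x. outer x x \<partial>\<mu>) = W 0 ** C_Gibbs (2 * \<alpha>) V + C_Gibbs (2 * \<alpha>) V ** transpose (W 0))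
   \<and> (\<forall>\<psi>0 s. ((\<lambda>t. \<integral>\<omega>. outer (sol \<psi>0 t \<omega>) (sol \<psi>0 (t + s) \<omega>) \<partial>M)
             \<longlongrightarrow> W s ** C_Gibbs (2 * \<alpha>) V + C_Gibbs (2 * \<alpha>) V ** transpose (W (- s))) at_top)"

end

(*
  Each damped, forced coordinate is a process G_k, and every linear functional of the solution is a
  deterministic part, which dies out, plus a pointwise limit of finite linear combinations of the
  values G_k(t).  Such limits are centred gaussian, with variances the limits of the variances, so
  everything reduces to covariances.  The hypothesis L_0 = {0} makes e^{tA} decay exponentially, and
  the Gibbs covariance C solves the Lyapunov equation A C + C A^T = -P, P being the projection onto
  the forced coordinates; hence e^{xA} P e^{yA^T} is minus the derivative of e^{xA} C e^{yA^T} along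
  the diagonal direction.  Integrating the covariance of the solution along the lines x - y = tau
  leaves the boundary values on x = 0 or y = 0, which are the two summands of the formula.  Weak
  convergence follows from the convergence of characteristic functions, by smoothing with gaussian
  kernels.
*)
theory Submission
  imports Defs
begin

section \<open>The matrix exponential\<close>


text \<open>All time integrals are pathwise. They are handled as pointwise limits of Riemann sums
  along continuous trajectories, which avoids Fubini between time and sample space. What would
  otherwise be an argument by uniform integrability is supplied by gaussianity: for centred gaussian
  variables, pointwise convergence already forces the variances to converge.

  White noise has no trajectories. After integration by parts the solution depends only on Brownian
  paths, so both kinds of forcing fit one locale, whose covariance kernel \<open>R s t\<close> is
  either \<open>Cf (t - s)\<close> or \<open>min s t\<close>.

  The inverse temperature 2 \<alpha> is the value at which the damping, acting once from each side
  of the Gibbs covariance, contributes -1/2 - 1/2 on every forced coordinate, so that the source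
  term is the projection itself and not a multiple of it.

  An exponential rate, and not merely convergence of e^{tA} to 0, is needed: it dominates the
  integrals over the lag uniformly in t. Covariances may be singular, so normal laws are encoded by
  characteristic functions and not by densities.\<close>

lemma matrix_component_eq: "(X ** Y) $ i $ j = (\<Sum>l\<in>UNIV. X $ i $ l * Y $ l $ j)"
  by (simp add: matrix_matrix_mult_def)

text \<open>The norm of a vector of vectors is the Frobenius norm; submultiplicativity is
  Cauchy-Schwarz in each entry, a row of \<open>X\<close> against a column of
  \<open>Y\<close>.\<close>

lemma norm_matrix_mult_le:
  fixes X :: "real^'k^'m" and Y :: "real^'l^'k"
  shows "norm (X ** Y) \<le> norm X * norm Y"
proof -
  have col: "norm Y ^ 2 = (\<Sum>j\<in>UNIV. norm (column j Y) ^ 2)"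
    unfolding norm_vec_def L2_set_def column_def
    by (simp add: sum_nonneg) (rule sum.swap)
  have row: "norm X ^ 2 = (\<Sum>i\<in>UNIV. norm (X $ i) ^ 2)"
    by (simp add: norm_vec_def L2_set_def sum_nonneg)
  have "norm (X ** Y) ^ 2 = (\<Sum>i\<in>UNIV. \<Sum>j\<in>UNIV. ((X ** Y) $ i $ j) ^ 2)"
    by (simp add: norm_vec_def L2_set_def sum_nonneg)
  also have "\<dots> = (\<Sum>i\<in>UNIV. \<Sum>j\<in>UNIV. (X $ i \<bullet> column j Y) ^ 2)"
    by (simp add: matrix_matrix_mult_def inner_vec_def column_def)
  also have "\<dots> \<le> (\<Sum>i\<in>UNIV. \<Sum>j\<in>UNIV. norm (X $ i) ^ 2 * norm (column j Y) ^ 2)"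
  proof (intro sum_mono)
    fix i j show "(X $ i \<bullet> column j Y) ^ 2 \<le> norm (X $ i) ^ 2 * norm (column j Y) ^ 2"
      using Cauchy_Schwarz_ineq2[of "X $ i" "column j Y"]
      by (metis abs_le_square_iff abs_mult abs_norm_cancel power_mult_distrib)
  qed
  also have "\<dots> = (norm X * norm Y) ^ 2"
    by (simp add: power_mult_distrib row col sum_product)
  finally show ?thesis by (rule power2_le_imp_le) simp
qed

text \<open>The constant \<open>norm (mat 1)\<close> stays because the Frobenius norm of the
  identity is the square root of the dimension, not 1.\<close>

lemma norm_mpow_le: "norm (mpow B n) \<le> norm (mat 1 :: real^'k^'k) * norm (B::real^'k^'k) ^ n"
proof (induction n)
  case (Suc n)
  have "norm (mpow B (Suc n)) \<le> norm B * norm (mpow B n)" by (simp add: norm_matrix_mult_le)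
  also have "\<dots> \<le> norm B * (norm (mat 1 :: real^'k^'k) * norm B ^ n)"
    by (rule mult_left_mono[OF Suc]) simp
  finally show ?case by (simp add: mult.commute mult.left_commute)
qed simp

lemma mpow_comm: "mpow B n ** B = B ** mpow B n"
  by (induction n) (simp_all add: matrix_mul_assoc[symmetric])

lemma mpow_scaleR: "mpow (t *\<^sub>R B) n = t ^ n *\<^sub>R mpow B n"
  by (induction n) (simp_all add: matrix_scalar_ac scalar_matrix_assoc[symmetric] mult.commute)

lemma summable_mexp: "summable (\<lambda>n. (1 / fact n) *\<^sub>R mpow (B::real^'k^'k) n)"
proof (rule summable_comparison_test)
  show "\<exists>N. \<forall>n\<ge>N. norm ((1 / fact n) *\<^sub>R mpow B n) \<le> norm (mat 1 :: real^'k^'k) * (norm B ^ n /\<^sub>R fact n)"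
    using norm_mpow_le[of B] by (auto simp: divide_simps)
  show "summable (\<lambda>n. norm (mat 1 :: real^'k^'k) * (norm B ^ n /\<^sub>R fact n))"
    by (intro summable_mult summable_exp_generic)
qed

text \<open>Entrywise the exponential is a scalar power series in \<open>t\<close> that converges on
  the whole line, which makes termwise differentiation available.\<close>

lemma mexp_component:
  fixes B :: "real^'k^'k"
  shows "mexp (t *\<^sub>R B) $ i $ j = (\<Sum>n. (mpow B n $ i $ j / fact n) * t ^ n)"
  and summable_mexp_component: "summable (\<lambda>n. (mpow B n $ i $ j / fact n) * t ^ n)"
proof -
  have bl: "bounded_linear (\<lambda>X::real^'k^'k. X $ i $ j)"
    by (intro bounded_linear_compose[OF bounded_linear_vec_nth] bounded_linear_vec_nth)
  have eq: "((1 / fact n) *\<^sub>R mpow (t *\<^sub>R B) n) $ i $ j = (mpow B n $ i $ j / fact n) * t ^ n" for n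
    by (simp add: mpow_scaleR)
  show "mexp (t *\<^sub>R B) $ i $ j = (\<Sum>n. (mpow B n $ i $ j / fact n) * t ^ n)"
    using bounded_linear.suminf[OF bl summable_mexp[of "t *\<^sub>R B"]] unfolding eq mexp_def .
  show "summable (\<lambda>n. (mpow B n $ i $ j / fact n) * t ^ n)"
    using bounded_linear.summable[OF bl summable_mexp[of "t *\<^sub>R B"]] unfolding eq .
qed

lemma mexp_0: "mexp (0 *\<^sub>R B) = mat 1"
proof -
  have "mexp (0 *\<^sub>R B) $ i $ j = mat 1 $ i $ j" for i j
    unfolding mexp_component powser_zero by simp
  then show ?thesis by (simp add: vec_eq_iff)
qed

text \<open>The differentiated series has coefficients \<open>mpow B (Suc n)\<close>. Splitting off
  one factor on the left gives the derivative; splitting it off on the right sums the same series to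
  the other product, hence the commutation.\<close>

lemma mexp_has_field_derivative:
  fixes B :: "real^'k^'k"
  shows "((\<lambda>t. mexp (t *\<^sub>R B) $ i $ j) has_field_derivative (B ** mexp (t *\<^sub>R B)) $ i $ j) (at t)"
    and "B ** mexp (t *\<^sub>R B) = mexp (t *\<^sub>R B) ** B"
proof -
  \<comment> \<open>The series converges everywhere; \<open>norm t + 1\<close> is just a point of
    convergence farther from 0 than \<open>t\<close>.\<close>
  have D: "((\<lambda>t. mexp (t *\<^sub>R B) $ i $ j) has_field_derivative
      (\<Sum>n. diffs (\<lambda>n. mpow B n $ i $ j / fact n) n * t ^ n)) (at t)" for i j
    unfolding mexp_component
    by (rule termdiffs_strong[OF summable_mexp_component[of B i j "norm t + 1"]]) simp
  have c: "diffs (\<lambda>n. mpow B n $ i $ j / fact n) n = mpow B (Suc n) $ i $ j / fact n" for n i j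
    unfolding diffs_def by (simp del: mpow.simps fact_Suc add: fact_reduce)
  have c1: "diffs (\<lambda>n. mpow B n $ i $ j / fact n) n * t ^ n
     = (\<Sum>l\<in>UNIV. B $ i $ l * ((mpow B n $ l $ j / fact n) * t ^ n))" for n i j
    unfolding c by (simp add: matrix_matrix_mult_def sum_distrib_right sum_divide_distrib mult.assoc)
  have c2: "diffs (\<lambda>n. mpow B n $ i $ j / fact n) n * t ^ n
     = (\<Sum>l\<in>UNIV. ((mpow B n $ i $ l / fact n) * t ^ n) * B $ l $ j)" for n i j
    unfolding c mpow.simps mpow_comm[symmetric]
    by (simp add: matrix_matrix_mult_def sum_distrib_right sum_divide_distrib mult.commute mult.left_commute sum_distrib_left)
  have s1: "(\<Sum>n. diffs (\<lambda>n. mpow B n $ i $ j / fact n) n * t ^ n) = (B ** mexp (t *\<^sub>R B)) $ i $ j" for i j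
    unfolding c1 matrix_component_eq[of B] mexp_component
    by (subst suminf_sum, rule summable_mult, rule summable_mexp_component)
       (intro sum.cong refl suminf_mult summable_mexp_component)
  have s2: "(\<Sum>n. diffs (\<lambda>n. mpow B n $ i $ j / fact n) n * t ^ n) = (mexp (t *\<^sub>R B) ** B) $ i $ j" for i j
    unfolding c2 matrix_component_eq[of _ B] mexp_component
    by (subst suminf_sum, rule summable_mult2, rule summable_mexp_component)
       (intro sum.cong refl suminf_mult2[symmetric] summable_mexp_component)
  show "((\<lambda>t. mexp (t *\<^sub>R B) $ i $ j) has_field_derivative (B ** mexp (t *\<^sub>R B)) $ i $ j) (at t)"
    using D[of i j] unfolding s1 .
  show "B ** mexp (t *\<^sub>R B) = mexp (t *\<^sub>R B) ** B"
    using s1 s2 by (simp add: vec_eq_iff)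
qed

text \<open>The product E(r - u) E(u) has derivative 0 in \<open>u\<close>, since \<open>B\<close>
  commutes with its exponential; compare \<open>u = t\<close> with \<open>u = 0\<close>.\<close>

lemma mexp_add:
  fixes B :: "real^'k^'k"
  shows "mexp ((s + t) *\<^sub>R B) = mexp (s *\<^sub>R B) ** mexp (t *\<^sub>R B)"
proof -
  define r where "r = s + t"
  define E where "E t = mexp (t *\<^sub>R B)" for t
  have "(E (r - t) ** E t) $ i $ j = (E (r - 0) ** E 0) $ i $ j" for i j
  proof (rule DERIV_isconst_all[where f = "\<lambda>u. (E (r - u) ** E u) $ i $ j"])
    show "\<forall>u. ((\<lambda>u. (E (r - u) ** E u) $ i $ j) has_real_derivative 0) (at u)"
    proof
      fix u
      have 1: "((\<lambda>u. E u $ i $ j) has_field_derivative (B ** E u) $ i $ j) (at u)" for i j u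
        unfolding E_def by (rule mexp_has_field_derivative)
      have 2: "((\<lambda>u. E (r - u) $ i $ j) has_field_derivative (E (r - u) ** B) $ i $ j * (- 1)) (at u)" for i j
        by (rule DERIV_chain2[of "\<lambda>u. E u $ i $ j"])
           (use 1[of i j "r - u"] in \<open>auto simp: E_def mexp_has_field_derivative(2)[symmetric] intro!: derivative_eq_intros\<close>)
      have "((\<lambda>u. (E (r - u) ** E u) $ i $ j) has_real_derivative
         (\<Sum>l\<in>UNIV. (E (r - u) ** B) $ i $ l * (- 1) * E u $ l $ j + (B ** E u) $ l $ j * E (r - u) $ i $ l)) (at u)"
        unfolding matrix_component_eq[of "E _" "E _"]
        by (intro DERIV_sum DERIV_mult 1 2)
      also have "(\<Sum>l\<in>UNIV. (E (r - u) ** B) $ i $ l * (- 1) * E u $ l $ j + (B ** E u) $ l $ j * E (r - u) $ i $ l)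
        = - ((E (r - u) ** B) ** E u) $ i $ j + (E (r - u) ** (B ** E u)) $ i $ j"
        unfolding matrix_component_eq[of "E _" "B ** _"] matrix_component_eq[of "_ ** B" "E _"]
        by (simp add: sum_subtractf mult.commute)
      also have "\<dots> = 0" by (simp add: matrix_mul_assoc)
      finally show "((\<lambda>u. (E (r - u) ** E u) $ i $ j) has_real_derivative 0) (at u)" .
    qed
  qed
  then have "E (r - t) ** E t = E r ** E 0" by (simp add: vec_eq_iff)
  then show ?thesis by (simp add: E_def r_def mexp_0[simplified])
qed

lemma continuous_mexp: "continuous_on S (\<lambda>t. mexp (t *\<^sub>R (B::real^'k^'k)))"
proof -
  have "continuous_on S (\<lambda>t. \<chi> i j. mexp (t *\<^sub>R B) $ i $ j)"
    by (intro continuous_on_vec_lambda continuous_at_imp_continuous_on ballI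
      DERIV_isCont[OF mexp_has_field_derivative(1)])
  then show ?thesis by simp
qed

text \<open>The semigroup law turns plain convergence into a rate: once the norm at some time
  \<open>T\<close> is at most 1/e, every further step of length \<open>T\<close> gains that factor,
  and compactness bounds the norm over the first step.\<close>

lemma mexp_decay_of_tendsto:
  fixes B :: "real^'k^'k"
  assumes lim: "((\<lambda>t. mexp (t *\<^sub>R B)) \<longlongrightarrow> 0) at_top"
  obtains K r where "K > 0" "r > 0" "\<And>t. t \<ge> 0 \<Longrightarrow> norm (mexp (t *\<^sub>R B)) \<le> K * exp (- r * t)"
proof -
  define E where "E t = mexp (t *\<^sub>R B)" for t
  have "\<forall>\<^sub>F t in at_top. norm (E t) < exp (-1)"
    using lim unfolding E_def[symmetric] tendsto_iff dist_norm by simp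
  then obtain T0 where T0: "\<And>t. t \<ge> T0 \<Longrightarrow> norm (E t) < exp (-1)"
    unfolding eventually_at_top_linorder by blast
  define T where "T = max T0 1"
  have T: "T > 0" "norm (E T) \<le> exp (-1)" using T0[of T] by (auto simp: T_def)
  have "compact (E ` {0..T})"
    unfolding E_def by (intro compact_continuous_image continuous_mexp) auto
  then obtain C where C: "\<And>t. t \<in> {0..T} \<Longrightarrow> norm (E t) \<le> C" "C > 0"
    by (metis bounded_pos compact_imp_bounded image_eqI)
  have step: "norm (E (real n * T + u)) \<le> C * exp (- real n)" if "u \<in> {0..T}" for n u
  proof (induction n)
    case 0 then show ?case using C that by simp
  next
    case (Suc n)
    have "E (real (Suc n) * T + u) = E T ** E (real n * T + u)"
      unfolding E_def mexp_add[symmetric] by (simp add: algebra_simps)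
    then have "norm (E (real (Suc n) * T + u)) \<le> norm (E T) * norm (E (real n * T + u))"
      by (simp add: norm_matrix_mult_le)
    also have "\<dots> \<le> exp (-1) * (C * exp (- real n))"
      by (intro mult_mono T Suc) auto
    also have "\<dots> = C * exp (- real (Suc n))" by (simp add: mult_exp_exp)
    finally show ?case .
  qed
  show thesis
  proof (rule that[of "C * exp 1" "1 / T"])
    fix t :: real assume t: "t \<ge> 0"
    \<comment> \<open>Rounding \<open>t / T\<close> down loses less than one step, which costs the
      factor \<open>exp 1\<close> in the constant.\<close>
    define n where "n = nat \<lfloor>t / T\<rfloor>"
    have n: "real n = of_int \<lfloor>t / T\<rfloor>" using t T by (simp add: n_def)
    have a: "real n \<le> t / T" "t / T < real n + 1" unfolding n by linarith+
    have "t - real n * T \<in> {0..T}" using a T by (auto simp: field_simps)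
    from step[OF this, of n] have "norm (E t) \<le> C * exp (- real n)" by simp
    also have "\<dots> \<le> C * exp (1 - t / T)" using C a by auto
    also have "\<dots> = C * exp 1 * exp (- (1 / T) * t)" by (simp add: mult_exp_exp)
    finally show "norm (mexp (t *\<^sub>R B)) \<le> C * exp 1 * exp (- (1 / T) * t)" by (simp add: E_def)
  qed (use C T in auto)
qed

section \<open>The Lyapunov equation for the Gibbs covariance\<close>


definition q_part :: "real^('n::finite + 'n) \<Rightarrow> real^'n" where "q_part x = (\<chi> i. x $ Inl i)"
definition p_part :: "real^('n::finite + 'n) \<Rightarrow> real^'n" where "p_part x = (\<chi> i. x $ Inr i)"

lemma sum_UNIV_Plus:
  fixes f :: "'n::finite + 'n \<Rightarrow> 'b::comm_monoid_add"
  shows "sum f UNIV = (\<Sum>i\<in>UNIV. f (Inl i)) + (\<Sum>i\<in>UNIV. f (Inr i))"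
  unfolding UNIV_Plus_UNIV[symmetric] by (subst sum.Plus) (auto simp: comp_def)

lemma inner_parts: "x \<bullet> y = q_part x \<bullet> q_part y + p_part x \<bullet> p_part y"
  by (simp add: inner_vec_def sum_UNIV_Plus q_part_def p_part_def)

lemma hamiltonian_eq: "hamiltonian V x = (p_part x \<bullet> p_part x + q_part x \<bullet> (V *v q_part x)) / 2"
proof -
  have "(\<Sum>i\<in>UNIV. \<Sum>j\<in>UNIV. V $ j $ i * x $ Inl i * x $ Inl j) = q_part x \<bullet> (V *v q_part x)"
    unfolding inner_vec_def matrix_vector_mult_def q_part_def
    by (subst sum.swap) (simp add: sum_distrib_left ac_simps)
  moreover have "(\<Sum>i\<in>UNIV. (x $ Inr i)\<^sup>2) = p_part x \<bullet> p_part x"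
    by (simp add: inner_vec_def p_part_def power2_eq_square)
  ultimately show ?thesis unfolding hamiltonian_def by (simp add: field_simps)
qed

lemma hamiltonian_scaleR: "hamiltonian V (r *\<^sub>R x) = r^2 * hamiltonian V x"
proof -
  have "q_part (r *\<^sub>R x) = r *\<^sub>R q_part x" "p_part (r *\<^sub>R x) = r *\<^sub>R p_part x"
    by (simp_all add: q_part_def p_part_def vec_eq_iff)
  then show ?thesis
    by (simp add: hamiltonian_eq matrix_vector_mult_scaleR power2_eq_square algebra_simps)
qed

text \<open>The constant is the minimum of the energy over the unit sphere, positive by compactness;
  homogeneity of degree two extends the bound to all vectors.\<close>

lemma hamiltonian_lower_bound:
  assumes V: "V \<in> H_Gamma E"
  obtains c where "c > 0" "\<And>x. c * norm x ^ 2 \<le> hamiltonian V x"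
proof -
  have pos: "hamiltonian V x > 0" if "x \<noteq> 0" for x
  proof (cases "q_part x = 0")
    case True
    then have "x \<bullet> x = p_part x \<bullet> p_part x" by (simp add: inner_parts)
    with that have "p_part x \<bullet> p_part x > 0" by (metis inner_gt_zero_iff)
    with True show ?thesis by (simp add: hamiltonian_eq)
  next
    case False
    then have "q_part x \<bullet> (V *v q_part x) > 0" using V by (simp add: H_Gamma_def)
    then show ?thesis by (simp add: hamiltonian_eq add_nonneg_pos)
  qed
  have cont: "continuous_on (sphere 0 1) (hamiltonian V)"
    unfolding hamiltonian_def by (intro continuous_intros)
  have "axis undefined 1 \<in> (sphere 0 1 :: (real^('a + 'a)) set)" by (simp add: norm_eq_sqrt_inner inner_axis_axis)
  then have ne: "(sphere 0 1 :: (real^('a + 'a)) set) \<noteq> {}" by blast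
  obtain y where y: "y \<in> sphere 0 1" "\<And>x. x \<in> sphere 0 1 \<Longrightarrow> hamiltonian V y \<le> hamiltonian V x"
    using continuous_attains_inf[OF compact_sphere ne cont] by blast
  show thesis
  proof (rule that)
    show "hamiltonian V y > 0" using y pos[of y] by force
    fix x
    show "hamiltonian V y * norm x ^ 2 \<le> hamiltonian V x"
    proof (cases "x = 0")
      case True then show ?thesis using hamiltonian_scaleR[of V 0 0] by simp
    next
      case False
      have "hamiltonian V x = norm x ^ 2 * hamiltonian V (x /\<^sub>R norm x)"
        using hamiltonian_scaleR[of V "norm x" "x /\<^sub>R norm x"] False by simp
      moreover have "hamiltonian V y \<le> hamiltonian V (x /\<^sub>R norm x)"
        using False by (intro y(2)) simp
      ultimately show ?thesis by (metis mult.commute mult_left_mono zero_le_power2)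
    qed
  qed
qed

text \<open>Coercivity and continuity make decay of the energy equivalent to decay of the vector. In
  the second form the condition is linear in \<open>x\<close>.\<close>

lemma L_minus_iff:
  assumes V: "V \<in> H_Gamma E"
  shows "x \<in> L_minus \<alpha> m V \<longleftrightarrow> ((\<lambda>t. mexp (t *\<^sub>R Amat \<alpha> m V) *v x) \<longlongrightarrow> 0) at_top"
proof
  obtain c where c: "c > 0" "\<And>x. c * norm x ^ 2 \<le> hamiltonian V x"
    using hamiltonian_lower_bound[OF V] by blast
  let ?f = "\<lambda>t. mexp (t *\<^sub>R Amat \<alpha> m V) *v x"
  {
    assume "x \<in> L_minus \<alpha> m V"
    then have H: "((\<lambda>t. hamiltonian V (?f t) / c) \<longlongrightarrow> 0) at_top"
      unfolding L_minus_def by (auto intro: tendsto_divide_zero)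
    have "((\<lambda>t. norm (?f t) ^ 2) \<longlongrightarrow> 0) at_top"
      by (rule tendsto_sandwich[OF _ _ tendsto_const H])
        (use c in \<open>auto simp: field_simps intro!: always_eventually\<close>)
    then have "((\<lambda>t. sqrt (norm (?f t) ^ 2)) \<longlongrightarrow> sqrt 0) at_top" by (rule tendsto_real_sqrt)
    then show "(?f \<longlongrightarrow> 0) at_top" by (simp add: tendsto_norm_zero_iff)
  }
  assume "(?f \<longlongrightarrow> 0) at_top"
  moreover have "isCont (hamiltonian V) 0"
    unfolding hamiltonian_def by (intro continuous_intros)
  ultimately have "((\<lambda>t. hamiltonian V (?f t)) \<longlongrightarrow> hamiltonian V 0) at_top"
    by (rule isCont_tendsto_compose[rotated])
  then show "x \<in> L_minus \<alpha> m V"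
    unfolding L_minus_def using hamiltonian_scaleR[of V 0 0] by simp
qed

text \<open>\<open>L_minus\<close> is a subspace whose orthogonal complement is trivial, hence the
  whole space; the columns of e^{tA} are the orbits of the basis vectors.\<close>

lemma mexp_Amat_tendsto_0:
  assumes V: "V \<in> H_Gamma E" and L0: "L_zero \<alpha> m V = {0}"
  shows "((\<lambda>t. mexp (t *\<^sub>R Amat \<alpha> m V)) \<longlongrightarrow> 0) at_top"
proof -
  have sub: "subspace (L_minus \<alpha> m V)"
    unfolding subspace_def
  proof (intro conjI ballI allI)
    show "0 \<in> L_minus \<alpha> m V" by (simp add: L_minus_iff[OF V])
    fix x y assume "x \<in> L_minus \<alpha> m V" "y \<in> L_minus \<alpha> m V"
    then show "x + y \<in> L_minus \<alpha> m V"
      unfolding L_minus_iff[OF V] matrix_vector_right_distrib by (rule tendsto_add_zero)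
  next
    fix c x assume "x \<in> L_minus \<alpha> m V"
    then show "c *\<^sub>R x \<in> L_minus \<alpha> m V"
      unfolding L_minus_iff[OF V] matrix_vector_mult_scaleR
      using tendsto_scaleR[OF tendsto_const, of _ 0 at_top c] by simp
  qed
  have all: "x \<in> L_minus \<alpha> m V" for x
  proof -
    obtain y z where yz: "y \<in> span (L_minus \<alpha> m V)" "\<And>w. w \<in> span (L_minus \<alpha> m V) \<Longrightarrow> orthogonal z w" "x = y + z"
      using orthogonal_subspace_decomp_exists[of "L_minus \<alpha> m V" x] by blast
    have "z \<in> L_zero \<alpha> m V"
      using yz(2) span_base unfolding L_zero_def orthogonal_def by blast
    then have "z = 0" using L0 by simp
    with yz show ?thesis using span_eq_iff[THEN iffD2, OF sub] by simp
  qed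
  have "((\<lambda>t. mexp (t *\<^sub>R Amat \<alpha> m V) $ i $ j) \<longlongrightarrow> 0 $ i $ j) at_top" for i j
    using tendsto_vec_nth[OF all[of "axis j 1", unfolded L_minus_iff[OF V]], of i]
    by (simp add: matrix_vector_mult_basis column_def)
  then show ?thesis by (intro vec_tendstoI) simp
qed

section \<open>Adjoint dynamics against the Gibbs covariance\<close>

lemma q_part_transpose_Amat: "q_part (transpose (Amat \<alpha> m V) *v x) = - (transpose V *v p_part x)"
  by (simp add: q_part_def p_part_def vec_eq_iff matrix_vector_mult_def transpose_def Amat_def sum_UNIV_Plus sum_negf)

lemma p_part_transpose_Amat:
  "p_part (transpose (Amat \<alpha> m V) *v x) = q_part x - \<alpha> *\<^sub>R (\<chi> k. if damped m k then p_part x $ k else 0)"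
proof -
  have "p_part (transpose (Amat \<alpha> m V) *v x) $ k = (q_part x - \<alpha> *\<^sub>R (\<chi> k. if damped m k then p_part x $ k else 0)) $ k" for k
  proof -
    have 1: "(\<Sum>i\<in>UNIV. (if i = k then 1 else 0) * x $ Inl i) = x $ Inl k"
      by (simp add: if_distrib if_distribR sum.delta' cong: if_cong)
    have "(\<Sum>i\<in>UNIV. (if i = k \<and> damped m i then - \<alpha> else 0) * x $ Inr i)
       = (\<Sum>i\<in>UNIV. if i = k then (if damped m k then - \<alpha> * x $ Inr k else 0) else 0)"
      by (intro sum.cong) auto
    also have "\<dots> = (if damped m k then - \<alpha> * x $ Inr k else 0)" by (simp add: sum.delta')
    finally show ?thesis using 1
      by (simp add: q_part_def p_part_def matrix_vector_mult_def transpose_def Amat_def sum_UNIV_Plus)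
  qed
  then show ?thesis by (simp add: vec_eq_iff)
qed

lemma q_part_C_Gibbs: "q_part (C_Gibbs \<beta> V *v x) = (1 / \<beta>) *\<^sub>R (matrix_inv V *v q_part x)"
  by (simp add: q_part_def vec_eq_iff matrix_vector_mult_def C_Gibbs_def sum_UNIV_Plus sum_divide_distrib)

lemma p_part_C_Gibbs: "p_part (C_Gibbs \<beta> V *v x) = (1 / \<beta>) *\<^sub>R p_part x"
  by (simp add: p_part_def vec_eq_iff matrix_vector_mult_def C_Gibbs_def sum_UNIV_Plus
      if_distrib if_distribR sum.delta cong: if_cong)

lemma H_Gamma_transpose: "V \<in> H_Gamma E \<Longrightarrow> transpose V = V"
  by (auto simp: H_Gamma_def transpose_def vec_eq_iff)

lemma H_Gamma_inv:
  assumes V: "V \<in> H_Gamma E"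
  shows "V ** matrix_inv V = mat 1" "matrix_inv V ** V = mat 1"
    "transpose (matrix_inv V) = matrix_inv V"
proof -
  have "inj ((*v) V)"
    unfolding matrix_left_invertible_injective[symmetric] matrix_left_invertible_ker
    using V unfolding H_Gamma_def by (metis (mono_tags, lifting) inner_zero_right less_irrefl mem_Collect_eq)
  then have inv: "invertible V"
    by (simp add: invertible_left_inverse matrix_left_invertible_injective)
  show 1: "V ** matrix_inv V = mat 1" and 2: "matrix_inv V ** V = mat 1"
    using someI_ex[OF inv[unfolded invertible_def]] unfolding matrix_inv_def by auto
  have "transpose (matrix_inv V) ** V = mat 1"
    using arg_cong[OF 1, of transpose] by (simp add: matrix_transpose_mul H_Gamma_transpose[OF V] transpose_mat)
  then have "transpose (matrix_inv V) ** V ** matrix_inv V = matrix_inv V" by simp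
  then show "transpose (matrix_inv V) = matrix_inv V"
    unfolding matrix_mul_assoc[symmetric] 1 by simp
qed

lemma transpose_C_Gibbs: "V \<in> H_Gamma E \<Longrightarrow> transpose (C_Gibbs \<beta> V) = C_Gibbs \<beta> V"
  using H_Gamma_inv(3)[of V E]
  by (auto simp: C_Gibbs_def transpose_def vec_eq_iff split: sum.splits)

lemma inner_matrix_vector_left: "(X *v x) \<bullet> y = x \<bullet> (transpose X *v (y::real^'m))"
  for X :: "real^'k^'m"
  by (metis adjoint_matrix adjoint_works matrix_vector_mul_linear inner_commute)

text \<open>This is A C + C A^T = -P tested on \<open>a\<close> and \<open>b\<close>. The
  conservative part of A drops out: \<open>V\<close> cancels its inverse in the terms that couple
  positions with momenta, and what remains is antisymmetric. The damping enters twice, each time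
  with \<alpha> / (2 \<alpha>) = 1/2.\<close>

lemma lyapunov_C_Gibbs:
  fixes V :: "real^('n::{finite,linorder})^('n::{finite,linorder})"
  assumes V: "V \<in> H_Gamma E" and alpha: "\<alpha> > 0"
  shows "(transpose (Amat \<alpha> m V) *v a) \<bullet> (C_Gibbs (2 * \<alpha>) V *v b)
      + a \<bullet> (C_Gibbs (2 * \<alpha>) V *v (transpose (Amat \<alpha> m V) *v b))
      = - (\<Sum>k\<in>{k. damped m k}. a $ Inr k * b $ Inr k)"
proof -
  note [simp] = H_Gamma_transpose[OF V]
  define D where "D x = (\<chi> k. if damped m k then p_part x $ k else 0)" for x :: "real^('n + 'n)"
  have d: "D x \<bullet> p_part y = (\<Sum>k\<in>{k. damped m k}. x $ Inr k * y $ Inr k)" for x y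
    unfolding D_def p_part_def inner_vec_def by (simp add: if_distrib if_distribR sum.If_cases cong: if_cong)
  have d': "p_part x \<bullet> D y = D x \<bullet> p_part y" for x y
    unfolding D_def inner_vec_def by (intro sum.cong) auto
  have v: "(V *v x) \<bullet> (matrix_inv V *v y) = x \<bullet> y" for x y
    by (simp add: inner_matrix_vector_left matrix_vector_mul_assoc H_Gamma_inv(1)[OF V])
  have v': "matrix_inv V *v (V *v x) = x" for x
    by (simp add: matrix_vector_mul_assoc H_Gamma_inv(2)[OF V])
  have neg: "X *v (- x) = - (X *v x)" for X :: "((real, 'n) vec, 'n) vec" and x
    using matrix_vector_mult_scaleR[of X "-1" x] by simp
  show ?thesis
    unfolding inner_parts[of "_ *v _"] inner_parts[of a] q_part_transpose_Amat p_part_transpose_Amat q_part_C_Gibbs p_part_C_Gibbs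
      D_def[symmetric]
    using alpha
    by (simp add: v v' neg d[symmetric] d' inner_diff_left inner_diff_right inner_commute[of "p_part b"] inner_commute[of "q_part b"] field_simps)
qed

section \<open>Gaussian laws\<close>


lemma abs_integral_le:
  fixes f g :: "'a \<Rightarrow> real"
  shows "integrable M f \<Longrightarrow> integrable M g \<Longrightarrow> (\<And>x. x \<in> space M \<Longrightarrow> \<bar>f x\<bar> \<le> g x)
    \<Longrightarrow> \<bar>\<integral>x. f x \<partial>M\<bar> \<le> (\<integral>x. g x \<partial>M)"
  by (rule order_trans[OF integral_norm_bound[of M f, unfolded real_norm_def]])
     (auto intro!: integral_mono)

text \<open>\<open>X\<close> is centred normal with variance \<open>v\<close>. The encoding by the
  characteristic function needs no separate clause for \<open>v = 0\<close> and is well suited to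
  limits.\<close>

definition normal_rv :: "'w measure \<Rightarrow> real \<Rightarrow> ('w \<Rightarrow> real) \<Rightarrow> bool" where
  "normal_rv M v X \<longleftrightarrow> X \<in> borel_measurable M \<and> v \<ge> 0 \<and>
     (\<forall>u. (CLINT \<omega>|M. iexp (u * X \<omega>)) = of_real (exp (- (u\<^sup>2 * v) / 2)))"

definition normal_dist :: "real \<Rightarrow> real \<Rightarrow> real measure" where
  "normal_dist \<mu> \<sigma> = (if \<sigma> = 0 then return borel \<mu> else density lborel (normal_density \<mu> \<sigma>))"

interpretation std_normal: real_distribution std_normal_distribution
  by (rule real_dist_normal_dist)

text \<open>An affine image of the standard normal law covers the Dirac and the density case at
  once, so moments and characteristic functions need no case distinction.\<close>

lemma normal_dist_eq_distr:
  assumes "\<sigma> \<ge> 0"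
  shows "normal_dist \<mu> \<sigma> = distr std_normal_distribution borel (\<lambda>x. \<mu> + \<sigma> * x)"
proof (cases "\<sigma> = 0")
  case True
  then show ?thesis by (simp add: normal_dist_def std_normal.distr_const)
next
  case False
  have "distributed std_normal_distribution lborel (\<lambda>x. x) std_normal_density"
    unfolding distributed_def by (auto simp: distr_id2)
  from std_normal.normal_density_affine[OF this, of \<sigma> \<mu>] False assms
  have "distr std_normal_distribution lborel (\<lambda>x. \<mu> + \<sigma> * x) = density lborel (normal_density \<mu> \<sigma>)"
    unfolding distributed_def by simp
  also have "distr std_normal_distribution lborel (\<lambda>x. \<mu> + \<sigma> * x) = distr std_normal_distribution borel (\<lambda>x. \<mu> + \<sigma> * x)"
    by (rule distr_cong) auto
  finally show ?thesis using False by (simp add: normal_dist_def)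
qed

lemma real_distribution_normal_dist: "\<sigma> \<ge> 0 \<Longrightarrow> real_distribution (normal_dist \<mu> \<sigma>)"
  unfolding normal_dist_eq_distr by (intro std_normal.real_distribution_distr) simp

lemma std_normal_moments:
  "integrable std_normal_distribution (\<lambda>x. x)" "(LINT x|std_normal_distribution. x) = 0"
  "integrable std_normal_distribution (\<lambda>x. x\<^sup>2)" "(LINT x|std_normal_distribution. x\<^sup>2) = 1"
  using integrable_std_normal_distribution_moment[of 1] integrable_std_normal_distribution_moment[of 2]
    integral_std_normal_distribution_moment_odd[of 1] std_normal_distribution_even_moments(1)[of 1]
  by (simp_all add: numeral_2_eq_2)

lemma normal_dist_moments:
  assumes "\<sigma> \<ge> 0"
  shows "integrable (normal_dist \<mu> \<sigma>) (\<lambda>x. x)" "(LINT x|normal_dist \<mu> \<sigma>. x) = \<mu>"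
    "integrable (normal_dist \<mu> \<sigma>) (\<lambda>x. x\<^sup>2)" "(LINT x|normal_dist \<mu> \<sigma>. x\<^sup>2) = \<mu>\<^sup>2 + \<sigma>\<^sup>2"
  unfolding normal_dist_eq_distr[OF assms]
  by (simp_all add: integrable_distr_eq integral_distr power2_sum power_mult_distrib std_normal_moments
      mult.assoc[symmetric] std_normal.prob_space[simplified])

lemma char_normal_dist:
  assumes "\<sigma> \<ge> 0"
  shows "char (normal_dist \<mu> \<sigma>) u = iexp (u * \<mu>) * of_real (exp (- (u\<^sup>2 * \<sigma>\<^sup>2) / 2))"
proof -
  have "char (normal_dist \<mu> \<sigma>) u = (CLINT x|std_normal_distribution. iexp (u * \<mu>) * iexp (u * \<sigma> * x))"
    unfolding normal_dist_eq_distr[OF assms] char_def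
    by (subst integral_distr) (auto simp: exp_add[symmetric] algebra_simps)
  also have "\<dots> = iexp (u * \<mu>) * char std_normal_distribution (u * \<sigma>)"
    unfolding char_def by (rule integral_mult_right_zero)
  finally show ?thesis by (simp add: char_std_normal_distribution power_mult_distrib)
qed

lemma gaussian_measure_iff: "gaussian_measure \<nu> \<longleftrightarrow> (\<exists>\<mu> \<sigma>. \<sigma> \<ge> 0 \<and> \<nu> = normal_dist \<mu> \<sigma>)"
  by (simp add: gaussian_measure_def normal_dist_def)

context prob_space begin

lemma char_distr: "X \<in> borel_measurable M \<Longrightarrow> char (distr M borel X) u = (CLINT \<omega>|M. iexp (u * X \<omega>))"
  by (simp add: char_def integral_distr)

text \<open>Levy's uniqueness theorem links the encoding by characteristic functions to the law
  itself, from which the moments are read.\<close>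

lemma normal_rv_iff_distr:
  "normal_rv M v X \<longleftrightarrow> X \<in> borel_measurable M \<and> v \<ge> 0 \<and> distr M borel X = normal_dist 0 (sqrt v)"
proof (cases "X \<in> borel_measurable M \<and> v \<ge> 0")
  case True
  then have X: "X \<in> borel_measurable M" and v: "v \<ge> 0" by auto
  have "distr M borel X = normal_dist 0 (sqrt v) \<longleftrightarrow> char (distr M borel X) = char (normal_dist 0 (sqrt v))"
    using Levy_uniqueness[OF real_distribution_distr[OF X] real_distribution_normal_dist[of "sqrt v" 0]] v
    by auto
  also have "\<dots> \<longleftrightarrow> (\<forall>u. (CLINT \<omega>|M. iexp (u * X \<omega>)) = of_real (exp (- (u\<^sup>2 * v) / 2)))"
    using v by (simp add: fun_eq_iff char_distr[OF X] char_normal_dist)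
  finally show ?thesis using True by (simp add: normal_rv_def)
qed (auto simp: normal_rv_def)

lemma normal_rv_of_gaussian_measure:
  assumes "gaussian_measure (distr M borel X)" "X \<in> borel_measurable M" "expectation X = 0"
  shows "\<exists>v. normal_rv M v X"
proof -
  obtain \<mu> \<sigma> where *: "\<sigma> \<ge> 0" "distr M borel X = normal_dist \<mu> \<sigma>"
    using assms(1) by (auto simp: gaussian_measure_iff)
  have "\<mu> = (LINT x|distr M borel X. x)" using *(1) by (simp add: *(2) normal_dist_moments)
  also have "\<dots> = expectation X" by (simp add: integral_distr assms(2))
  finally have "normal_rv M (\<sigma>\<^sup>2) X"
    using * assms by (simp add: normal_rv_iff_distr)
  then show ?thesis ..
qed

lemma normal_rv_gaussian_measure: "normal_rv M v X \<Longrightarrow> gaussian_measure (distr M borel X)"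
  unfolding normal_rv_iff_distr gaussian_measure_iff by (metis real_sqrt_ge_zero)

lemma normal_rv_moments:
  assumes "normal_rv M v X"
  shows "integrable M X" "expectation X = 0"
    "integrable M (\<lambda>\<omega>. (X \<omega>)\<^sup>2)" "expectation (\<lambda>\<omega>. (X \<omega>)\<^sup>2) = v"
proof -
  have X[measurable]: "X \<in> borel_measurable M" and v: "v \<ge> 0" and d: "distr M borel X = normal_dist 0 (sqrt v)"
    using assms by (auto simp: normal_rv_iff_distr)
  note m = normal_dist_moments[of "sqrt v" 0, folded d]
  show "integrable M X" "expectation X = 0"
    "integrable M (\<lambda>\<omega>. (X \<omega>)\<^sup>2)" "expectation (\<lambda>\<omega>. (X \<omega>)\<^sup>2) = v"
    using m v by (simp_all add: integrable_distr_eq integral_distr)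
qed

text \<open>Since the characteristic functions converge pointwise and the limit is continuous
  and equals 1 at 0, the variances must converge.\<close>
lemma normal_rv_limit:
  assumes X: "\<And>n. normal_rv M (v n) (X n)" and Y: "Y \<in> borel_measurable M"
    and lim: "\<And>\<omega>. \<omega> \<in> space M \<Longrightarrow> (\<lambda>n. X n \<omega>) \<longlonglongrightarrow> Y \<omega>"
  shows "\<exists>w. v \<longlonglongrightarrow> w \<and> normal_rv M w Y"
proof -
  have [measurable]: "X n \<in> borel_measurable M" for n using X by (simp add: normal_rv_def)
  note Y[measurable]
  interpret D: real_distribution "distr M borel Y" by (rule real_distribution_distr[OF Y])
  define \<phi> where "\<phi> u = (CLINT \<omega>|M. iexp (u * Y \<omega>))" for u
  have conv: "(\<lambda>n. of_real (exp (- (u\<^sup>2 * v n) / 2))) \<longlonglongrightarrow> \<phi> u" for u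
  proof -
    have "(\<lambda>n. CLINT \<omega>|M. iexp (u * X n \<omega>)) \<longlonglongrightarrow> \<phi> u"
      unfolding \<phi>_def
    proof (rule integral_dominated_convergence[where w = "\<lambda>_. 1"])
      show "AE \<omega> in M. (\<lambda>n. iexp (u * X n \<omega>)) \<longlonglongrightarrow> iexp (u * Y \<omega>)"
        by (intro AE_I2 tendsto_intros lim)
    qed auto
    then show ?thesis using X by (simp add: normal_rv_def)
  qed
  have "char (distr M borel Y) = \<phi>" by (simp add: \<phi>_def char_distr[OF Y] fun_eq_iff)
  then have "isCont \<phi> 0" using D.isCont_char[of 0] by simp
  moreover have "\<phi> 0 \<noteq> 0" by (simp add: \<phi>_def prob_space)
  \<comment> \<open>A variance escaping to infinity would make the limit vanish at every nonzero
    \<open>u\<close>. Continuity at 0 yields some nonzero \<open>u\<close> where \<phi> does not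
    vanish, and a logarithm at this single \<open>u\<close> recovers the limit of the
    variances.\<close>
  ultimately have "\<forall>\<^sub>F u in at 0. \<phi> u \<noteq> 0"
    unfolding isCont_def by (rule tendsto_imp_eventually_ne)
  then obtain e where e: "e > 0" "\<And>u. u \<noteq> 0 \<Longrightarrow> \<bar>u\<bar> < e \<Longrightarrow> \<phi> u \<noteq> 0"
    by (auto simp: eventually_at dist_real_def)
  define u where "u = e / 2"
  have u: "u > 0" "\<phi> u \<noteq> 0" using e by (auto simp: u_def)
  have c: "(\<lambda>n. exp (- (u\<^sup>2 * v n) / 2)) \<longlonglongrightarrow> Re (\<phi> u)"
    using tendsto_Re[OF conv[of u]] by simp
  have "\<phi> u = of_real (Re (\<phi> u))"
    using LIMSEQ_unique[OF conv[of u] tendsto_of_real[OF c]] .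
  with u(2) have ne: "Re (\<phi> u) \<noteq> 0" by (metis of_real_0)
  have "(\<lambda>n. - 2 / u\<^sup>2 * ln (exp (- (u\<^sup>2 * v n) / 2))) \<longlonglongrightarrow> - 2 / u\<^sup>2 * ln (Re (\<phi> u))"
    by (intro tendsto_mult tendsto_const tendsto_ln c ne)
  then have v: "v \<longlonglongrightarrow> - 2 / u\<^sup>2 * ln (Re (\<phi> u))" (is "_ \<longlonglongrightarrow> ?w") using u by simp
  have "?w \<ge> 0" by (rule LIMSEQ_le_const[OF v]) (use X in \<open>auto simp: normal_rv_def\<close>)
  moreover have "\<phi> u' = of_real (exp (- (u'\<^sup>2 * ?w) / 2))" for u'
    by (rule LIMSEQ_unique[OF conv]) (intro tendsto_intros v, simp)
  ultimately show ?thesis using v Y unfolding normal_rv_def \<phi>_def by blast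
qed

end

section \<open>Centred multivariate normal laws\<close>

lemma outer_component: "outer x y $ i $ j = x $ i * y $ j"
  by (simp add: outer_def)

text \<open>An entry may be taken inside the Bochner integral once the matrix-valued function is
  integrable; expanding it over the matrices with a single entry 1 derives this from the scalar
  hypotheses.\<close>

lemma integral_outer_component:
  fixes X Y :: "'w \<Rightarrow> real^'k"
  assumes int: "\<And>i j. integrable M (\<lambda>\<omega>. X \<omega> $ i * Y \<omega> $ j)"
  shows "(\<integral>\<omega>. outer (X \<omega>) (Y \<omega>) \<partial>M) $ i $ j = (\<integral>\<omega>. X \<omega> $ i * Y \<omega> $ j \<partial>M)"
proof -
  have "outer x y = (\<Sum>i\<in>UNIV. \<Sum>j\<in>UNIV. (x $ i * y $ j) *\<^sub>R axis i (axis j 1))" for x y :: "real^'k"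
  proof -
    have "(\<Sum>k\<in>UNIV. \<Sum>l\<in>UNIV. (x $ k * y $ l) *\<^sub>R axis k (axis l (1::real))) $ i $ j
        = (\<Sum>k\<in>UNIV. if k = i then x $ i * y $ j else 0)" for i j
      unfolding sum_component
    proof (intro sum.cong refl)
      fix k
      have "(\<Sum>l\<in>UNIV. ((x $ k * y $ l) *\<^sub>R axis k (axis l (1::real))) $ i $ j)
        = (\<Sum>l\<in>UNIV. if l = j then (if k = i then x $ i * y $ j else 0) else 0)"
        by (intro sum.cong) (auto simp: axis_def)
      also have "\<dots> = (if k = i then x $ i * y $ j else 0)"
        by (simp add: sum.delta)
      finally show "(\<Sum>l\<in>UNIV. ((x $ k * y $ l) *\<^sub>R axis k (axis l (1::real))) $ i $ j)
        = (if k = i then x $ i * y $ j else 0)" .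
    qed
    then show ?thesis by (simp add: vec_eq_iff outer_def)
  qed
  then have "integrable M (\<lambda>\<omega>. outer (X \<omega>) (Y \<omega>))"
    by (simp add: int)
  then have "(\<integral>\<omega>. outer (X \<omega>) (Y \<omega>) \<partial>M) $ i $ j = (\<integral>\<omega>. outer (X \<omega>) (Y \<omega>) $ i $ j \<partial>M)"
    by (intro integral_bounded_linear[symmetric, where T = "\<lambda>X. X $ i $ j"]
        bounded_linear_compose[OF bounded_linear_vec_nth] bounded_linear_vec_nth)
  then show ?thesis by (simp add: outer_component)
qed

text \<open>The centred normal law with covariance \<open>S\<close>, where \<open>S\<close> may be
  singular.\<close>

definition normal_law :: "(real^'k) measure \<Rightarrow> real^'k^'k \<Rightarrow> bool" where
  "normal_law \<mu> S \<longleftrightarrow> prob_space \<mu> \<and> sets \<mu> = sets borel \<and>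
     (\<forall>c. (CLINT x|\<mu>. iexp (c \<bullet> x)) = of_real (exp (- (c \<bullet> (S *v c)) / 2)))"

lemma inner_symmetric:
  assumes "transpose S = (S :: real^'k^'k)"
  shows "(S *v x) \<bullet> y = x \<bullet> (S *v y)"
  by (simp add: inner_matrix_vector_left assms)

lemma psd_quadratic:
  fixes S :: "real^'k^'k"
  assumes sym: "transpose S = S"
  shows "(x - r *\<^sub>R y) \<bullet> (S *v (x - r *\<^sub>R y)) = x \<bullet> (S *v x) - 2 * r * (x \<bullet> (S *v y)) + r\<^sup>2 * (y \<bullet> (S *v y))"
  using inner_symmetric[OF sym, of x y] inner_commute[of y "S *v x"]
  by (simp add: matrix_vector_mult_diff_distrib matrix_vector_mult_scaleR inner_diff_left
      inner_diff_right power2_eq_square algebra_simps)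

lemma inner_axis_matrix: "axis i 1 \<bullet> (S *v axis j 1) = (S :: real^'k^'k) $ i $ j"
  by (simp add: matrix_vector_mult_basis column_def inner_axis')

text \<open>With a zero diagonal entry the form is affine in \<open>r\<close> along
  \<open>x - r *\<^sub>R axis j 1\<close>; a nonzero slope would make it negative. The chosen
  \<open>r\<close> gives the value -1.\<close>

lemma psd_zero_diagonal:
  fixes S :: "real^'k^'k"
  assumes sym: "transpose S = S" and psd: "\<And>c. c \<bullet> (S *v c) \<ge> 0" and z: "S $ j $ j = 0"
  shows "x \<bullet> (S *v axis j 1) = 0"
proof (rule ccontr)
  assume ne: "x \<bullet> (S *v axis j 1) \<noteq> 0" (is "?b \<noteq> 0")
  define r where "r = (x \<bullet> (S *v x) + 1) / (2 * ?b)"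
  have "0 \<le> x \<bullet> (S *v x) - 2 * r * ?b"
    using psd[of "x - r *\<^sub>R axis j 1"] z by (simp add: psd_quadratic[OF sym] inner_axis_matrix)
  also have "\<dots> = -1" using ne by (simp add: r_def) (simp add: field_simps)
  finally show False by simp
qed

text \<open>If X has law \<open>\<mu>\<close> and Z is an independent standard normal variable, then
  X + Z v has the covariance enlarged by the rank one matrix of \<open>v\<close>.\<close>

lemma normal_law_add_line:
  assumes N: "normal_law \<mu> S"
  shows "\<exists>\<nu>. normal_law \<nu> (S + outer v v)"
proof -
  interpret \<mu>: prob_space \<mu> using N by (simp add: normal_law_def)
  interpret P: pair_prob_space \<mu> std_normal_distribution ..
  have [measurable_cong]: "sets \<mu> = sets borel" using N by (simp add: normal_law_def)
  let ?f = "\<lambda>(x, z). x + z *\<^sub>R v"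
  let ?\<nu> = "distr (\<mu> \<Otimes>\<^sub>M std_normal_distribution) borel ?f"
  have f[measurable]: "?f \<in> borel_measurable (\<mu> \<Otimes>\<^sub>M std_normal_distribution)" by measurable
  have "(CLINT x|?\<nu>. iexp (c \<bullet> x)) = of_real (exp (- (c \<bullet> ((S + outer v v) *v c)) / 2))" for c
  proof -
    have "outer v v *v c = (c \<bullet> v) *\<^sub>R v"
      by (simp add: vec_eq_iff outer_def matrix_vector_mult_def inner_vec_def sum_distrib_left ac_simps)
    then have q: "c \<bullet> ((S + outer v v) *v c) = c \<bullet> (S *v c) + (c \<bullet> v)\<^sup>2"
      by (simp add: matrix_vector_mult_add_rdistrib inner_add_right power2_eq_square)
    have "(CLINT x|?\<nu>. iexp (c \<bullet> x)) = (CLINT p|(\<mu> \<Otimes>\<^sub>M std_normal_distribution). (\<lambda>(x,z). iexp (c \<bullet> x) * iexp ((c \<bullet> v) * z)) p)"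
      by (subst integral_distr) (auto simp: split_beta' inner_add_right exp_add[symmetric] algebra_simps intro!: Bochner_Integration.integral_cong)
    also have "\<dots> = (CLINT x|\<mu>. CLINT z|std_normal_distribution. iexp (c \<bullet> x) * iexp ((c \<bullet> v) * z))"
      by (subst P.integral_fst'[symmetric])
         (auto simp: split_beta' norm_mult intro!: P.integrable_const_bound[where B = 1])
    also have "\<dots> = (CLINT x|\<mu>. iexp (c \<bullet> x)) * char std_normal_distribution (c \<bullet> v)"
      by (simp add: char_def)
    also have "\<dots> = of_real (exp (- (c \<bullet> ((S + outer v v) *v c)) / 2))"
      using N by (simp add: normal_law_def char_std_normal_distribution q exp_add[symmetric] of_real_mult[symmetric] add_divide_distrib
          del: of_real_mult)
    finally show ?thesis .
  qed
  then have "normal_law ?\<nu> (S + outer v v)"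
    using P.prob_space_distr[OF f] by (simp add: normal_law_def)
  then show ?thesis ..
qed

text \<open>Cholesky elimination: removing the rank one part of a nonzero pivot leaves a positive
  semidefinite Schur complement with fewer nonzero diagonal entries, and
  \<open>normal_law_add_line\<close> puts the removed part back.\<close>

lemma normal_law_exists:
  fixes S :: "real^'k^'k"
  assumes "transpose S = S" and "\<And>c. c \<bullet> (S *v c) \<ge> 0"
  shows "\<exists>\<mu>. normal_law \<mu> S"
  using assms
proof (induction "card {i. S $ i $ i \<noteq> 0}" arbitrary: S rule: less_induct)
  case less
  note sym = less.prems(1) and psd = less.prems(2)
  show ?case
  proof (cases "\<exists>i. S $ i $ i \<noteq> 0")
    case False
    then have "S $ i $ j = 0" for i j
      using psd_zero_diagonal[OF sym psd, of j "axis i 1"] by (simp add: inner_axis_matrix)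
    then have "S = 0" by (simp add: vec_eq_iff)
    moreover have "normal_law (return borel 0) (0::real^'k^'k)"
      by (auto simp: normal_law_def prob_space_return integral_return)
    ultimately show ?thesis by blast
  next
    case True
    then obtain i where i: "S $ i $ i \<noteq> 0" by blast
    have d: "S $ i $ i > 0" using psd[of "axis i 1"] i by (simp add: inner_axis_matrix)
    \<comment> \<open>The pivot column, scaled so that \<open>outer v v\<close> agrees with
      \<open>S\<close> on row and column \<open>i\<close>.\<close>
    define v where "v = (1 / sqrt (S $ i $ i)) *\<^sub>R (S *v axis i 1)"
    define S' where "S' = S - outer v v"
    have vj: "v $ j = S $ j $ i / sqrt (S $ i $ i)" for j
      by (simp add: v_def matrix_vector_mult_basis column_def)
    have q: "c \<bullet> (S' *v c) = c \<bullet> (S *v c) - (c \<bullet> (S *v axis i 1))\<^sup>2 / (S $ i $ i)" for c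
    proof -
      have "outer v v *v c = (c \<bullet> v) *\<^sub>R v"
        by (simp add: vec_eq_iff outer_def matrix_vector_mult_def inner_vec_def sum_distrib_left ac_simps)
      then have "c \<bullet> (S' *v c) = c \<bullet> (S *v c) - (c \<bullet> v)\<^sup>2"
        by (simp add: S'_def matrix_vector_mult_diff_rdistrib inner_diff_right power2_eq_square)
      then show ?thesis using d by (simp add: v_def power_divide)
    qed
    have sym': "transpose S' = S'"
      using sym by (auto simp: S'_def transpose_def outer_def vec_eq_iff mult.commute)
    have psd': "c \<bullet> (S' *v c) \<ge> 0" for c
    proof -
      \<comment> \<open>This \<open>r\<close> minimises the form along
        \<open>c - r *\<^sub>R axis i 1\<close>; the minimum is the value of the Schur complement at
        \<open>c\<close>.\<close>
      define r where "r = (c \<bullet> (S *v axis i 1)) / (S $ i $ i)"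
      have "0 \<le> c \<bullet> (S *v c) - 2 * r * (c \<bullet> (S *v axis i 1)) + r\<^sup>2 * (S $ i $ i)"
        using psd[of "c - r *\<^sub>R axis i 1"] by (simp add: psd_quadratic[OF sym] inner_axis_matrix)
      also have "\<dots> = c \<bullet> (S' *v c)"
        unfolding q r_def using d by (simp add: power2_eq_square field_simps)
      finally show ?thesis .
    qed
    \<comment> \<open>The pivot disappears, and no new nonzero diagonal entry arises, because a zero
      diagonal entry of \<open>S\<close> forces its whole row and column to be zero.\<close>
    have "{j. S' $ j $ j \<noteq> 0} \<subset> {j. S $ j $ j \<noteq> 0}"
    proof
      have "S' $ i $ i = 0" using d by (simp add: S'_def outer_def vj power2_eq_square[symmetric])
      then show "{j. S' $ j $ j \<noteq> 0} \<noteq> {j. S $ j $ j \<noteq> 0}" using i by blast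
      show "{j. S' $ j $ j \<noteq> 0} \<subseteq> {j. S $ j $ j \<noteq> 0}"
      proof clarify
        fix j assume "S' $ j $ j \<noteq> 0" "S $ j $ j = 0"
        moreover from this have "S $ i $ j = 0"
          using psd_zero_diagonal[OF sym psd, of j "axis i 1"] by (simp add: inner_axis_matrix)
        then have "S $ j $ i = 0" using sym by (metis transpose_def vec_lambda_beta)
        ultimately show False by (simp add: S'_def outer_def vj)
      qed
    qed
    then have "card {j. S' $ j $ j \<noteq> 0} < card {j. S $ j $ j \<noteq> 0}"
      by (intro psubset_card_mono) auto
    from less.hyps[OF this sym' psd'] obtain \<mu> where "normal_law \<mu> S'" by blast
    from normal_law_add_line[OF this, of v] show ?thesis by (simp add: S'_def)
  qed
qed

lemma normal_law_normal_rv: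
  assumes N: "normal_law \<mu> S" and S: "\<And>c. c \<bullet> (S *v c) \<ge> 0"
  shows "normal_rv \<mu> (c \<bullet> (S *v c)) (\<lambda>x. c \<bullet> x)"
proof -
  have [measurable_cong]: "sets \<mu> = sets borel" using N by (simp add: normal_law_def)
  have "(CLINT x|\<mu>. iexp (u * (c \<bullet> x))) = of_real (exp (- (u\<^sup>2 * (c \<bullet> (S *v c))) / 2))" for u
    using N[unfolded normal_law_def, THEN conjunct2, THEN conjunct2, rule_format, of "u *\<^sub>R c"]
    by (simp add: matrix_vector_mult_scaleR power2_eq_square mult.assoc)
  then show ?thesis using S by (simp add: normal_rv_def)
qed

lemma normal_law_gaussian_vec:
  assumes N: "normal_law \<mu> S" and S: "\<And>c. c \<bullet> (S *v c) \<ge> 0"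
  shows "gaussian_vec_measure \<mu>"
  using prob_space.normal_rv_gaussian_measure[OF _ normal_law_normal_rv[OF N S]] N
  by (simp add: gaussian_vec_measure_def normal_law_def)

text \<open>By polarisation the mixed moments follow from the variances of the one-dimensional
  projections.\<close>

lemma normal_law_covariance:
  assumes N: "normal_law \<mu> S" and sym: "transpose S = S" and S: "\<And>c. c \<bullet> (S *v c) \<ge> 0"
  shows "(\<integral>x. outer x x \<partial>\<mu>) = S"
proof -
  interpret prob_space \<mu> using N by (simp add: normal_law_def)
  note m = normal_rv_moments[OF normal_law_normal_rv[OF N S]]
  have e: "x $ i * x $ j = (((axis i 1 + axis j 1) \<bullet> x)\<^sup>2 - (axis i 1 \<bullet> x)\<^sup>2 - (axis j 1 \<bullet> x)\<^sup>2) / 2"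
    for x :: "real^'a" and i j
    by (simp add: inner_add_left inner_axis' power2_eq_square algebra_simps)
  have i: "integrable \<mu> (\<lambda>x. x $ i * x $ j)" for i j
    unfolding e using m by (intro Bochner_Integration.integrable_diff integrable_divide) auto
  have "(\<integral>x. x $ i * x $ j \<partial>\<mu>) = S $ i $ j" for i j
  proof -
    have "(\<integral>x. x $ i * x $ j \<partial>\<mu>) = ((axis i 1 + axis j 1) \<bullet> (S *v (axis i 1 + axis j 1))
       - axis i 1 \<bullet> (S *v axis i 1) - axis j 1 \<bullet> (S *v axis j 1)) / 2"
      unfolding e using m by simp
    also have "\<dots> = (S $ i $ j + S $ j $ i) / 2"
      by (simp add: matrix_vector_right_distrib inner_add_left inner_add_right inner_axis_matrix)
    also have "S $ j $ i = S $ i $ j" using sym by (metis transpose_def vec_lambda_beta)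
    finally show ?thesis by simp
  qed
  then show ?thesis by (simp add: vec_eq_iff integral_outer_component[OF i])
qed

section \<open>Weak convergence from characteristic functions\<close>


text \<open>Two roles: up to normalisation, the normal density with covariance 1/c times the
  identity; and, as it stands, the characteristic function of the normal law with covariance
  \<open>c\<close> times the identity.\<close>

definition gauss_kernel :: "real \<Rightarrow> 'a::euclidean_space \<Rightarrow> real" where
  "gauss_kernel c y = exp (- (c * (norm y)\<^sup>2) / 2)"

lemma gauss_kernel_nonneg: "gauss_kernel c y \<ge> 0"
  by (simp add: gauss_kernel_def)

lemma gauss_kernel_le_1: "c \<ge> 0 \<Longrightarrow> gauss_kernel c y \<le> 1"
  by (simp add: gauss_kernel_def)

lemma borel_measurable_gauss_kernel[measurable]: "gauss_kernel c \<in> borel_measurable borel"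
  unfolding gauss_kernel_def by measurable

text \<open>The kernel factors over the coordinates into multiples of one-dimensional normal
  densities with deviation \<open>1 / sqrt c\<close>.\<close>

lemma integrable_gauss_kernel:
  assumes c: "c > 0"
  shows "integrable lborel (gauss_kernel c :: 'a::euclidean_space \<Rightarrow> real)"
proof (rule integrableI_nonneg)
  define s where "s = 1 / sqrt c"
  have s: "s > 0" "s\<^sup>2 = 1 / c" using c by (auto simp: s_def power_divide)
  have "exp (- (c * x\<^sup>2) / 2) = sqrt (2 * pi * s\<^sup>2) * normal_density 0 s x" for x :: real
    using s c unfolding normal_density_def by (simp add: field_simps)
  then have int1: "integrable lborel (\<lambda>x::real. exp (- (c * x\<^sup>2) / 2))" using s by simp
  have fin: "(\<integral>\<^sup>+x. ennreal (exp (- (c * x\<^sup>2) / 2)) \<partial>lborel) < \<infinity>"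
    by (subst nn_integral_eq_integral[OF int1]) auto
  have n: "(norm y)\<^sup>2 = (\<Sum>b\<in>Basis. (y \<bullet> b)\<^sup>2)" for y :: 'a
    unfolding power2_norm_eq_inner by (subst euclidean_inner) (simp add: power2_eq_square)
  have "gauss_kernel c y = (\<Prod>b\<in>Basis. exp (- (c * (y \<bullet> b)\<^sup>2) / 2))" for y :: 'a
    unfolding gauss_kernel_def n by (simp add: exp_sum[symmetric] sum_negf sum_divide_distrib sum_distrib_left)
  then have "(\<integral>\<^sup>+(y::'a). gauss_kernel c y \<partial>lborel) = (\<integral>\<^sup>+(y::'a). (\<Prod>b\<in>Basis. ennreal (exp (- (c * (y \<bullet> b)\<^sup>2) / 2))) \<partial>lborel)"
    by (simp add: prod_ennreal)
  also have "\<dots> = (\<Prod>b\<in>(Basis::'a set). (\<integral>\<^sup>+x. exp (- (c * x\<^sup>2) / 2) \<partial>lborel))"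
    by (subst nn_integral_lborel_prod) auto
  also have "\<dots> < \<infinity>"
    using fin by (simp add: power_less_top_ennreal)
  finally show "(\<integral>\<^sup>+y. gauss_kernel c (y::'a) \<partial>lborel) < \<infinity>" .
qed (simp_all add: gauss_kernel_nonneg)

lemma
  fixes f :: "'a::euclidean_space \<Rightarrow> real"
  assumes f: "integrable lborel f"
  shows integrable_translate: "integrable lborel (\<lambda>a. f (c + a))"
    and integral_translate: "(\<integral>a. f (c + a) \<partial>lborel) = (\<integral>a. f a \<partial>lborel)"
proof -
  have [measurable]: "f \<in> borel_measurable borel" using f by simp
  have f': "integrable (distr lborel borel ((+) c)) f" using f by (simp add: lborel_distr_plus)
  show "integrable lborel (\<lambda>a. f (c + a))"
    using f' by (subst (asm) integrable_distr_eq) auto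
  have "(\<integral>a. f (c + a) \<partial>lborel) = (\<integral>a. f a \<partial>distr lborel borel ((+) c))"
    by (subst integral_distr) auto
  then show "(\<integral>a. f (c + a) \<partial>lborel) = (\<integral>a. f a \<partial>lborel)" by (simp add: lborel_distr_plus)
qed

lemma gauss_kernel_shift: "gauss_kernel c (x - a) = gauss_kernel c (- x + a)"
  unfolding gauss_kernel_def using norm_minus_commute[of x a] by simp

lemma
  fixes x :: "'a::euclidean_space"
  assumes c: "c > 0"
  shows integrable_gauss_kernel_shift: "integrable lborel (\<lambda>a. gauss_kernel c (x - a))"
    and integral_gauss_kernel_shift: "(\<integral>a. gauss_kernel c (x - a) \<partial>lborel) = (\<integral>a. gauss_kernel c (a::'a) \<partial>lborel)"
  unfolding gauss_kernel_shift
  by (rule integrable_translate integral_translate, rule integrable_gauss_kernel[OF c])+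

text \<open>One unit of the exponent is kept for integrability in \<open>y\<close>; the remaining
  \<open>c - 1\<close> give a factor that is small uniformly outside the ball.\<close>

lemma gauss_kernel_tail:
  assumes "norm y \<ge> \<delta>" "\<delta> \<ge> 0" "c \<ge> 1"
  shows "gauss_kernel c y \<le> exp (- ((c - 1) * \<delta>\<^sup>2) / 2) * gauss_kernel 1 y"
proof -
  have "(c - 1) * \<delta>\<^sup>2 \<le> (c - 1) * (norm y)\<^sup>2"
    using assms by (intro mult_left_mono power_mono) auto
  then show ?thesis
    by (simp add: gauss_kernel_def exp_add[symmetric] algebra_simps)
qed

text \<open>Using the ball of half the radius, this bound decays like exp(-c \<delta>^2 / 8), more
  slowly than the tail factor exp(-c \<delta>^2 / 2). Their comparison makes the exact normalisation
  irrelevant.\<close>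

lemma gauss_kernel_total_ge:
  assumes "\<delta> > 0" "c > 0"
  shows "(\<integral>a. gauss_kernel c (a::'a::euclidean_space) \<partial>lborel)
     \<ge> exp (- (c * (\<delta>/2)\<^sup>2) / 2) * measure lborel (ball (0::'a) (\<delta>/2))"
proof -
  have "(\<integral>a. exp (- (c * (\<delta>/2)\<^sup>2) / 2) * indicator (ball (0::'a) (\<delta>/2)) a \<partial>lborel) \<le> (\<integral>a. gauss_kernel c (a::'a) \<partial>lborel)"
  proof (intro integral_mono integrable_gauss_kernel assms)
    show "integrable lborel (\<lambda>a. exp (- (c * (\<delta>/2)\<^sup>2) / 2) * indicator (ball (0::'a) (\<delta>/2)) a)"
      using emeasure_lborel_ball_finite[of "0::'a" "\<delta>/2"] by (intro integrable_mult_right) auto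
    fix a :: 'a
    show "exp (- (c * (\<delta>/2)\<^sup>2) / 2) * indicator (ball 0 (\<delta>/2)) a \<le> gauss_kernel c a"
    proof (cases "a \<in> ball 0 (\<delta>/2)")
      case True
      then have "c * (norm a)\<^sup>2 \<le> c * (\<delta>/2)\<^sup>2"
        using assms by (intro mult_left_mono power_mono) auto
      with True show ?thesis by (simp add: gauss_kernel_def)
    qed (simp add: gauss_kernel_nonneg)
  qed
  then show ?thesis by simp
qed

text \<open>The normalised kernel is an approximate identity: near \<open>x\<close> uniform
  continuity of \<open>h\<close> applies, far from \<open>x\<close> the kernel carries a vanishing
  share of its mass.\<close>

lemma gauss_smoothing_uniform:
  fixes h :: "'a::euclidean_space \<Rightarrow> real"
  assumes h: "continuous_on UNIV h" and supp: "\<And>x. norm x > R \<Longrightarrow> h x = 0"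
    and B: "\<And>x. \<bar>h x\<bar> \<le> B" and e: "e > 0"
  obtains c where "c > 0" "\<And>x. \<bar>(\<integral>a. h a * gauss_kernel c (x - a) \<partial>lborel) / (\<integral>a. gauss_kernel c (a::'a) \<partial>lborel) - h x\<bar> \<le> e"
proof -
  have [measurable]: "h \<in> borel_measurable borel" using h by (simp add: borel_measurable_continuous_onI)
  have "uniformly_continuous_on (cball 0 (R + 1)) h"
    by (intro compact_uniformly_continuous continuous_on_subset[OF h]) auto
  then obtain d where d: "d > 0" "\<And>x y. x \<in> cball 0 (R+1) \<Longrightarrow> y \<in> cball 0 (R+1) \<Longrightarrow> dist y x < d \<Longrightarrow> dist (h y) (h x) < e/2"
    unfolding uniformly_continuous_on_def using e by (metis half_gt_zero)
  \<comment> \<open>The bound by 1 keeps both points inside the ball of radius \<open>R + 1\<close>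
    as soon as one of them lies within \<open>R\<close>.\<close>
  define \<delta> where "\<delta> = min d 1"
  have \<delta>: "\<delta> > 0" "\<delta> \<le> 1" "\<delta> \<le> d" using d by (auto simp: \<delta>_def)
  have close: "\<bar>h a - h x\<bar> \<le> e / 2" if "norm (x - a) < \<delta>" for x a
  proof (cases "norm x > R \<and> norm a > R")
    case True then show ?thesis using supp[of x] supp[of a] e by simp
  next
    case False
    then have "norm x \<le> R + 1" "norm a \<le> R + 1"
      using that \<delta> norm_triangle_sub[of x a] norm_triangle_sub[of a x] by (auto simp: norm_minus_commute)
    then show ?thesis using d(2)[of x a] that \<delta> by (auto simp: dist_norm norm_minus_commute)
  qed
  define N where "N c = (\<integral>a. gauss_kernel c (a::'a) \<partial>lborel)" for c
  define vol where "vol = measure lborel (ball (0::'a) (\<delta>/2))"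
  have vol: "vol > 0" unfolding vol_def using \<delta> content_ball_pos[of "\<delta>/2" "0::'a"] by simp
  have N: "N c \<ge> exp (- (c * (\<delta>/2)\<^sup>2) / 2) * vol" if "c > 0" for c
    unfolding N_def vol_def by (rule gauss_kernel_total_ge[OF \<delta>(1) that])
  have Npos: "N c > 0" if "c > 0" for c
    using N[OF that] vol by (smt (verit) exp_gt_zero mult_pos_pos)
  have B0: "B \<ge> 0" using B[of 0] by linarith
  \<comment> \<open>\<open>C\<close> collects the constants of tail over total mass. The exponent
    below is 1/2 - 1/8 = 3/8, and \<open>exp (\<delta>\<^sup>2 / 2)\<close> accounts for
    \<open>c - 1\<close> in place of \<open>c\<close> in the tail.\<close>
  define C where "C = 2 * B * exp (\<delta>\<^sup>2 / 2) * N 1 / vol"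
  have "((\<lambda>c. C * exp (- (3 * \<delta>\<^sup>2 / 8) * c)) \<longlongrightarrow> C * 0) at_top"
  proof (intro tendsto_mult tendsto_const filterlim_compose[OF exp_at_bot])
    show "filterlim (\<lambda>c. - (3 * \<delta>\<^sup>2 / 8) * c) at_bot at_top"
      using \<delta> by (intro filterlim_tendsto_neg_mult_at_bot[OF tendsto_const] filterlim_ident) auto
  qed
  then have "\<forall>\<^sub>F c in at_top. C * exp (- (3 * \<delta>\<^sup>2 / 8) * c) < e / 2"
    using e by (auto dest!: order_tendstoD(2)[where a = "e/2"])
  then have "\<forall>\<^sub>F c in at_top. C * exp (- (3 * \<delta>\<^sup>2 / 8) * c) < e / 2 \<and> c \<ge> 1"
    by (intro eventually_conj eventually_ge_at_top)
  then obtain c where c: "C * exp (- (3 * \<delta>\<^sup>2 / 8) * c) < e / 2" "c \<ge> 1"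
    by (metis (no_types, lifting) eventually_at_top_linorder order_refl)
  then have c0: "c > 0" by simp
  define T where "T = exp (- ((c - 1) * \<delta>\<^sup>2) / 2)"
  show thesis
  proof (rule that[OF c0])
    fix x
    note iK = integrable_gauss_kernel_shift
    have iN: "(\<integral>a. gauss_kernel c (x - a) \<partial>lborel) = N c" if "c > 0" for c and x :: 'a
      unfolding N_def by (rule integral_gauss_kernel_shift[OF that])
    have ih: "integrable lborel (\<lambda>a. h a * gauss_kernel c (x - a))"
    proof (rule Bochner_Integration.integrable_bound[OF integrable_mult_right[OF iK[OF c0, of x], of B]])
      show "AE a in lborel. norm (h a * gauss_kernel c (x - a)) \<le> norm (B * gauss_kernel c (x - a))"
        using B B0 by (auto simp: abs_mult gauss_kernel_nonneg intro!: mult_right_mono)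
    qed measurable
    have "\<bar>(\<integral>a. h a * gauss_kernel c (x - a) \<partial>lborel) - N c * h x\<bar>
      = \<bar>(\<integral>a. h a * gauss_kernel c (x - a) \<partial>lborel) - (\<integral>a. h x * gauss_kernel c (x - a) \<partial>lborel)\<bar>"
      by (simp add: iN[OF c0] mult.commute)
    also have "\<dots> = \<bar>\<integral>a. h a * gauss_kernel c (x - a) - h x * gauss_kernel c (x - a) \<partial>lborel\<bar>"
      by (subst Bochner_Integration.integral_diff) (auto intro: ih iK[OF c0])
    also have "\<dots> \<le> (\<integral>a. e / 2 * gauss_kernel c (x - a) + 2 * B * T * gauss_kernel 1 (x - a) \<partial>lborel)"
    proof (rule abs_integral_le)
      show "integrable lborel (\<lambda>a. h a * gauss_kernel c (x - a) - h x * gauss_kernel c (x - a))"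
        by (intro Bochner_Integration.integrable_diff ih integrable_mult_right iK c0)
      show "integrable lborel (\<lambda>a. e / 2 * gauss_kernel c (x - a) + 2 * B * T * gauss_kernel 1 (x - a))"
        by (intro Bochner_Integration.integrable_add integrable_mult_right iK c0) simp
      fix a
      have "\<bar>h a * gauss_kernel c (x - a) - h x * gauss_kernel c (x - a)\<bar> = \<bar>h a - h x\<bar> * gauss_kernel c (x - a)"
        by (simp add: left_diff_distrib[symmetric] abs_mult gauss_kernel_nonneg)
      also have "\<dots> \<le> e / 2 * gauss_kernel c (x - a) + 2 * B * T * gauss_kernel 1 (x - a)"
      proof (cases "norm (x - a) < \<delta>")
        case True
        have "\<bar>h a - h x\<bar> * gauss_kernel c (x - a) \<le> e / 2 * gauss_kernel c (x - a)"
          by (intro mult_right_mono close True gauss_kernel_nonneg)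
        moreover have "2 * B * T * gauss_kernel 1 (x - a) \<ge> 0"
          using B0 by (simp add: T_def gauss_kernel_nonneg)
        ultimately show ?thesis by linarith
      next
        case False
        have "\<bar>h a - h x\<bar> \<le> 2 * B" using B[of a] B[of x] by linarith
        then have "\<bar>h a - h x\<bar> * gauss_kernel c (x - a) \<le> 2 * B * (T * gauss_kernel 1 (x - a))"
          unfolding T_def using False \<delta> c
          by (intro mult_mono gauss_kernel_tail gauss_kernel_nonneg) auto
        moreover have "e / 2 * gauss_kernel c (x - a) \<ge> 0"
          using e by (simp add: gauss_kernel_nonneg)
        ultimately show ?thesis by linarith
      qed
      finally show "\<bar>h a * gauss_kernel c (x - a) - h x * gauss_kernel c (x - a)\<bar>
        \<le> e / 2 * gauss_kernel c (x - a) + 2 * B * T * gauss_kernel 1 (x - a)" .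
    qed
    also have "\<dots> = e / 2 * N c + 2 * B * T * N 1"
      by (subst Bochner_Integration.integral_add) (auto simp: iN[OF c0] iN[of 1] iK[OF c0] iK[of 1])
    also have "2 * B * T * N 1 \<le> e / 2 * N c"
    proof -
      have TT: "T = exp (\<delta>\<^sup>2 / 2) * exp (- (3 * \<delta>\<^sup>2 / 8) * c) * exp (- (c * (\<delta>/2)\<^sup>2) / 2)"
        unfolding T_def exp_add[symmetric] by (simp add: field_simps power2_eq_square)
      have "2 * B * T * N 1 = C * exp (- (3 * \<delta>\<^sup>2 / 8) * c) * (exp (- (c * (\<delta>/2)\<^sup>2) / 2) * vol)"
        unfolding C_def TT using vol by simp
      also have "\<dots> \<le> e / 2 * N c"
        using c(1) N[OF c0] vol e by (intro mult_mono) auto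
      finally show ?thesis .
    qed
    finally have *: "\<bar>(\<integral>a. h a * gauss_kernel c (x - a) \<partial>lborel) - N c * h x\<bar> \<le> e * N c" by simp
    have "(\<integral>a. h a * gauss_kernel c (x - a) \<partial>lborel) / N c - h x
       = ((\<integral>a. h a * gauss_kernel c (x - a) \<partial>lborel) - N c * h x) / N c"
      using Npos[OF c0] by (simp add: field_simps)
    then have "\<bar>(\<integral>a. h a * gauss_kernel c (x - a) \<partial>lborel) / N c - h x\<bar>
      = \<bar>(\<integral>a. h a * gauss_kernel c (x - a) \<partial>lborel) - N c * h x\<bar> / N c"
      using Npos[OF c0] by simp
    also have "\<dots> \<le> e" using * Npos[OF c0] by (simp add: divide_le_eq)
    finally show "\<bar>(\<integral>a. h a * gauss_kernel c (x - a) \<partial>lborel) / (\<integral>a. gauss_kernel c (a::'a) \<partial>lborel) - h x\<bar> \<le> e"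
      unfolding N_def .
  qed
qed

section \<open>From characteristic functions to integrals of continuous functions\<close>

text \<open>The kernel is the expectation of exp(i sqrt(c) (x - a).z) over a standard normal vector
  z. Fubini then expresses its integral through the characteristic function of \<open>P\<close>,
  averaged over the probability law of z.\<close>

lemma gauss_kernel_fourier:
  fixes P :: "(real^'k) measure"
  assumes P: "prob_space P" "sets P = sets borel" and \<gamma>: "normal_law \<gamma> (mat 1 :: real^'k^'k)" and c: "c \<ge> 0"
  shows "of_real (\<integral>x. gauss_kernel c (x - a) \<partial>P)
     = (CLINT z|\<gamma>. iexp (- sqrt c * (a \<bullet> z)) * (CLINT x|P. iexp ((sqrt c *\<^sub>R z) \<bullet> x)))"
    "(\<lambda>z. CLINT x|P. iexp ((sqrt c *\<^sub>R z) \<bullet> x)) \<in> borel_measurable \<gamma>"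
proof -
  interpret Q: prob_space P by fact
  interpret \<gamma>: prob_space \<gamma> using \<gamma> by (simp add: normal_law_def)
  interpret PP: pair_prob_space P \<gamma> ..
  have [measurable_cong]: "sets P = sets borel" "sets \<gamma> = sets borel" using P \<gamma> by (auto simp: normal_law_def)
  have 1: "(CLINT z|\<gamma>. iexp (sqrt c * ((x - a) \<bullet> z))) = of_real (gauss_kernel c (x - a))" for x
    using \<gamma>[unfolded normal_law_def, THEN conjunct2, THEN conjunct2, rule_format, of "sqrt c *\<^sub>R (x - a)"] c
    by (simp add: gauss_kernel_def dot_square_norm power2_norm_eq_inner[symmetric] mult.assoc[symmetric] power_mult_distrib)
  have "of_real (\<integral>x. gauss_kernel c (x - a) \<partial>P) = (CLINT x|P. of_real (gauss_kernel c (x - a)))"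
    by (rule integral_complex_of_real[symmetric])
  also have "\<dots> = (CLINT x|P. CLINT z|\<gamma>. iexp (sqrt c * ((x - a) \<bullet> z)))" by (simp only: 1)
  also have "\<dots> = (CLINT z|\<gamma>. CLINT x|P. iexp (sqrt c * ((x - a) \<bullet> z)))"
    by (rule PP.Fubini_integral[symmetric]) (auto intro!: PP.integrable_const_bound[where B = 1] simp: split_beta')
  also have "\<dots> = (CLINT z|\<gamma>. CLINT x|P. iexp (- sqrt c * (a \<bullet> z)) * iexp ((sqrt c *\<^sub>R z) \<bullet> x))"
    by (intro Bochner_Integration.integral_cong refl)
       (simp add: exp_add[symmetric] inner_diff_left inner_commute algebra_simps)
  also have "\<dots> = (CLINT z|\<gamma>. iexp (- sqrt c * (a \<bullet> z)) * (CLINT x|P. iexp ((sqrt c *\<^sub>R z) \<bullet> x)))"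
    by (subst integral_mult_right_zero) simp
  finally show "of_real (\<integral>x. gauss_kernel c (x - a) \<partial>P)
     = (CLINT z|\<gamma>. iexp (- sqrt c * (a \<bullet> z)) * (CLINT x|P. iexp ((sqrt c *\<^sub>R z) \<bullet> x)))" .
  show "(\<lambda>z. CLINT x|P. iexp ((sqrt c *\<^sub>R z) \<bullet> x)) \<in> borel_measurable \<gamma>"
    by measurable
qed

text \<open>Dominated convergence in the auxiliary normal variable: characteristic functions are
  bounded by 1.\<close>

lemma gauss_kernel_conv:
  fixes P :: "nat \<Rightarrow> (real^'k) measure"
  assumes P: "\<And>n. prob_space (P n)" "\<And>n. sets (P n) = sets borel"
    and \<mu>: "prob_space \<mu>" "sets \<mu> = sets borel"
    and char: "\<And>c. (\<lambda>n. CLINT x|P n. iexp (c \<bullet> x)) \<longlonglongrightarrow> (CLINT x|\<mu>. iexp (c \<bullet> x))"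
    and c: "c \<ge> 0"
  shows "(\<lambda>n. \<integral>x. gauss_kernel c (x - a) \<partial>P n) \<longlonglongrightarrow> (\<integral>x. gauss_kernel c (x - a) \<partial>\<mu>)"
proof -
  obtain \<gamma> where \<gamma>: "normal_law \<gamma> (mat 1 :: real^'k^'k)"
    using normal_law_exists[of "mat 1 :: real^'k^'k"] by auto
  interpret \<gamma>: prob_space \<gamma> using \<gamma> by (simp add: normal_law_def)
  have [measurable_cong]: "sets \<gamma> = sets borel" using \<gamma> by (auto simp: normal_law_def)
  note F = gauss_kernel_fourier(1)[OF _ _ \<gamma> c] and M = gauss_kernel_fourier(2)[OF _ _ \<gamma> c]
  have "(\<lambda>n. complex_of_real (\<integral>x. gauss_kernel c (x - a) \<partial>P n)) \<longlonglongrightarrow> of_real (\<integral>x. gauss_kernel c (x - a) \<partial>\<mu>)"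
    unfolding F[OF P] F[OF \<mu>]
  proof (rule integral_dominated_convergence[where w = "\<lambda>_. 1"])
    show "AE z in \<gamma>. (\<lambda>n. iexp (- sqrt c * (a \<bullet> z)) * (CLINT x|P n. iexp ((sqrt c *\<^sub>R z) \<bullet> x)))
      \<longlonglongrightarrow> iexp (- sqrt c * (a \<bullet> z)) * (CLINT x|\<mu>. iexp ((sqrt c *\<^sub>R z) \<bullet> x))"
      by (intro AE_I2 tendsto_mult tendsto_const char)
    show "AE z in \<gamma>. norm (iexp (- sqrt c * (a \<bullet> z)) * (CLINT x|P n. iexp ((sqrt c *\<^sub>R z) \<bullet> x))) \<le> 1" for n
    proof (rule AE_I2)
      fix z
      interpret Pn: prob_space "P n" by (rule P)
      have "norm (CLINT x|P n. iexp ((sqrt c *\<^sub>R z) \<bullet> x)) \<le> (\<integral>x. norm (iexp ((sqrt c *\<^sub>R z) \<bullet> x)) \<partial>P n)"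
        by (rule integral_norm_bound)
      also have "\<dots> = 1" by (simp add: Pn.prob_space)
      finally show "norm (iexp (- sqrt c * (a \<bullet> z)) * (CLINT x|P n. iexp ((sqrt c *\<^sub>R z) \<bullet> x))) \<le> 1"
        by (simp add: norm_mult)
    qed
    show "(\<lambda>z. iexp (- sqrt c * (a \<bullet> z)) * (CLINT x|\<mu>. iexp ((sqrt c *\<^sub>R z) \<bullet> x))) \<in> borel_measurable \<gamma>"
      by (rule borel_measurable_times[OF _ M[OF \<mu>]]) measurable
    show "(\<lambda>z. iexp (- sqrt c * (a \<bullet> z)) * (CLINT x|P n. iexp ((sqrt c *\<^sub>R z) \<bullet> x))) \<in> borel_measurable \<gamma>" for n
      by (rule borel_measurable_times[OF _ M[OF P]]) measurable
  qed auto
  then show ?thesis using tendsto_of_real_iff by blast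
qed

text \<open>\<open>h\<close> is replaced by a uniformly close smoothing, whose integral is an
  average over centres \<open>a\<close> of kernel integrals; for each of these convergence is
  known.\<close>

lemma weak_conv_compact_support:
  fixes P :: "nat \<Rightarrow> (real^'k) measure"
  assumes P: "\<And>n. prob_space (P n)" "\<And>n. sets (P n) = sets borel"
    and \<mu>: "prob_space \<mu>" "sets \<mu> = sets borel"
    and char: "\<And>c. (\<lambda>n. CLINT x|P n. iexp (c \<bullet> x)) \<longlonglongrightarrow> (CLINT x|\<mu>. iexp (c \<bullet> x))"
    and h: "continuous_on UNIV h" and supp: "\<And>x. norm x > R \<Longrightarrow> h x = 0"
    and B: "\<And>x. \<bar>h x\<bar> \<le> B"
  shows "(\<lambda>n. \<integral>x. h x \<partial>P n) \<longlonglongrightarrow> (\<integral>x. h x \<partial>\<mu> :: real)"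
proof (rule LIMSEQ_I)
  fix r :: real assume r: "r > 0"
  have [measurable]: "h \<in> borel_measurable borel" using h by (simp add: borel_measurable_continuous_onI)
  have r4: "r / 4 > 0" using r by simp
  obtain c where c: "c > 0" and close: "\<And>x. \<bar>(\<integral>a. h a * gauss_kernel c (x - a) \<partial>lborel) /
      (\<integral>a. gauss_kernel c (a::real^'k) \<partial>lborel) - h x\<bar> \<le> r / 4"
    by (rule gauss_smoothing_uniform[OF h supp B r4]) (rule that | assumption)+
  define N where "N = (\<integral>a. gauss_kernel c (a::real^'k) \<partial>lborel)"
  define g where "g x = (\<integral>a. h a * gauss_kernel c (x - a) \<partial>lborel) / N" for x
  have close: "\<bar>g x - h x\<bar> \<le> r / 4" for x using close by (simp add: g_def N_def)
  have hint: "integrable lborel h"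
  proof (rule Bochner_Integration.integrable_bound[where f = "\<lambda>x. B * indicator (cball 0 R) x"])
    show "integrable lborel (\<lambda>x. B * indicator (cball 0 R) x)"
      using emeasure_lborel_cball_finite[of 0 R] by (intro integrable_mult_right) auto
    show "AE x in lborel. norm (h x) \<le> norm (B * indicator (cball 0 R) x)"
    proof (rule AE_I2)
      fix x show "norm (h x) \<le> norm (B * indicator (cball 0 R) x)"
        using supp[of x] B[of x] by (cases "norm x > R") (auto simp: indicator_def)
    qed
  qed simp
  have gint: "integrable Q g" "(\<integral>x. g x \<partial>Q) = (\<integral>a. h a * (\<integral>x. gauss_kernel c (x - a) \<partial>Q) \<partial>lborel) / N"
    and hintQ: "integrable Q h"
    if Q: "prob_space Q" "sets Q = sets borel" for Q
  proof -
    interpret Q: prob_space Q by fact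
    interpret pair_sigma_finite Q "lborel :: (real^'k) measure" ..
    have [measurable_cong]: "sets Q = sets borel" by fact
    show "integrable Q h" by (rule Q.integrable_const_bound[of _ B]) (use B in auto)
    \<comment> \<open>\<open>Q\<close> has mass 1 and the kernel is at most 1, so \<open>h\<close>,
      bounded with compact support, dominates on the product space.\<close>
    have i1: "integrable (Q \<Otimes>\<^sub>M lborel) (\<lambda>(x, a). h a)"
    proof (rule integrableI_bounded)
      have "(\<integral>\<^sup>+p. ennreal (norm (case p of (x, a) \<Rightarrow> h a)) \<partial>(Q \<Otimes>\<^sub>M lborel)) = (\<integral>\<^sup>+x. \<integral>\<^sup>+a. ennreal \<bar>h a\<bar> \<partial>lborel \<partial>Q)"
        by (subst lborel.nn_integral_fst[symmetric]) (auto simp: split_beta')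
      also have "\<dots> = (\<integral>\<^sup>+a. ennreal \<bar>h a\<bar> \<partial>lborel)" by (simp add: Q.emeasure_space_1)
      also have "\<dots> < \<infinity>" using hint by (simp add: integrable_iff_bounded)
      finally show "(\<integral>\<^sup>+p. ennreal (norm (case p of (x, a) \<Rightarrow> h a)) \<partial>(Q \<Otimes>\<^sub>M lborel)) < \<infinity>" .
    qed measurable
    have i: "integrable (Q \<Otimes>\<^sub>M lborel) (\<lambda>(x, a). h a * gauss_kernel c (x - a))"
      by (rule Bochner_Integration.integrable_bound[OF i1])
         (auto simp: split_beta' abs_mult gauss_kernel_nonneg gauss_kernel_le_1 c less_imp_le intro!: mult_left_le)
    show "integrable Q g" unfolding g_def
      using integrable_fst[OF i] by simp
    show "(\<integral>x. g x \<partial>Q) = (\<integral>a. h a * (\<integral>x. gauss_kernel c (x - a) \<partial>Q) \<partial>lborel) / N"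
      unfolding g_def using Fubini_integral[OF i] by simp
  qed
  have "(\<lambda>n. \<integral>a. h a * (\<integral>x. gauss_kernel c (x - a) \<partial>P n) \<partial>lborel)
     \<longlonglongrightarrow> (\<integral>a. h a * (\<integral>x. gauss_kernel c (x - a) \<partial>\<mu>) \<partial>lborel)"
  proof (rule integral_dominated_convergence[where w = "\<lambda>a. \<bar>h a\<bar>"])
    have meas: "(\<lambda>a. \<integral>x. gauss_kernel c (x - a) \<partial>Q) \<in> borel_measurable borel"
      if Q: "prob_space Q" "sets Q = sets borel" for Q :: "(real^'k) measure"
    proof -
      interpret Q: prob_space Q by fact
      have [measurable_cong]: "sets Q = sets borel" by fact
      show ?thesis by measurable
    qed
    note [measurable] = meas[OF P] meas[OF \<mu>]
    show "(\<lambda>a. h a * (\<integral>x. gauss_kernel c (x - a) \<partial>\<mu>)) \<in> borel_measurable lborel"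
      "(\<lambda>a. h a * (\<integral>x. gauss_kernel c (x - a) \<partial>P n)) \<in> borel_measurable lborel" for n by measurable
    show "integrable lborel (\<lambda>a. \<bar>h a\<bar>)" using hint by simp
    show "AE a in lborel. (\<lambda>n. h a * (\<integral>x. gauss_kernel c (x - a) \<partial>P n)) \<longlonglongrightarrow> h a * (\<integral>x. gauss_kernel c (x - a) \<partial>\<mu>)"
      using c by (intro AE_I2 tendsto_mult tendsto_const gauss_kernel_conv P \<mu> char) auto
    show "AE a in lborel. norm (h a * (\<integral>x. gauss_kernel c (x - a) \<partial>P n)) \<le> \<bar>h a\<bar>" for n
    proof (rule AE_I2)
      fix a
      interpret Pn: prob_space "P n" by (rule P)
      have [measurable_cong]: "sets (P n) = sets borel" by (rule P)
      have le: "gauss_kernel c (x - a) \<le> 1" for x :: "real^'k" using c by (simp add: gauss_kernel_le_1)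
      have "integrable (P n) (\<lambda>x. gauss_kernel c (x - a))"
        by (rule Pn.integrable_const_bound[of _ 1]) (auto simp: gauss_kernel_nonneg le)
      then have "(\<integral>x. gauss_kernel c (x - a) \<partial>P n) \<le> 1"
        by (rule Pn.integral_le_const) (simp add: le)
      moreover have "(\<integral>x. gauss_kernel c (x - a) \<partial>P n) \<ge> 0"
        by (simp add: gauss_kernel_nonneg)
      ultimately have "\<bar>\<integral>x. gauss_kernel c (x - a) \<partial>P n\<bar> \<le> 1" by simp
      then show "norm (h a * (\<integral>x. gauss_kernel c (x - a) \<partial>P n)) \<le> \<bar>h a\<bar>"
        by (simp add: abs_mult mult_left_le)
    qed
  qed
  then have "(\<lambda>n. \<integral>x. g x \<partial>P n) \<longlonglongrightarrow> (\<integral>x. g x \<partial>\<mu>)"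
    unfolding gint(2)[OF P] gint(2)[OF \<mu>] divide_inverse by (rule tendsto_mult_right)
  then obtain n0 where n0: "\<And>n. n \<ge> n0 \<Longrightarrow> \<bar>(\<integral>x. g x \<partial>P n) - (\<integral>x. g x \<partial>\<mu>)\<bar> < r / 4"
    using LIMSEQ_D[of _ _ "r/4"] r by (metis real_norm_def zero_less_divide_iff zero_less_numeral)
  have diff: "\<bar>(\<integral>x. g x \<partial>Q) - (\<integral>x. h x \<partial>Q)\<bar> \<le> r / 4" if Q: "prob_space Q" "sets Q = sets borel" for Q
  proof -
    interpret Q: prob_space Q by fact
    have "\<bar>(\<integral>x. g x \<partial>Q) - (\<integral>x. h x \<partial>Q)\<bar> = \<bar>\<integral>x. g x - h x \<partial>Q\<bar>"
      using gint(1)[OF Q] hintQ[OF Q] by simp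
    also have "\<dots> \<le> (\<integral>x. r / 4 \<partial>Q)"
      using gint(1)[OF Q] hintQ[OF Q] close
      by (intro abs_integral_le) auto
    finally show ?thesis by (simp add: Q.prob_space)
  qed
  show "\<exists>n0. \<forall>n\<ge>n0. norm ((\<integral>x. h x \<partial>P n) - (\<integral>x. h x \<partial>\<mu>)) < r"
  proof (intro exI allI impI)
    fix n assume "n0 \<le> n"
    from n0[OF this] diff[OF P, of n] diff[OF \<mu>] show "norm ((\<integral>x. h x \<partial>P n) - (\<integral>x. h x \<partial>\<mu>)) < r"
      unfolding real_norm_def by linarith
  qed
qed

text \<open>Tightness comes for free: a compactly supported cutoff that captures most of the mass of the
  limit captures, by the compactly supported case, most of the mass of the approximants.\<close>
lemma weak_conv_of_char:
  fixes P :: "nat \<Rightarrow> (real^'k) measure"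
  assumes P: "\<And>n. prob_space (P n)" "\<And>n. sets (P n) = sets borel"
    and \<mu>: "prob_space \<mu>" "sets \<mu> = sets borel"
    and char: "\<And>c. (\<lambda>n. CLINT x|P n. iexp (c \<bullet> x)) \<longlonglongrightarrow> (CLINT x|\<mu>. iexp (c \<bullet> x))"
    and h: "continuous_on UNIV h" and B: "\<And>x. \<bar>h x\<bar> \<le> B"
  shows "(\<lambda>n. \<integral>x. h x \<partial>P n) \<longlonglongrightarrow> (\<integral>x. h x \<partial>\<mu> :: real)"
proof -
  interpret \<mu>: prob_space \<mu> by fact
  have \<mu>b[measurable_cong]: "sets \<mu> = sets borel" by fact
  have [measurable]: "h \<in> borel_measurable borel" using h by (simp add: borel_measurable_continuous_onI)
  define cut where "cut k x = max 0 (min 1 (real k + 1 - norm x))" for k :: nat and x :: "real^'k"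
  have cutc: "continuous_on UNIV (cut k)" for k unfolding cut_def by (intro continuous_intros)
  have [measurable]: "cut k \<in> borel_measurable borel" for k
    using cutc by (simp add: borel_measurable_continuous_onI)
  have cutb: "0 \<le> cut k x" "cut k x \<le> 1" for k x by (auto simp: cut_def)
  have cuts: "cut k x = 0" if "norm x > real k + 1" for k x using that by (simp add: cut_def)
  have B0: "B \<ge> 0" using B[of 0] by linarith
  show ?thesis
  proof (rule LIMSEQ_I)
    fix r :: real assume r: "r > 0"
    \<comment> \<open>The summand 4 keeps the denominator positive when \<open>B = 0\<close>; the
      choice makes each of the two cutoff errors at most r/4.\<close>
    define e where "e = r / (4 * B + 4)"
    have e: "e > 0" "B * e \<le> r / 4" using r B0 by (auto simp: e_def field_simps)
    have "(\<lambda>k. \<integral>x. cut k x \<partial>\<mu>) \<longlonglongrightarrow> (\<integral>x. 1 \<partial>\<mu>)"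
    proof (rule integral_dominated_convergence[where w = "\<lambda>_. 1"])
      show "AE x in \<mu>. (\<lambda>k. cut k x) \<longlonglongrightarrow> 1"
      proof (rule AE_I2)
        fix x :: "real^'k"
        have "\<forall>\<^sub>F k in sequentially. cut k x = 1"
          using eventually_ge_at_top[of "nat \<lceil>norm x\<rceil>"]
        proof eventually_elim
          case (elim k) then have "norm x \<le> real k" by linarith
          then show ?case by (simp add: cut_def)
        qed
        then show "(\<lambda>k. cut k x) \<longlonglongrightarrow> 1" by (simp add: tendsto_eventually)
      qed
    qed (use cutb in auto)
    then have "(\<lambda>k. \<integral>x. cut k x \<partial>\<mu>) \<longlonglongrightarrow> 1" by (simp add: \<mu>.prob_space)
    then have "\<forall>\<^sub>F k in sequentially. (\<integral>x. cut k x \<partial>\<mu>) > 1 - e"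
      using e by (intro order_tendstoD) auto
    then obtain k where k: "(\<integral>x. cut k x \<partial>\<mu>) > 1 - e" by (metis eventually_sequentially order_refl)
    have l1: "(\<lambda>n. \<integral>x. cut k x \<partial>P n) \<longlonglongrightarrow> (\<integral>x. cut k x \<partial>\<mu>)"
      by (rule weak_conv_compact_support[OF P \<mu> char cutc cuts, where B = 1]) (use cutb in \<open>auto simp: abs_le_iff\<close>)
    have hb: "\<bar>h x * cut k x\<bar> \<le> B" for x
      using B[of x] cutb[of k x] by (simp add: abs_mult) (metis abs_ge_zero mult_left_le order_trans)
    have l2: "(\<lambda>n. \<integral>x. h x * cut k x \<partial>P n) \<longlonglongrightarrow> (\<integral>x. h x * cut k x \<partial>\<mu>)"
      by (rule weak_conv_compact_support[OF P \<mu> char _ _ hb, where R = "real k + 1"])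
         (use h cutc cuts in \<open>auto intro!: continuous_intros\<close>)
    have diff: "\<bar>(\<integral>x. h x \<partial>Q) - (\<integral>x. h x * cut k x \<partial>Q)\<bar> \<le> B * (1 - (\<integral>x. cut k x \<partial>Q))"
      if Q: "prob_space Q" "sets Q = sets borel" for Q
    proof -
      interpret Q: prob_space Q by fact
      have [measurable_cong]: "sets Q = sets borel" by fact
      have "integrable Q h" "integrable Q (\<lambda>x. h x * cut k x)"
        by (rule Q.integrable_const_bound[of _ B], use B hb in auto)+
      moreover have "integrable Q (cut k)"
        by (rule Q.integrable_const_bound[of _ 1], use cutb in auto)
      ultimately have i: "integrable Q h" "integrable Q (\<lambda>x. h x * cut k x)" "integrable Q (cut k)" .
      have "\<bar>(\<integral>x. h x \<partial>Q) - (\<integral>x. h x * cut k x \<partial>Q)\<bar> = \<bar>\<integral>x. h x - h x * cut k x \<partial>Q\<bar>"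
        using i by simp
      also have "\<dots> \<le> (\<integral>x. B * (1 - cut k x) \<partial>Q)"
      proof (rule abs_integral_le)
        fix x
        have "\<bar>h x - h x * cut k x\<bar> = \<bar>h x\<bar> * (1 - cut k x)"
          using cutb[of k x] abs_mult[of "h x" "1 - cut k x"] by (simp add: algebra_simps)
        also have "\<dots> \<le> B * (1 - cut k x)" using B cutb by (intro mult_right_mono) auto
        finally show "\<bar>h x - h x * cut k x\<bar> \<le> B * (1 - cut k x)" .
      qed (use i in auto)
      also have "\<dots> = B * (1 - (\<integral>x. cut k x \<partial>Q))" using i by (simp add: Q.prob_space)
      finally show ?thesis .
    qed
    have "\<forall>\<^sub>F n in sequentially. (\<integral>x. cut k x \<partial>P n) > 1 - e"
      by (rule order_tendstoD(1)[OF l1 k])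
    moreover have "\<forall>\<^sub>F n in sequentially. dist (\<integral>x. h x * cut k x \<partial>P n) (\<integral>x. h x * cut k x \<partial>\<mu>) < r / 4"
      using l2 r by (intro tendstoD) auto
    ultimately have "\<forall>\<^sub>F n in sequentially. norm ((\<integral>x. h x \<partial>P n) - (\<integral>x. h x \<partial>\<mu>)) < r"
    proof eventually_elim
      case (elim n)
      have "B * (1 - (\<integral>x. cut k x \<partial>P n)) \<le> B * e" "B * (1 - (\<integral>x. cut k x \<partial>\<mu>)) \<le> B * e"
        using elim k B0 by (intro mult_left_mono; simp)+
      with diff[OF P, of n] diff[OF \<mu>] elim(2) e r show ?case
        unfolding dist_real_def real_norm_def by linarith
    qed
    then show "\<exists>n0. \<forall>n\<ge>n0. norm ((\<integral>x. h x \<partial>P n) - (\<integral>x. h x \<partial>\<mu>)) < r"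
      by (simp add: eventually_sequentially)
  qed
qed

section \<open>Gaussian noise\<close>


text \<open>Equidistant left endpoints: applied to a trajectory, each sum is a finite linear
  combination of values of the process.\<close>

lemma riemann_sum_tendsto_integral:
  fixes h :: "real \<Rightarrow> real"
  assumes h: "continuous_on {0..t} h" and t: "t \<ge> 0"
  shows "(\<lambda>n::nat. \<Sum>i<n. (t / real n) * h (t * real i / real n)) \<longlonglongrightarrow> integral {0..t} h"
proof (rule LIMSEQ_I)
  fix r :: real assume r: "r > 0"
  define e where "e = r / (t + 1)"
  have e: "e > 0" "e * t < r" using r t by (auto simp: e_def field_simps)
  have "uniformly_continuous_on {0..t} h" by (rule compact_uniformly_continuous[OF h]) simp
  then obtain d where d: "d > 0" "\<And>x y. x \<in> {0..t} \<Longrightarrow> y \<in> {0..t} \<Longrightarrow> dist y x < d \<Longrightarrow> dist (h y) (h x) < e"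
    unfolding uniformly_continuous_on_def using e by metis
  obtain N :: nat where N: "t / d < N" using reals_Archimedean2 by blast
  show "\<exists>no::nat. \<forall>n\<ge>no. norm ((\<Sum>i<n. (t / real n) * h (t * real i / real n)) - integral {0..t} h) < r"
  proof (rule exI[of _ "max N 1"], intro allI impI)
    fix n assume n: "max N 1 \<le> n"
    then have n0: "real n > 0" and nN: "t / d < n" using N by auto
    have small: "t / n < d" using nN d n0 by (simp add: field_simps)
    define x where "x i = t * real i / real n" for i
    have x: "0 \<le> x i" "x i \<le> x (Suc i)" "x (Suc i) - x i = t / n" for i
      using t n0 by (auto simp: x_def field_simps)
    have xt: "x i \<le> t" if "i \<le> n" for i
      using that t n0 by (simp add: x_def divide_le_eq mult_left_mono)
    have intg: "h integrable_on {u..v}" if "0 \<le> u" "v \<le> t" for u v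
      using that by (intro integrable_continuous_interval continuous_on_subset[OF h]) auto
    have split: "integral {0..x j} h = (\<Sum>i<j. integral {x i..x (Suc i)} h)" if "j \<le> n" for j
      using that
    proof (induction j)
      case 0 then show ?case by (simp add: x_def)
    next
      case (Suc j)
      have "integral {0..x (Suc j)} h = integral {0..x j} h + integral {x j..x (Suc j)} h"
        using x[of j] xt[of "Suc j"] Suc.prems
        by (intro Henstock_Kurzweil_Integration.integral_combine[symmetric] intg) auto
      then show ?case using Suc by simp
    qed
    have part: "\<bar>(t / real n) * h (x i) - integral {x i..x (Suc i)} h\<bar> \<le> e * (t / real n)" if i: "i < n" for i
    proof -
      have "integral {x i..x (Suc i)} (\<lambda>u. h u - h (x i)) = integral {x i..x (Suc i)} h - (t / real n) * h (x i)"
        using x[of i] xt[of "Suc i"] i by (subst integral_diff) (auto intro!: intg)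
      moreover have "norm (integral {x i..x (Suc i)} (\<lambda>u. h u - h (x i))) \<le> integral {x i..x (Suc i)} (\<lambda>u. e)"
      proof (rule Henstock_Kurzweil_Integration.integral_norm_bound_integral)
        show "(\<lambda>u. h u - h (x i)) integrable_on {x i..x (Suc i)}"
          using x[of i] xt[of "Suc i"] i by (intro integrable_diff intg) auto
        fix u assume u: "u \<in> {x i..x (Suc i)}"
        have "dist (h u) (h (x i)) < e"
          using u x[of i] xt[of "Suc i"] i small by (intro d(2)) (auto simp: dist_real_def)
        then show "norm (h u - h (x i)) \<le> e" by (simp add: dist_real_def)
      qed (rule integrable_const_ivl)
      ultimately show ?thesis using x[of i] by (simp add: abs_minus_commute mult.commute)
    qed
    have "integral {0..t} h = (\<Sum>i<n. integral {x i..x (Suc i)} h)"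
      using split[of n] n0 by (simp add: x_def)
    then have "\<bar>(\<Sum>i<n. (t / real n) * h (x i)) - integral {0..t} h\<bar> = \<bar>\<Sum>i<n. (t / real n) * h (x i) - integral {x i..x (Suc i)} h\<bar>"
      by (simp add: sum_subtractf)
    also have "\<dots> \<le> (\<Sum>i<n. e * (t / real n))"
      by (intro order_trans[OF sum_abs] sum_mono part) simp
    also have "\<dots> = e * t" using n0 by simp
    also have "\<dots> < r" by (rule e)
    finally show "norm ((\<Sum>i<n. (t / real n) * h (t * real i / real n)) - integral {0..t} h) < r"
      by (simp add: x_def)
  qed
qed

text \<open>The kernel \<open>R\<close> is left general so that it covers a stationary covariance as
  well as Brownian motion, and times are restricted to \<open>{0..}\<close>, where Brownian motion
  lives. Independence is asked only for finite linear combinations over a common set of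
  times.\<close>

locale gaussian_noise = prob_space M for M :: "'w measure" +
  fixes I :: "'i set" and G :: "'i \<Rightarrow> real \<Rightarrow> 'w \<Rightarrow> real" and R :: "real \<Rightarrow> real \<Rightarrow> real"
  assumes fin: "finite I"
    and cont: "k \<in> I \<Longrightarrow> \<omega> \<in> space M \<Longrightarrow> continuous_on {0..} (\<lambda>t. G k t \<omega>)"
    and gauss: "finite T \<Longrightarrow> T \<subseteq> {0..} \<Longrightarrow> k \<in> I \<Longrightarrow> \<exists>v. normal_rv M v (\<lambda>\<omega>. \<Sum>t\<in>T. c t * G k t \<omega>)"
    and indep: "finite T \<Longrightarrow> T \<subseteq> {0..} \<Longrightarrow> indep_vars (\<lambda>_. borel) (\<lambda>k \<omega>. \<Sum>t\<in>T. d k t * G k t \<omega>) I"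
    and cov: "k \<in> I \<Longrightarrow> s \<ge> 0 \<Longrightarrow> t \<ge> 0 \<Longrightarrow> expectation (\<lambda>\<omega>. G k s \<omega> * G k t \<omega>) = R s t"
begin

definition lin :: "real set \<Rightarrow> ('i \<Rightarrow> real \<Rightarrow> real) \<Rightarrow> 'w \<Rightarrow> real" where
  "lin T c \<omega> = (\<Sum>k\<in>I. \<Sum>t\<in>T. c k t * G k t \<omega>)"

definition combos :: "('w \<Rightarrow> real) set" where
  "combos = {lin T c |T c. finite T \<and> T \<subseteq> {0..}}"

text \<open>The gaussian space of the noise, with pointwise limits in place of an L2 closure,
  because the integrals over time are pathwise.\<close>

definition gspace :: "('w \<Rightarrow> real) set" where
  "gspace = {X. \<exists>Z. (\<forall>n::nat. Z n \<in> combos) \<and> (\<forall>\<omega>\<in>space M. (\<lambda>n. Z n \<omega>) \<longlonglongrightarrow> X \<omega>)}"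

text \<open>Terms are grouped by coordinate: each group is gaussian, the groups are independent, so
  their characteristic functions multiply and their variances add.\<close>

lemma combos_normal:
  assumes "X \<in> combos"
  shows "\<exists>v. normal_rv M v X"
proof -
  obtain T c where X: "X = lin T c" and T: "finite T" "T \<subseteq> {0..}"
    using assms by (auto simp: combos_def)
  have "\<forall>k\<in>I. \<exists>v. normal_rv M v (\<lambda>\<omega>. \<Sum>t\<in>T. c k t * G k t \<omega>)"
    using gauss[OF T] by blast
  from bchoice[OF this] obtain v
    where v: "\<And>k. k \<in> I \<Longrightarrow> normal_rv M (v k) (\<lambda>\<omega>. \<Sum>t\<in>T. c k t * G k t \<omega>)" by blast
  then have [measurable]: "k \<in> I \<Longrightarrow> (\<lambda>\<omega>. \<Sum>t\<in>T. c k t * G k t \<omega>) \<in> borel_measurable M" for k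
    by (simp add: normal_rv_def)
  have m: "lin T c \<in> borel_measurable M" unfolding lin_def by measurable
  have "(CLINT \<omega>|M. iexp (u * lin T c \<omega>)) = of_real (exp (- (u\<^sup>2 * (\<Sum>k\<in>I. v k)) / 2))" for u
  proof -
    have "(CLINT \<omega>|M. iexp (u * lin T c \<omega>)) = char (distr M borel (\<lambda>\<omega>. \<Sum>k\<in>I. \<Sum>t\<in>T. c k t * G k t \<omega>)) u"
      using m by (simp add: char_distr lin_def[abs_def])
    also have "\<dots> = (\<Prod>k\<in>I. char (distr M borel (\<lambda>\<omega>. \<Sum>t\<in>T. c k t * G k t \<omega>)) u)"
      by (rule char_distr_sum[OF indep[OF T]])
    also have "\<dots> = (\<Prod>k\<in>I. of_real (exp (- (u\<^sup>2 * v k) / 2)))"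
      using v by (intro prod.cong refl) (simp add: char_distr normal_rv_def)
    also have "\<dots> = of_real (exp (- (u\<^sup>2 * (\<Sum>k\<in>I. v k)) / 2))"
      using fin by (simp add: exp_sum[symmetric] of_real_prod[symmetric] sum_negf sum_distrib_left sum_divide_distrib
          del: of_real_prod)
    finally show ?thesis .
  qed
  moreover have "(\<Sum>k\<in>I. v k) \<ge> 0" using v by (intro sum_nonneg) (simp add: normal_rv_def)
  ultimately show ?thesis using m X unfolding normal_rv_def by blast
qed

lemma gspace_normal:
  assumes "X \<in> gspace"
  shows "\<exists>v. normal_rv M v X"
proof -
  obtain Z where Z: "\<And>n. Z n \<in> combos" "\<And>\<omega>. \<omega> \<in> space M \<Longrightarrow> (\<lambda>n. Z n \<omega>) \<longlonglongrightarrow> X \<omega>"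
    using assms by (auto simp: gspace_def)
  have "\<forall>n. \<exists>v. normal_rv M v (Z n)" using combos_normal[OF Z(1)] by blast
  from choice[OF this] obtain v where v: "\<And>n. normal_rv M (v n) (Z n)" by blast
  have "X \<in> borel_measurable M"
    by (rule borel_measurable_LIMSEQ_metric[OF _ Z(2)]) (use v in \<open>auto simp: normal_rv_def\<close>)
  from normal_rv_limit[OF v this Z(2)] show ?thesis by blast
qed

lemma gspace_measurable[measurable_dest]: "X \<in> gspace \<Longrightarrow> X \<in> borel_measurable M"
  using gspace_normal by (auto simp: normal_rv_def)

lemma combos_add:
  assumes "X \<in> combos" "Y \<in> combos"
  shows "(\<lambda>\<omega>. X \<omega> + Y \<omega>) \<in> combos"
proof -
  obtain T c T' c' where X: "X = lin T c" "finite T" "T \<subseteq> {0..}" and Y: "Y = lin T' c'" "finite T'" "T' \<subseteq> {0..}"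
    using assms by (auto simp: combos_def)
  have 1: "(\<Sum>t\<in>T. f t) = (\<Sum>t\<in>T\<union>T'. if t \<in> T then f t else 0)"
    "(\<Sum>t\<in>T'. f t) = (\<Sum>t\<in>T\<union>T'. if t \<in> T' then f t else 0)" for f :: "real \<Rightarrow> real"
    using X Y by (auto intro!: sum.mono_neutral_cong_left)
  have "(\<lambda>\<omega>. X \<omega> + Y \<omega>) = lin (T \<union> T') (\<lambda>k t. (if t \<in> T then c k t else 0) + (if t \<in> T' then c' k t else 0))"
    unfolding X(1) Y(1) lin_def 1 sum.distrib[symmetric]
    by (intro ext sum.cong) (auto simp: algebra_simps)
  then show ?thesis using X Y unfolding combos_def by blast
qed

lemma combos_scale: "X \<in> combos \<Longrightarrow> (\<lambda>\<omega>. r * X \<omega>) \<in> combos"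
proof -
  assume "X \<in> combos"
  then obtain T c where X: "X = lin T c" "finite T" "T \<subseteq> {0..}" by (auto simp: combos_def)
  have "(\<lambda>\<omega>. r * X \<omega>) = lin T (\<lambda>k t. r * c k t)"
    by (simp add: X(1) lin_def[abs_def] sum_distrib_left mult.assoc)
  then show ?thesis using X unfolding combos_def by blast
qed

lemma combos_G: "k \<in> I \<Longrightarrow> t \<ge> 0 \<Longrightarrow> G k t \<in> combos"
proof -
  assume k: "k \<in> I" and t: "t \<ge> 0"
  have "lin {t} (\<lambda>l _. if l = k then 1 else 0) \<omega> = G k t \<omega>" for \<omega>
  proof -
    have "lin {t} (\<lambda>l _. if l = k then 1 else 0) \<omega> = (\<Sum>l\<in>I. if l = k then G k t \<omega> else 0)"
      unfolding lin_def by (intro sum.cong) auto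
    then show ?thesis using k fin by simp
  qed
  then have "G k t = lin {t} (\<lambda>l _. if l = k then 1 else 0)" by auto
  then show ?thesis using t unfolding combos_def by blast
qed

lemma combos_zero: "(\<lambda>_. 0) \<in> combos"
proof -
  have "(\<lambda>_. 0) = lin {} (\<lambda>_ _. 0)" by (simp add: lin_def[abs_def])
  then show ?thesis unfolding combos_def by blast
qed

lemma combos_sum: "(\<And>i. i \<in> J \<Longrightarrow> X i \<in> combos) \<Longrightarrow> (\<lambda>\<omega>. \<Sum>i\<in>J. X i \<omega>) \<in> combos"
  by (induction J rule: infinite_finite_induct) (auto intro: combos_add combos_zero)

lemma combos_gspace: "X \<in> combos \<Longrightarrow> X \<in> gspace"
  unfolding gspace_def by (auto intro!: exI[of _ "\<lambda>_. X"])

lemma gspace_add: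
  assumes "X \<in> gspace" "Y \<in> gspace"
  shows "(\<lambda>\<omega>. X \<omega> + Y \<omega>) \<in> gspace"
proof -
  obtain Z where "\<And>n. Z n \<in> combos" "\<And>\<omega>. \<omega> \<in> space M \<Longrightarrow> (\<lambda>n. Z n \<omega>) \<longlonglongrightarrow> X \<omega>"
    using assms(1) by (auto simp: gspace_def)
  moreover obtain Z' where "\<And>n. Z' n \<in> combos" "\<And>\<omega>. \<omega> \<in> space M \<Longrightarrow> (\<lambda>n. Z' n \<omega>) \<longlonglongrightarrow> Y \<omega>"
    using assms(2) by (auto simp: gspace_def)
  ultimately show ?thesis unfolding gspace_def
    by (auto intro!: exI[of _ "\<lambda>n \<omega>. Z n \<omega> + Z' n \<omega>"] combos_add tendsto_add)
qed

lemma gspace_scale: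
  assumes "X \<in> gspace"
  shows "(\<lambda>\<omega>. r * X \<omega>) \<in> gspace"
proof -
  obtain Z where "\<And>n. Z n \<in> combos" "\<And>\<omega>. \<omega> \<in> space M \<Longrightarrow> (\<lambda>n. Z n \<omega>) \<longlonglongrightarrow> X \<omega>"
    using assms by (auto simp: gspace_def)
  then show ?thesis unfolding gspace_def
    by (auto intro!: exI[of _ "\<lambda>n \<omega>. r * Z n \<omega>"] combos_scale tendsto_mult_left)
qed

lemma gspace_sum: "(\<And>i. i \<in> J \<Longrightarrow> X i \<in> gspace) \<Longrightarrow> (\<lambda>\<omega>. \<Sum>i\<in>J. X i \<omega>) \<in> gspace"
  by (induction J rule: infinite_finite_induct) (auto intro: gspace_add combos_gspace combos_zero)

lemma gspace_G: "k \<in> I \<Longrightarrow> t \<ge> 0 \<Longrightarrow> G k t \<in> gspace"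
  by (intro combos_gspace combos_G)

lemma product_eq_squares: "x * y = ((x + y)\<^sup>2 - x\<^sup>2 - y\<^sup>2) / (2::real)"
  by (simp add: power2_eq_square algebra_simps)

lemma gspace_moments:
  assumes "X \<in> gspace"
  shows "integrable M X" "expectation X = 0" "integrable M (\<lambda>\<omega>. (X \<omega>)\<^sup>2)"
  using gspace_normal[OF assms] normal_rv_moments by auto

text \<open>Polarisation reduces covariances to variances, the quantities that
  \<open>normal_rv_limit\<close> controls.\<close>

lemma
  assumes X: "X \<in> gspace" and Y: "Y \<in> gspace"
  shows gspace_integrable_mult: "integrable M (\<lambda>\<omega>. X \<omega> * Y \<omega>)"
    and gspace_cov_polar: "expectation (\<lambda>\<omega>. X \<omega> * Y \<omega>) =
      (expectation (\<lambda>\<omega>. (X \<omega> + Y \<omega>)\<^sup>2) - expectation (\<lambda>\<omega>. (X \<omega>)\<^sup>2) - expectation (\<lambda>\<omega>. (Y \<omega>)\<^sup>2)) / 2"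
  unfolding product_eq_squares
  using gspace_moments(3)[OF X] gspace_moments(3)[OF Y] gspace_moments(3)[OF gspace_add[OF X Y]]
  by simp_all

lemma gspace_char:
  assumes "X \<in> gspace"
  shows "(CLINT \<omega>|M. iexp (X \<omega>)) = of_real (exp (- expectation (\<lambda>\<omega>. (X \<omega>)\<^sup>2) / 2))"
proof -
  obtain v where v: "normal_rv M v X" using gspace_normal[OF assms] by blast
  from v[unfolded normal_rv_def, THEN conjunct2, THEN conjunct2, rule_format, of 1]
  show ?thesis by (simp add: normal_rv_moments(4)[OF v])
qed

text \<open>No domination is assumed: for centred normal variables pointwise convergence carries the
  second moments along, by \<open>normal_rv_limit\<close>.\<close>

lemma gspace_square_limit:
  assumes X: "\<And>n. X n \<in> gspace" and lim: "\<And>\<omega>. \<omega> \<in> space M \<Longrightarrow> (\<lambda>n. X n \<omega>) \<longlonglongrightarrow> Y \<omega>"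
  shows "(\<lambda>n. expectation (\<lambda>\<omega>. (X n \<omega>)\<^sup>2)) \<longlonglongrightarrow> expectation (\<lambda>\<omega>. (Y \<omega>)\<^sup>2)"
proof -
  have "\<forall>n. \<exists>v. normal_rv M v (X n)" using gspace_normal[OF X] by blast
  from choice[OF this] obtain v where v: "\<And>n. normal_rv M (v n) (X n)" by blast
  have "Y \<in> borel_measurable M"
    by (rule borel_measurable_LIMSEQ_metric[OF _ lim]) (use v in \<open>auto simp: normal_rv_def\<close>)
  from normal_rv_limit[OF v this lim] obtain w where "v \<longlonglongrightarrow> w" "normal_rv M w Y" by blast
  then show ?thesis using normal_rv_moments(4)[OF v] normal_rv_moments(4) by simp
qed

lemma gspace_cov_limit:
  assumes X: "\<And>n. X n \<in> gspace" and Z: "Z \<in> gspace" and Y: "Y \<in> gspace"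
    and lim: "\<And>\<omega>. \<omega> \<in> space M \<Longrightarrow> (\<lambda>n. X n \<omega>) \<longlonglongrightarrow> Z \<omega>"
  shows "(\<lambda>n. expectation (\<lambda>\<omega>. X n \<omega> * Y \<omega>)) \<longlonglongrightarrow> expectation (\<lambda>\<omega>. Z \<omega> * Y \<omega>)"
  unfolding gspace_cov_polar[OF X Y] gspace_cov_polar[OF Z Y]
  by (intro tendsto_divide tendsto_diff tendsto_const gspace_square_limit gspace_add X Y tendsto_add lim) auto

text \<open>Continuity of the covariance is inherited from the trajectories, so nothing need be
  assumed of \<open>R\<close>, and the integrals over time below are integrals of continuous
  functions.\<close>

lemma gspace_cov_continuous:
  assumes k: "k \<in> I" and Y: "Y \<in> gspace"
  shows "continuous_on {0..} (\<lambda>s. expectation (\<lambda>\<omega>. G k s \<omega> * Y \<omega>))"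
  unfolding continuous_on_sequentially
proof (intro allI ballI impI, elim conjE)
  fix x :: "nat \<Rightarrow> real" and a assume a: "a \<in> {0..}" and x: "\<forall>n. x n \<in> {0..}" "x \<longlonglongrightarrow> a"
  show "((\<lambda>s. expectation (\<lambda>\<omega>. G k s \<omega> * Y \<omega>)) \<circ> x) \<longlonglongrightarrow> expectation (\<lambda>\<omega>. G k a \<omega> * Y \<omega>)"
    unfolding comp_def
  proof (rule gspace_cov_limit[OF _ _ Y])
    fix \<omega> assume "\<omega> \<in> space M"
    from cont[OF k this] show "(\<lambda>n. G k (x n) \<omega>) \<longlonglongrightarrow> G k a \<omega>"
      using a x unfolding continuous_on_sequentially comp_def by blast
  qed (use a x gspace_G[OF k] in auto)
qed

text \<open>The Riemann sums lie in \<open>combos\<close> and converge along every trajectory;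
  covariances pass to the limit by \<open>gspace_cov_limit\<close>, so no Fubini argument on time
  and sample space is involved.\<close>

lemma
  assumes k: "k \<in> I" and a: "continuous_on {0..t} a" and t: "t \<ge> 0"
  shows gspace_integral: "(\<lambda>\<omega>. integral {0..t} (\<lambda>s. a s * G k s \<omega>)) \<in> gspace" (is "?X \<in> _")
    and gspace_integral_cov: "Y \<in> gspace \<Longrightarrow> expectation (\<lambda>\<omega>. integral {0..t} (\<lambda>s. a s * G k s \<omega>) * Y \<omega>)
      = integral {0..t} (\<lambda>s. a s * expectation (\<lambda>\<omega>. G k s \<omega> * Y \<omega>))"
proof -
  define S where "S n \<omega> = (\<Sum>i<n. (t / real n) * (a (t * real i / real n) * G k (t * real i / real n) \<omega>))" for n :: nat and \<omega>
  have lim: "(\<lambda>n. S n \<omega>) \<longlonglongrightarrow> ?X \<omega>" if "\<omega> \<in> space M" for \<omega>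
    unfolding S_def
    by (intro riemann_sum_tendsto_integral t continuous_intros a continuous_on_subset[OF cont[OF k that]]) auto
  have Sc: "S n \<in> combos" for n
    unfolding S_def[abs_def] using t by (intro combos_sum combos_scale combos_G k) auto
  show X: "?X \<in> gspace" unfolding gspace_def using lim Sc by blast
  assume Y: "Y \<in> gspace"
  have "expectation (\<lambda>\<omega>. S n \<omega> * Y \<omega>)
    = (\<Sum>i<n. (t / real n) * (a (t * real i / real n) * expectation (\<lambda>\<omega>. G k (t * real i / real n) \<omega> * Y \<omega>)))" for n
  proof -
    have i: "integrable M (\<lambda>\<omega>. G k (t * real i / real n) \<omega> * Y \<omega>)" for i
      using t by (intro gspace_integrable_mult gspace_G k Y) auto
    have "expectation (\<lambda>\<omega>. S n \<omega> * Y \<omega>)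
       = expectation (\<lambda>\<omega>. \<Sum>i<n. ((t / real n) * a (t * real i / real n)) * (G k (t * real i / real n) \<omega> * Y \<omega>))"
      unfolding S_def sum_distrib_right by (simp add: mult.assoc)
    also have "\<dots> = (\<Sum>i<n. ((t / real n) * a (t * real i / real n)) * expectation (\<lambda>\<omega>. G k (t * real i / real n) \<omega> * Y \<omega>))"
      by (subst Bochner_Integration.integral_sum, rule integrable_mult_right, rule i) (simp only: integral_mult_right_zero)
    finally show ?thesis by (simp add: mult.assoc)
  qed
  moreover have "(\<lambda>n::nat. \<Sum>i<n. (t / real n) * (a (t * real i / real n) * expectation (\<lambda>\<omega>. G k (t * real i / real n) \<omega> * Y \<omega>)))
    \<longlonglongrightarrow> integral {0..t} (\<lambda>s. a s * expectation (\<lambda>\<omega>. G k s \<omega> * Y \<omega>))"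
    by (rule riemann_sum_tendsto_integral[OF _ t])
       (intro continuous_intros a continuous_on_subset[OF gspace_cov_continuous[OF k Y]], auto)
  ultimately have "(\<lambda>n. expectation (\<lambda>\<omega>. S n \<omega> * Y \<omega>))
    \<longlonglongrightarrow> integral {0..t} (\<lambda>s. a s * expectation (\<lambda>\<omega>. G k s \<omega> * Y \<omega>))" by simp
  moreover have "(\<lambda>n. expectation (\<lambda>\<omega>. S n \<omega> * Y \<omega>)) \<longlonglongrightarrow> expectation (\<lambda>\<omega>. ?X \<omega> * Y \<omega>)"
    by (intro gspace_cov_limit combos_gspace Sc X Y lim)
  ultimately show "expectation (\<lambda>\<omega>. ?X \<omega> * Y \<omega>)
      = integral {0..t} (\<lambda>s. a s * expectation (\<lambda>\<omega>. G k s \<omega> * Y \<omega>))"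
    by (rule LIMSEQ_unique[rotated])
qed

lemma cov_distinct:
  assumes k: "k \<in> I" and l: "l \<in> I" and ne: "k \<noteq> l" and st: "s \<ge> 0" "t \<ge> 0"
  shows "expectation (\<lambda>\<omega>. G k s \<omega> * G l t \<omega>) = 0"
proof -
  \<comment> \<open>\<open>indep\<close> works with a single set of times for all coordinates; over
    the set \<open>{s,t}\<close> these coefficients select time \<open>s\<close> for
    \<open>k\<close> and time \<open>t\<close> for \<open>l\<close>, also when
    \<open>s = t\<close>.\<close>
  define c where "c j u = (if j = k then (if u = s then 1 else 0) else if u = t then 1 else (0::real))" for j u
  define X where "X j \<omega> = (\<Sum>u\<in>{s,t}. c j u * G j u \<omega>)" for j \<omega>
  have Xk: "X k = G k s" and Xl: "X l = G l t"
    using ne by (auto simp: X_def c_def fun_eq_iff) (cases "s = t"; simp)+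
  have "indep_vars (\<lambda>_. borel) X {k, l}"
    unfolding X_def[abs_def] by (rule indep_vars_subset[OF indep]) (use k l st in auto)
  then have "expectation (\<lambda>\<omega>. \<Prod>j\<in>{k,l}. X j \<omega>) = (\<Prod>j\<in>{k,l}. expectation (X j))"
    by (intro indep_vars_lebesgue_integral) (use k l st Xk Xl in \<open>auto intro: gspace_moments(1)[OF gspace_G]\<close>)
  then show ?thesis using ne k l st by (simp add: Xk Xl gspace_moments(2) gspace_G)
qed

lemma cov_G: "k \<in> I \<Longrightarrow> l \<in> I \<Longrightarrow> s \<ge> 0 \<Longrightarrow> t \<ge> 0 \<Longrightarrow>
    expectation (\<lambda>\<omega>. G k s \<omega> * G l t \<omega>) = (if k = l then R s t else 0)"
  using cov cov_distinct by auto

lemma cov_G_integral: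
  assumes kl: "k \<in> I" "l \<in> I" and s: "s \<ge> 0" and t: "t \<ge> 0" and b: "continuous_on {0..t} b"
  shows "expectation (\<lambda>\<omega>. G k s \<omega> * integral {0..t} (\<lambda>v. b v * G l v \<omega>))
    = (if k = l then integral {0..t} (\<lambda>v. b v * R v s) else 0)"
proof -
  have "expectation (\<lambda>\<omega>. G k s \<omega> * integral {0..t} (\<lambda>v. b v * G l v \<omega>))
     = integral {0..t} (\<lambda>v. b v * expectation (\<lambda>\<omega>. G l v \<omega> * G k s \<omega>))"
    using gspace_integral_cov[OF kl(2) b t gspace_G[OF kl(1) s]] by (simp add: mult.commute)
  also have "\<dots> = integral {0..t} (\<lambda>v. b v * (if k = l then R v s else 0))"
    by (intro integral_cong) (use kl s in \<open>auto simp: cov_G\<close>)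
  finally show ?thesis by simp
qed

lemma cov_integral_integral:
  assumes kl: "k \<in> I" "l \<in> I" and t: "t \<ge> 0" and a: "continuous_on {0..t} a"
    and t': "t' \<ge> 0" and b: "continuous_on {0..t'} b"
  shows "expectation (\<lambda>\<omega>. integral {0..t} (\<lambda>u. a u * G k u \<omega>) * integral {0..t'} (\<lambda>v. b v * G l v \<omega>))
    = (if k = l then integral {0..t} (\<lambda>u. a u * integral {0..t'} (\<lambda>v. b v * R v u)) else 0)"
proof -
  have "expectation (\<lambda>\<omega>. integral {0..t} (\<lambda>u. a u * G k u \<omega>) * integral {0..t'} (\<lambda>v. b v * G l v \<omega>))
     = integral {0..t} (\<lambda>u. a u * expectation (\<lambda>\<omega>. G k u \<omega> * integral {0..t'} (\<lambda>v. b v * G l v \<omega>)))"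
    by (rule gspace_integral_cov[OF kl(1) a t gspace_integral[OF kl(2) b t']])
  also have "\<dots> = integral {0..t} (\<lambda>u. a u * (if k = l then integral {0..t'} (\<lambda>v. b v * R v u) else 0))"
    by (intro integral_cong) (use kl t' b in \<open>auto simp: cov_G_integral\<close>)
  finally show ?thesis by simp
qed

end

section \<open>Limits of covariance integrals\<close>


text \<open>Passage from the Henstock-Kurzweil integrals of the solution formula to Lebesgue
  integrals, where Fubini and changes of variables apply; elapsed time replaces absolute
  time.\<close>

lemma integral_reflect_lborel:
  fixes f :: "real \<Rightarrow> real"
  assumes f[measurable]: "f \<in> borel_measurable borel" and K: "\<And>x. x \<in> {0..t} \<Longrightarrow> \<bar>f x\<bar> \<le> K"
  shows "integral {0..t} (\<lambda>u. f (t - u)) = (\<integral>x. indicator {0..t} x * f x \<partial>lborel)"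
proof -
  have "set_integrable lborel {0..t} (\<lambda>u. f (t - u))"
    unfolding set_integrable_def
    by (rule integrableI_bounded_set_indicator[where B = K]) (auto simp: emeasure_lborel_Icc_eq intro!: K)
  then have "integral {0..t} (\<lambda>u. f (t - u)) = (LINT u:{0..t}|lborel. f (t - u))"
    by (simp add: set_borel_integral_eq_integral)
  also have "\<dots> = (\<integral>x. indicator {0..t} (t - x) * f (t - (t - x)) \<partial>lborel)"
    unfolding set_lebesgue_integral_def by (subst lborel_integral_real_affine[where c = "-1" and t = t]) auto
  also have "\<dots> = (\<integral>x. indicator {0..t} x * f x \<partial>lborel)"
    by (intro Bochner_Integration.integral_cong) (auto simp: indicator_def)
  finally show ?thesis .
qed

text \<open>The shear \<open>x = y + \<tau>\<close> turns the double integral over the rectangle into an integral over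
  the lag \<open>\<tau>\<close>.\<close>
lemma
  fixes a b \<kappa> :: "real \<Rightarrow> real"
  assumes a: "continuous_on UNIV a" and b: "continuous_on UNIV b"
    and \<kappa>[measurable]: "\<kappa> \<in> borel_measurable borel" and B: "\<And>x. \<bar>\<kappa> x\<bar> \<le> B" and even: "\<And>x. \<kappa> (- x) = \<kappa> x"
  defines "S \<equiv> \<lambda>t t' \<tau>. \<integral>y. indicator {0..t'} y * indicator {0..t} (y + \<tau>) * (a (y + \<tau>) * b y) \<partial>lborel"
  shows rectangle_integral_shear:
      "integral {0..t} (\<lambda>u. a (t - u) * integral {0..t'} (\<lambda>v. b (t' - v) * \<kappa> (u - v)))
        = (\<integral>\<tau>. \<kappa> (t' - t + \<tau>) * S t t' \<tau> \<partial>lborel)" (is ?eq)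
    and integrable_rectangle_shear: "integrable lborel (\<lambda>\<tau>. \<kappa> (t' - t + \<tau>) * S t t' \<tau>)"
proof -
  have [measurable]: "a \<in> borel_measurable borel" "b \<in> borel_measurable borel"
    using a b by (auto intro: borel_measurable_continuous_onI)
  obtain Ka where Ka: "\<And>x. x \<in> {0..t} \<Longrightarrow> \<bar>a x\<bar> \<le> Ka" "Ka \<ge> 0"
    using compact_imp_bounded[OF compact_continuous_image[OF continuous_on_subset[OF a], of "{0..t}"]]
    unfolding bounded_pos by (force simp: less_imp_le)
  obtain Kb where Kb: "\<And>x. x \<in> {0..t'} \<Longrightarrow> \<bar>b x\<bar> \<le> Kb" "Kb \<ge> 0"
    using compact_imp_bounded[OF compact_continuous_image[OF continuous_on_subset[OF b], of "{0..t'}"]]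
    unfolding bounded_pos by (force simp: less_imp_le)
  have B0: "B \<ge> 0" using B[of 0] by linarith
  define s where "s = t' - t"
  \<comment> \<open>With x = t - u and y = t' - v one has u - v = -(s + x - y), so evenness of
    \<open>\<kappa>\<close> gives this form, and along x = y + \<tau> the kernel depends on the lag
    only.\<close>
  define H where "H x y = indicator {0..t} x * indicator {0..t'} y * (a x * b y * \<kappa> (s + x - y))" for x y :: real
  have Hb: "\<bar>a x * b y * \<kappa> z\<bar> \<le> Ka * Kb * B" if "x \<in> {0..t}" "y \<in> {0..t'}" for x y z
    unfolding abs_mult using Ka Kb B that by (intro mult_mono mult_nonneg_nonneg) auto
  have Hm[measurable]: "(\<lambda>(x, y). H x y) \<in> borel_measurable (lborel \<Otimes>\<^sub>M lborel)"
    unfolding H_def split_beta' by measurable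
  have Hi: "integrable (lborel \<Otimes>\<^sub>M lborel) (\<lambda>(x, y). H x y)"
  proof -
    have "integrable (lborel \<Otimes>\<^sub>M lborel) (\<lambda>z. indicator ({0..t} \<times> {0..t'}) z *\<^sub>R (case z of (x, y) \<Rightarrow> a x * b y * \<kappa> (s + x - y)))"
      using Hb by (intro integrableI_bounded_set_indicator[where B = "Ka * Kb * B"])
        (auto simp: lborel.emeasure_pair_measure_Times emeasure_lborel_Icc_eq ennreal_mult_less_top)
    then show ?thesis by (rule Bochner_Integration.integrable_cong[THEN iffD1, rotated 2])
        (auto simp: H_def indicator_times)
  qed
  \<comment> \<open>For x in \<open>{0..t}\<close> and y in \<open>{0..t'}\<close> the lag lies in
    \<open>{-t'..t}\<close>, so the sheared integrand is bounded with bounded support.\<close>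
  have Hs: "integrable (lborel \<Otimes>\<^sub>M lborel) (\<lambda>(\<tau>, y). H (y + \<tau>) y)"
  proof -
    have "integrable (lborel \<Otimes>\<^sub>M lborel) (\<lambda>z. indicator ({-t'..t} \<times> {0..t'}) z *\<^sub>R (case z of (\<tau>, y) \<Rightarrow> H (y + \<tau>) y))"
    proof (intro integrableI_bounded_set_indicator[where B = "Ka * Kb * B"])
      show "AE z \<in> {-t'..t} \<times> {0..t'} in lborel \<Otimes>\<^sub>M lborel. norm (case z of (\<tau>, y) \<Rightarrow> H (y + \<tau>) y) \<le> Ka * Kb * B"
        using Hb Ka Kb B0 by (intro AE_I2) (auto simp: H_def indicator_def)
      show "(\<lambda>(\<tau>, y). H (y + \<tau>) y) \<in> borel_measurable (lborel \<Otimes>\<^sub>M lborel)"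
        unfolding H_def split_beta' by measurable
    qed (auto simp: lborel.emeasure_pair_measure_Times emeasure_lborel_Icc_eq ennreal_mult_less_top)
    then show ?thesis by (rule Bochner_Integration.integrable_cong[THEN iffD1, rotated 2])
        (auto simp: H_def indicator_def)
  qed
  have inner: "(\<integral>y. H (y + \<tau>) y \<partial>lborel) = \<kappa> (s + \<tau>) * S t t' \<tau>" for \<tau>
    unfolding S_def H_def
    by (subst integral_mult_right_zero[symmetric]) (auto intro!: Bochner_Integration.integral_cong simp: mult_ac)
  show "integrable lborel (\<lambda>\<tau>. \<kappa> (t' - t + \<tau>) * S t t' \<tau>)"
    using lborel_pair.integrable_fst[OF Hs] by (simp add: inner s_def[symmetric])
  define L where "L x = (\<integral>y. indicator {0..t'} y * (b y * \<kappa> (s + x - y)) \<partial>lborel)" for x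
  have Lm[measurable]: "L \<in> borel_measurable borel" unfolding L_def by measurable
  have in1: "integral {0..t'} (\<lambda>v. b (t' - v) * \<kappa> (u - v)) = L (t - u)" for u
  proof -
    have "integral {0..t'} (\<lambda>v. b (t' - v) * \<kappa> (u - t' + (t' - v))) = (\<integral>y. indicator {0..t'} y * (b y * \<kappa> (u - t' + y)) \<partial>lborel)"
      by (rule integral_reflect_lborel[where K = "Kb * B"])
         (use Kb B B0 in \<open>auto simp: abs_mult intro!: mult_mono\<close>)
    also have "\<dots> = L (t - u)"
      unfolding L_def s_def using even[of "u - t' + _"]
      by (intro Bochner_Integration.integral_cong refl) (simp add: algebra_simps)
    finally show ?thesis by simp
  qed
  have Lb: "\<bar>L x\<bar> \<le> (\<integral>y. indicator {0..t'} y * (Kb * B) \<partial>lborel)" for x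
    unfolding L_def
  proof (rule abs_integral_le)
    show i2: "integrable lborel (\<lambda>y. indicator {0..t'} y * (Kb * B))"
      by (intro integrable_mult_left) (auto simp: emeasure_lborel_Icc_eq)
    show le: "\<bar>indicator {0..t'} y * (b y * \<kappa> (s + x - y))\<bar> \<le> indicator {0..t'} y * (Kb * B)" for y
      using Kb B[of "s + x - y"] B0 by (auto simp: indicator_def abs_mult intro!: mult_mono)
    show "integrable lborel (\<lambda>y. indicator {0..t'} y * (b y * \<kappa> (s + x - y)))"
      by (rule Bochner_Integration.integrable_bound[OF i2]) (auto intro!: AE_I2 order_trans[OF le])
  qed
  have "integral {0..t} (\<lambda>u. a (t - u) * L (t - u)) = (\<integral>x. indicator {0..t} x * (a x * L x) \<partial>lborel)"
    by (rule integral_reflect_lborel[where K = "Ka * (\<integral>y. indicator {0..t'} y * (Kb * B) \<partial>lborel)"])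
       (use Ka Lb in \<open>auto simp: abs_mult intro!: mult_mono\<close>)
  also have "\<dots> = (\<integral>x. \<integral>y. H x y \<partial>lborel \<partial>lborel)"
  proof (intro Bochner_Integration.integral_cong refl)
    fix x
    have "indicator {0..t} x * (a x * L x) = (\<integral>y. (indicator {0..t} x * a x) * (indicator {0..t'} y * (b y * \<kappa> (s + x - y))) \<partial>lborel)"
      unfolding L_def integral_mult_right_zero by (simp add: mult.assoc)
    then show "indicator {0..t} x * (a x * L x) = (\<integral>y. H x y \<partial>lborel)"
      unfolding H_def by (simp add: mult_ac)
  qed
  also have "\<dots> = (\<integral>y. \<integral>x. H x y \<partial>lborel \<partial>lborel)"
    by (rule lborel_pair.Fubini_integral[OF Hi, symmetric])
  also have "\<dots> = (\<integral>y. \<integral>\<tau>. H (y + \<tau>) y \<partial>lborel \<partial>lborel)"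
    by (rule Bochner_Integration.integral_cong[OF refl], subst lborel_integral_real_affine[where c = 1 and t = y for y]) auto
  also have "\<dots> = (\<integral>\<tau>. \<integral>y. H (y + \<tau>) y \<partial>lborel \<partial>lborel)"
    by (rule lborel_pair.Fubini_integral[OF Hs])
  finally show ?eq unfolding in1 inner s_def .
qed

lemma integrable_exp_abs:
  assumes r: "r > 0"
  shows "integrable lborel (\<lambda>x::real. exp (- r * \<bar>x\<bar>))"
proof -
  have pos: "integrable lborel (\<lambda>x::real. indicator {0..} x * exp (- r * x))"
  proof (rule integrableI_nonneg)
    have "(\<integral>\<^sup>+x. ennreal (exp (- r * x)) * indicator {0..} x \<partial>lborel) = ennreal (0 - (- exp (- r * 0) / r))"
    proof (rule nn_integral_FTC_atLeast)
      show "((\<lambda>x. - exp (- r * x) / r) \<longlongrightarrow> 0) at_top"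
      proof -
        have "filterlim (\<lambda>x. - r * x) at_bot at_top"
          using r by (intro filterlim_tendsto_neg_mult_at_bot[OF tendsto_const] filterlim_ident) auto
        from tendsto_divide_zero[OF filterlim_compose[OF exp_at_bot this], of "- r"] show ?thesis by simp
      qed
    qed (use r in \<open>auto intro!: derivative_eq_intros simp: field_simps\<close>)
    then show "(\<integral>\<^sup>+x. ennreal (indicator {0..} x * exp (- r * x)) \<partial>lborel) < \<infinity>"
      by (simp add: ennreal_mult' mult.commute ennreal_indicator[symmetric])
  qed auto
  have "integrable lborel (\<lambda>x::real. indicator {0..} (0 + (-1) * x) * exp (- r * (0 + (-1) * x)))"
    using lborel_integrable_real_affine[OF pos, of "-1" 0] by simp
  with pos have "integrable lborel (\<lambda>x::real. indicator {0..} x * exp (- r * x) + indicator {0..} (0 + (-1) * x) * exp (- r * (0 + (-1) * x)))"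
    by (rule Bochner_Integration.integrable_add)
  then show ?thesis
    by (rule Bochner_Integration.integrable_bound) (auto simp: indicator_def)
qed

text \<open>For a fixed lag the integrand \<open>p\<close> is an exact derivative, so the inner
  integral is a difference of two values of \<open>g\<close>. The far one vanishes as time grows;
  the near one lies on y = 0 for nonnegative lags and on x = 0 for negative ones, which produces the
  two summands.\<close>

lemma lag_integral_tendsto:
  fixes p g :: "real \<Rightarrow> real \<Rightarrow> real" and \<kappa> :: "real \<Rightarrow> real"
  assumes p: "continuous_on UNIV (\<lambda>(x, y). p x y)"
    and g: "\<And>\<tau> y. ((\<lambda>y. g (y + \<tau>) y) has_real_derivative - p (y + \<tau>) y) (at y)"
    and gc0: "continuous_on UNIV (\<lambda>x. g x 0)" and g0c: "continuous_on UNIV (\<lambda>x. g 0 x)"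
    and r: "r > 0" and gb: "\<And>x y. x \<ge> 0 \<Longrightarrow> y \<ge> 0 \<Longrightarrow> \<bar>g x y\<bar> \<le> K * exp (- r * (x + y))"
    and \<kappa>[measurable]: "\<kappa> \<in> borel_measurable borel" and B: "\<And>x. \<bar>\<kappa> x\<bar> \<le> B"
  shows "((\<lambda>t. \<integral>\<tau>. \<kappa> (s + \<tau>) * (\<integral>y. indicator {0..t+s} y * indicator {0..t} (y + \<tau>) * p (y + \<tau>) y \<partial>lborel) \<partial>lborel)
     \<longlongrightarrow> (LINT \<tau>:{0..}|lborel. \<kappa> (\<tau> + s) * g \<tau> 0) + (LINT \<tau>:{0..}|lborel. \<kappa> (s - \<tau>) * g 0 \<tau>)) at_top"
proof -
  have [measurable]: "(\<lambda>(x, y). p x y) \<in> borel_measurable (borel \<Otimes>\<^sub>M borel)"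
    using borel_measurable_continuous_onI[OF p] by (simp add: borel_prod)
  have [measurable]: "(\<lambda>x. g x 0) \<in> borel_measurable borel" "(\<lambda>x. g 0 x) \<in> borel_measurable borel"
    using gc0 g0c by (auto intro: borel_measurable_continuous_onI)
  have B0: "B \<ge> 0" using B[of 0] by linarith
  have K0: "K \<ge> 0" using gb[of 0 0] by simp
  \<comment> \<open>The conditions 0 \<le> y \<le> t + s and 0 \<le> y + \<tau> \<le> t say that y
    runs from \<open>lo\<close> to \<open>hi\<close>.\<close>
  define lo where "lo \<tau> = max 0 (- \<tau>)" for \<tau> :: real
  define hi where "hi t \<tau> = min (t + s) (t - \<tau>)" for t \<tau> :: real
  define Q where "Q t \<tau> = (\<integral>y. indicator {0..t+s} y * indicator {0..t} (y + \<tau>) * p (y + \<tau>) y \<partial>lborel)" for t \<tau>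
  define L where "L \<tau> = g (lo \<tau> + \<tau>) (lo \<tau>)" for \<tau>
  have Leq: "L \<tau> = (if \<tau> \<ge> 0 then g \<tau> 0 else g 0 (- \<tau>))" for \<tau> by (simp add: L_def lo_def)
  have Lm[measurable]: "L \<in> borel_measurable borel" unfolding Leq[abs_def] by measurable
  have Qm[measurable]: "Q t \<in> borel_measurable borel" for t unfolding Q_def by measurable
  have Lb: "\<bar>L \<tau>\<bar> \<le> K * exp (- r * \<bar>\<tau>\<bar>)" for \<tau>
    unfolding Leq using gb[of \<tau> 0] gb[of 0 "- \<tau>"] by auto
  have Qeq: "Q t \<tau> = (if lo \<tau> \<le> hi t \<tau> then L \<tau> - g (hi t \<tau> + \<tau>) (hi t \<tau>) else 0)" for t \<tau>
  proof (cases "lo \<tau> \<le> hi t \<tau>")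
    case True
    have "Q t \<tau> = (\<integral>y. p (y + \<tau>) y * indicator {lo \<tau>..hi t \<tau>} y \<partial>lborel)"
      unfolding Q_def by (intro Bochner_Integration.integral_cong) (auto simp: indicator_def lo_def hi_def)
    also have "\<dots> = - g (hi t \<tau> + \<tau>) (hi t \<tau>) - (- g (lo \<tau> + \<tau>) (lo \<tau>))"
    proof (rule integral_FTC_Icc_real[OF True])
      show "((\<lambda>y. - g (y + \<tau>) y) has_real_derivative p (y + \<tau>) y) (at y)" for y
        using DERIV_minus[OF g[of \<tau> y]] by simp
      show "isCont (\<lambda>y. p (y + \<tau>) y) y" for y
        using continuous_on_compose2[OF p, of UNIV "\<lambda>y. (y + \<tau>, y)"]
        by (simp add: continuous_on_eq_continuous_at continuous_intros)
    qed
    finally show ?thesis using True by (simp add: L_def)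
  next
    case False
    have "Q t \<tau> = (\<integral>y. 0 \<partial>(lborel::real measure))"
      unfolding Q_def using False by (intro Bochner_Integration.integral_cong) (auto simp: indicator_def lo_def hi_def)
    then show ?thesis using False by simp
  qed
  have end_bound: "\<bar>g (hi t \<tau> + \<tau>) (hi t \<tau>)\<bar> \<le> K * exp (- r * (\<tau> + 2 * hi t \<tau>))" if "lo \<tau> \<le> hi t \<tau>" for t \<tau>
    using gb[of "hi t \<tau> + \<tau>" "hi t \<tau>"] that by (simp add: lo_def algebra_simps)
  have Qb: "\<bar>Q t \<tau>\<bar> \<le> 2 * K * exp (- r * \<bar>\<tau>\<bar>)" for t \<tau>
  proof (cases "lo \<tau> \<le> hi t \<tau>")
    case True
    \<comment> \<open>The coordinates sum to |\<tau>| at the near endpoint and to no less at the far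
      one, so a single function of the lag dominates both for all \<open>t\<close>.\<close>
    have "\<bar>\<tau>\<bar> \<le> \<tau> + 2 * hi t \<tau>" using True by (auto simp: lo_def)
    then have "K * exp (- r * (\<tau> + 2 * hi t \<tau>)) \<le> K * exp (- r * \<bar>\<tau>\<bar>)"
      using r K0 by (intro mult_left_mono) auto
    then show ?thesis using True Lb[of \<tau>] end_bound[OF True] unfolding Qeq by auto
  qed (use K0 in \<open>simp add: Qeq\<close>)
  have Ql: "((\<lambda>t. Q t \<tau>) \<longlongrightarrow> L \<tau>) at_top" for \<tau>
  proof -
    have hi: "filterlim (\<lambda>t. hi t \<tau>) at_top at_top"
    proof -
      have "hi t \<tau> = min s (- \<tau>) + t" for t by (auto simp: hi_def)
      then show ?thesis by (simp add: filterlim_tendsto_add_at_top[OF tendsto_const filterlim_ident])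
    qed
    have ev: "\<forall>\<^sub>F t in at_top. lo \<tau> \<le> hi t \<tau>"
      using hi by (simp add: filterlim_at_top)
    have "((\<lambda>t. K * exp (- r * (\<tau> + 2 * hi t \<tau>))) \<longlongrightarrow> K * 0) at_top"
    proof (intro tendsto_mult tendsto_const filterlim_compose[OF exp_at_bot])
      show "filterlim (\<lambda>t. - r * (\<tau> + 2 * hi t \<tau>)) at_bot at_top"
        using r by (intro filterlim_tendsto_neg_mult_at_bot[OF tendsto_const] filterlim_tendsto_add_at_top[OF tendsto_const]
            filterlim_tendsto_pos_mult_at_top[OF tendsto_const] hi) auto
    qed
    then have z: "((\<lambda>t. K * exp (- r * (\<tau> + 2 * hi t \<tau>))) \<longlongrightarrow> 0) at_top" by simp
    have "((\<lambda>t. g (hi t \<tau> + \<tau>) (hi t \<tau>)) \<longlongrightarrow> 0) at_top"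
      by (rule Lim_null_comparison[OF _ z]) (use ev end_bound in \<open>auto elim!: eventually_mono\<close>)
    then have "((\<lambda>t. L \<tau> - g (hi t \<tau> + \<tau>) (hi t \<tau>)) \<longlongrightarrow> L \<tau> - 0) at_top"
      by (intro tendsto_diff tendsto_const)
    then have "((\<lambda>t. L \<tau> - g (hi t \<tau> + \<tau>) (hi t \<tau>)) \<longlongrightarrow> L \<tau>) at_top" by simp
    then show ?thesis
      by (rule Lim_transform_eventually) (use ev in \<open>auto simp: Qeq elim!: eventually_mono\<close>)
  qed
  have dom: "integrable lborel (\<lambda>\<tau>. B * (2 * K * exp (- r * \<bar>\<tau>\<bar>)))"
    by (intro integrable_mult_right integrable_exp_abs r)
  have "((\<lambda>t. \<integral>\<tau>. \<kappa> (s + \<tau>) * Q t \<tau> \<partial>lborel) \<longlongrightarrow> (\<integral>\<tau>. \<kappa> (s + \<tau>) * L \<tau> \<partial>lborel)) at_top"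
  proof (rule integral_dominated_convergence_at_top[OF _ _ dom])
    show "\<forall>\<^sub>F t in at_top. AE \<tau> in lborel. norm (\<kappa> (s + \<tau>) * Q t \<tau>) \<le> B * (2 * K * exp (- r * \<bar>\<tau>\<bar>))"
      unfolding real_norm_def abs_mult
      by (intro always_eventually allI AE_I2 mult_mono B Qb B0) auto
    show "AE \<tau> in lborel. ((\<lambda>t. \<kappa> (s + \<tau>) * Q t \<tau>) \<longlongrightarrow> \<kappa> (s + \<tau>) * L \<tau>) at_top"
      by (intro AE_I2 tendsto_mult tendsto_const Ql)
  qed auto
  also have "(\<integral>\<tau>. \<kappa> (s + \<tau>) * L \<tau> \<partial>lborel)
    = (LINT \<tau>:{0..}|lborel. \<kappa> (\<tau> + s) * g \<tau> 0) + (LINT \<tau>:{0..}|lborel. \<kappa> (s - \<tau>) * g 0 \<tau>)"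
  proof -
    have i: "integrable lborel (\<lambda>\<tau>. \<kappa> (s + \<tau>) * L \<tau>)"
    proof (rule Bochner_Integration.integrable_bound[OF dom])
      have "norm (\<kappa> (s + \<tau>) * L \<tau>) \<le> norm (B * (2 * K * exp (- r * \<bar>\<tau>\<bar>)))" for \<tau>
      proof -
        have "\<bar>L \<tau>\<bar> \<le> 2 * K * exp (- r * \<bar>\<tau>\<bar>)" by (rule order_trans[OF Lb]) (use K0 in auto)
        then show ?thesis using B0 K0 B by (auto simp: abs_mult intro!: mult_mono)
      qed
      then show "AE \<tau> in lborel. norm (\<kappa> (s + \<tau>) * L \<tau>) \<le> norm (B * (2 * K * exp (- r * \<bar>\<tau>\<bar>)))" by simp
    qed measurable
    have i1: "integrable lborel (\<lambda>\<tau>. indicator {0..} \<tau> *\<^sub>R (\<kappa> (s + \<tau>) * L \<tau>))"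
      and i2: "integrable lborel (\<lambda>\<tau>. indicator {..<0} \<tau> *\<^sub>R (\<kappa> (s + \<tau>) * L \<tau>))"
      by (intro integrable_mult_indicator i; simp)+
    have "(\<integral>\<tau>. \<kappa> (s + \<tau>) * L \<tau> \<partial>lborel) =
       (\<integral>\<tau>. indicator {0..} \<tau> *\<^sub>R (\<kappa> (s + \<tau>) * L \<tau>) + indicator {..<0} \<tau> *\<^sub>R (\<kappa> (s + \<tau>) * L \<tau>) \<partial>lborel)"
      by (intro Bochner_Integration.integral_cong) (auto simp: indicator_def)
    also have "\<dots> = (\<integral>\<tau>. indicator {0..} \<tau> *\<^sub>R (\<kappa> (s + \<tau>) * L \<tau>) \<partial>lborel) + (\<integral>\<tau>. indicator {..<0} \<tau> *\<^sub>R (\<kappa> (s + \<tau>) * L \<tau>) \<partial>lborel)"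
      by (rule Bochner_Integration.integral_add[OF i1 i2])
    also have "(\<integral>\<tau>. indicator {0..} \<tau> *\<^sub>R (\<kappa> (s + \<tau>) * L \<tau>) \<partial>lborel) = (LINT \<tau>:{0..}|lborel. \<kappa> (\<tau> + s) * g \<tau> 0)"
      unfolding set_lebesgue_integral_def
      by (intro Bochner_Integration.integral_cong) (auto simp: indicator_def Leq add.commute)
    also have "(\<integral>\<tau>. indicator {..<0} \<tau> *\<^sub>R (\<kappa> (s + \<tau>) * L \<tau>) \<partial>lborel)
       = (\<integral>\<tau>. indicator {..<0} (- \<tau>) *\<^sub>R (\<kappa> (s + (- \<tau>)) * L (- \<tau>)) \<partial>lborel)"
      by (subst lborel_integral_real_affine[where c = "-1" and t = 0]) auto
    also have "\<dots> = (LINT \<tau>:{0..}|lborel. \<kappa> (s - \<tau>) * g 0 \<tau>)"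
      unfolding set_lebesgue_integral_def
    proof (rule integral_cong_AE)
      \<comment> \<open>After the reflection the half line is open, while the target is closed; the
        point 0 is a null set.\<close>
      show "AE \<tau> in lborel. indicator {..<0} (- \<tau>) *\<^sub>R (\<kappa> (s + (- \<tau>)) * L (- \<tau>)) = indicator {0..} \<tau> *\<^sub>R (\<kappa> (s - \<tau>) * g 0 \<tau>)"
        using AE_lborel_singleton[of "0::real"] by eventually_elim (auto simp: indicator_def Leq)
    qed auto
    finally show ?thesis .
  qed
  finally show ?thesis unfolding Q_def .
qed

text \<open>The covariance of two Wiener integrals, computed from the covariance \<open>min u v\<close> of Brownian
  motion after integrating by parts in each variable.\<close>
lemma integral_min_by_parts:
  fixes b b' :: "real \<Rightarrow> real"
  assumes b: "\<And>x. (b has_real_derivative b' x) (at x)" and b': "continuous_on UNIV b'"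
    and u: "0 \<le> u" "u \<le> t"
  shows "b 0 * u + integral {0..t} (\<lambda>v. b' (t - v) * min v u) = integral {0..u} (\<lambda>v. b (t - v))"
proof -
  have bc: "continuous_on UNIV b" using b by (meson DERIV_isCont continuous_at_imp_continuous_on)
  have c: "continuous_on S (\<lambda>v. b (t - v))" "continuous_on S (\<lambda>v. b' (t - v))" for S
    by (rule continuous_on_compose2[OF bc] continuous_on_compose2[OF b']; (intro continuous_intros | simp))+
  have d: "((\<lambda>v. b (t - v)) has_real_derivative - b' (t - v)) (at v within S)" for v S
    by (rule DERIV_subset, rule DERIV_chain2[OF b, THEN DERIV_cong]) (auto intro!: derivative_eq_intros)
  have "integral {0..t} (\<lambda>v. b' (t - v) * min v u)
     = integral {0..u} (\<lambda>v. b' (t - v) * min v u) + integral {u..t} (\<lambda>v. b' (t - v) * min v u)"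
    by (rule Henstock_Kurzweil_Integration.integral_combine[symmetric, OF u])
       (intro integrable_continuous_interval continuous_intros c)
  \<comment> \<open>Subtracting and adding \<open>b (t - v)\<close> completes the first part to the
    derivative of -v b(t - v).\<close>
  also have "integral {0..u} (\<lambda>v. b' (t - v) * min v u) = integral {0..u} (\<lambda>v. (b' (t - v) * v - b (t - v)) + b (t - v))"
    by (intro integral_cong) auto
  also have "\<dots> = integral {0..u} (\<lambda>v. b' (t - v) * v - b (t - v)) + integral {0..u} (\<lambda>v. b (t - v))"
    by (intro Henstock_Kurzweil_Integration.integral_add integrable_continuous_interval continuous_intros c)
  also have "integral {0..u} (\<lambda>v. b' (t - v) * v - b (t - v)) = - (u * b (t - u)) - (- (0 * b (t - 0)))"
    by (intro integral_unique fundamental_theorem_of_calculus u)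
       (auto simp: has_real_derivative_iff_has_vector_derivative[symmetric] intro!: derivative_eq_intros d)
  also have "integral {u..t} (\<lambda>v. b' (t - v) * min v u) = integral {u..t} (\<lambda>v. u * b' (t - v))"
    by (intro integral_cong) auto
  also have "\<dots> = - u * b (t - t) - (- u * b (t - u))"
    by (intro integral_unique fundamental_theorem_of_calculus u)
       (auto simp: has_real_derivative_iff_has_vector_derivative[symmetric] intro!: derivative_eq_intros d)
  finally show ?thesis by simp
qed

text \<open>The fundamental theorem for a(t - u) times the primitive of \<open>c\<close>, whose
  value at u = 0 vanishes. It undoes the remaining integration by parts in the covariance of two
  Wiener integrals.\<close>

lemma integral_by_parts_antiderivative:
  fixes a a' c :: "real \<Rightarrow> real"
  assumes a: "\<And>x. (a has_real_derivative a' x) (at x)" and a': "continuous_on UNIV a'"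
    and c: "continuous_on UNIV c" and t: "0 \<le> t"
  shows "a 0 * integral {0..t} c + integral {0..t} (\<lambda>u. a' (t - u) * integral {0..u} c)
    = integral {0..t} (\<lambda>u. a (t - u) * c u)"
proof -
  have ac: "continuous_on UNIV a" using a by (meson DERIV_isCont continuous_at_imp_continuous_on)
  have cc: "continuous_on S (\<lambda>v. a (t - v))" "continuous_on S (\<lambda>v. a' (t - v))" for S
    by (rule continuous_on_compose2[OF ac] continuous_on_compose2[OF a']; (intro continuous_intros | simp))+
  have d: "((\<lambda>v. a (t - v)) has_real_derivative - a' (t - v)) (at v within S)" for v S
    by (rule DERIV_subset, rule DERIV_chain2[OF a, THEN DERIV_cong]) (auto intro!: derivative_eq_intros)
  have k: "((\<lambda>u. integral {0..u} c) has_real_derivative c u) (at u within {0..t})" if "u \<in> {0..t}" for u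
    by (rule integral_has_real_derivative[OF continuous_on_subset[OF c] that]) simp
  have ak: "((\<lambda>u. a (t - u) * integral {0..u} c) has_real_derivative
      - a' (t - u) * integral {0..u} c + c u * a (t - u)) (at u within {0..t})" if "u \<in> {0..t}" for u
    by (rule DERIV_mult[OF d k[OF that]])
  have kc: "continuous_on {0..t} (\<lambda>u. integral {0..u} c)"
    using k by (meson DERIV_continuous continuous_on_eq_continuous_within)
  have "integral {0..t} (\<lambda>u. - a' (t - u) * integral {0..u} c + c u * a (t - u))
      = a (t - t) * integral {0..t} c - a (t - 0) * integral {0..0} c"
    by (intro integral_unique fundamental_theorem_of_calculus t)
       (rule ak[unfolded has_real_derivative_iff_has_vector_derivative])
  also have "integral {0..t} (\<lambda>u. - a' (t - u) * integral {0..u} c + c u * a (t - u))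
      = integral {0..t} (\<lambda>u. - (a' (t - u) * integral {0..u} c)) + integral {0..t} (\<lambda>u. a (t - u) * c u)"
    by (subst Henstock_Kurzweil_Integration.integral_add[symmetric])
       (auto intro!: integrable_continuous_interval continuous_intros cc kc continuous_on_subset[OF c] simp: mult.commute)
  finally show ?thesis by simp
qed

section \<open>The damped network\<close>


locale damped_network =
  fixes E :: "'n::{finite,linorder} \<Rightarrow> 'n \<Rightarrow> bool" and m :: nat and \<alpha> :: real
    and V :: "real^('n::{finite,linorder})^('n::{finite,linorder})"
  assumes V: "V \<in> H_Gamma E" and alpha: "\<alpha> > 0" and L0: "L_zero \<alpha> m V = {0}"
begin

abbreviation "A \<equiv> Amat \<alpha> m V"
abbreviation "C \<equiv> C_Gibbs (2 * \<alpha>) V"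
abbreviation "D \<equiv> {k. damped m k}"

definition flow :: "real \<Rightarrow> real^('n + 'n)^('n + 'n)" where "flow t = mexp (t *\<^sub>R A)"
text \<open>The functional \<open>c\<close> carried along by the adjoint flow: pairing with
  \<open>adj c t\<close> replaces letting e^{tA} act on the state, and all matrix identities become
  scalar ones.\<close>

definition adj :: "real^('n + 'n) \<Rightarrow> real \<Rightarrow> real^('n + 'n)" where "adj c t = transpose (flow t) *v c"
definition adj' :: "real^('n + 'n) \<Rightarrow> real \<Rightarrow> real^('n + 'n)" where "adj' c t = transpose A *v adj c t"

lemma flow_add: "flow (s + t) = flow s ** flow t"
  unfolding flow_def by (rule mexp_add)

lemma flow_0: "flow 0 = mat 1"
  unfolding flow_def by (rule mexp_0)

lemma adj_0: "adj c 0 = c"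
  by (simp add: adj_def flow_0 transpose_mat)

lemma inner_flow: "c \<bullet> (flow t *v x) = adj c t \<bullet> x"
  unfolding adj_def transpose_matrix_vector dot_lmul_matrix ..

lemma adj_inner_flow_minus: "adj c t \<bullet> (flow (- s) *v x) = adj c (t - s) \<bullet> x"
  using flow_add[of t "- s"] by (simp add: inner_flow[symmetric] matrix_vector_mul_assoc)

lemma adj'_inner: "adj c t \<bullet> (A *v x) = adj' c t \<bullet> x"
  unfolding adj'_def transpose_matrix_vector dot_lmul_matrix ..

lemma adj_derivative: "((\<lambda>t. adj c t $ i) has_real_derivative adj' c t $ i) (at t)"
proof -
  have "((\<lambda>t. \<Sum>j\<in>UNIV. mexp (t *\<^sub>R A) $ j $ i * c $ j) has_real_derivative
      (\<Sum>j\<in>UNIV. (A ** mexp (t *\<^sub>R A)) $ j $ i * c $ j)) (at t)"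
    by (intro DERIV_sum DERIV_cmult_right mexp_has_field_derivative)
  moreover have "(\<Sum>j\<in>UNIV. (A ** mexp (t *\<^sub>R A)) $ j $ i * c $ j) = adj' c t $ i"
    unfolding mexp_has_field_derivative(2) adj'_def adj_def flow_def matrix_vector_mul_assoc
      matrix_transpose_mul[symmetric]
    by (simp add: matrix_vector_mult_def transpose_def del: transpose_matrix_vector)
  ultimately show ?thesis by (simp add: adj_def flow_def matrix_vector_mult_def transpose_def del: transpose_matrix_vector)
qed

lemma continuous_flow: "continuous_on S flow"
  unfolding flow_def[abs_def] by (rule continuous_mexp)

lemma continuous_adj: "continuous_on S (adj c)"
proof -
  have "continuous_on S (\<lambda>t. \<chi> i. adj c t $ i)"
    by (intro continuous_on_vec_lambda continuous_at_imp_continuous_on ballI DERIV_isCont[OF adj_derivative])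
  then show ?thesis by simp
qed

lemma continuous_adj': "continuous_on S (adj' c)"
  unfolding adj'_def[abs_def]
  by (intro linear_continuous_on_compose[OF continuous_adj] matrix_vector_mul_linear)

lemma flow_decay:
  obtains K r where "K > 0" "r > 0" "\<And>t. t \<ge> 0 \<Longrightarrow> norm (flow t) \<le> K * exp (- r * t)"
  using mexp_decay_of_tendsto[OF mexp_Amat_tendsto_0[OF V L0]] unfolding flow_def by blast

lemma norm_transpose: "norm (transpose X) = norm (X :: real^'k^'l)"
  unfolding norm_vec_def L2_set_def transpose_def
  by (simp add: sum_nonneg) (rule sum.swap)

text \<open>The vector is read as a matrix with one column, so that the bound for products of
  matrices applies.\<close>

lemma norm_matrix_vector_le: "norm (X *v x) \<le> norm X * norm (x :: real^'k)" for X :: "real^'k^'l"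
proof -
  have "norm (X *v x) = norm (X ** (\<chi> i (j::unit). x $ i))"
    by (simp add: norm_vec_def L2_set_def matrix_vector_mult_def matrix_matrix_mult_def UNIV_unit)
  also have "\<dots> \<le> norm X * norm ((\<chi> i (j::unit). x $ i) :: real^unit^'k)" by (rule norm_matrix_mult_le)
  also have "norm ((\<chi> i (j::unit). x $ i) :: real^unit^'k) = norm x"
    by (simp add: norm_vec_def L2_set_def UNIV_unit)
  finally show ?thesis .
qed

lemma adj_bound: "norm (flow t) \<le> b \<Longrightarrow> norm (adj c t) \<le> b * norm c"
  unfolding adj_def
  by (rule order_trans[OF norm_matrix_vector_le]) (simp add: norm_transpose mult_right_mono)

lemma flow_tendsto_0: "((\<lambda>t. flow t *v x) \<longlongrightarrow> 0) at_top"
proof (rule Lim_null_comparison)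
  show "\<forall>\<^sub>F t in at_top. norm (flow t *v x) \<le> norm (flow t) * norm x"
    by (simp add: norm_matrix_vector_le)
  show "((\<lambda>t. norm (flow t) * norm x) \<longlongrightarrow> 0) at_top"
    using mexp_Amat_tendsto_0[OF V L0] unfolding flow_def
    by (intro tendsto_mult_left_zero tendsto_norm_zero)
qed

text \<open>The coefficient of e^{xA} C e^{yA^T} between \<open>c\<close> and
  \<open>d\<close>.\<close>

definition gibbs_form :: "real^('n + 'n) \<Rightarrow> real^('n + 'n) \<Rightarrow> real \<Rightarrow> real \<Rightarrow> real" where
  "gibbs_form c d x y = adj c x \<bullet> (C *v adj d y)"

text \<open>The same coefficient with the projection onto the forced momenta in place of C.\<close>

definition damped_form :: "real^('n + 'n) \<Rightarrow> real^('n + 'n) \<Rightarrow> real \<Rightarrow> real \<Rightarrow> real" where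
  "damped_form c d x y = (\<Sum>k\<in>D. adj c x $ Inr k * adj d y $ Inr k)"

lemma C_inner_symmetric: "x \<bullet> (C *v y) = y \<bullet> (C *v x)"
  using inner_matrix_vector_left[of C x y] transpose_C_Gibbs[OF V] by (simp add: inner_commute)

lemma gibbs_form_commute: "gibbs_form c d x y = gibbs_form d c y x"
  unfolding gibbs_form_def by (rule C_inner_symmetric)

text \<open>The Lyapunov equation along a diagonal line. Arbitrary \<open>f\<close> and
  \<open>h\<close> of slope 1 cover both uses: points (y + \<tau>, y) of fixed lag and joint shifts
  (t + u, t' + u).\<close>

lemma gibbs_form_derivative:
  assumes f: "\<And>y. (f has_real_derivative 1) (at y)" and h: "\<And>y. (h has_real_derivative 1) (at y)"
  shows "((\<lambda>y. gibbs_form c d (f y) (h y)) has_real_derivative - damped_form c d (f y) (h y)) (at y)"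
proof -
  have df: "((\<lambda>y. adj c (f y) $ i) has_real_derivative adj' c (f y) $ i) (at y)"
    if "(f has_real_derivative 1) (at y)" for c i and f :: "real \<Rightarrow> real"
    using DERIV_chain2[OF adj_derivative that] by simp
  have "((\<lambda>y. \<Sum>i\<in>UNIV. adj c (f y) $ i * (\<Sum>j\<in>UNIV. C $ i $ j * adj d (h y) $ j)) has_real_derivative
      (\<Sum>i\<in>UNIV. adj' c (f y) $ i * (\<Sum>j\<in>UNIV. C $ i $ j * adj d (h y) $ j)
        + (\<Sum>j\<in>UNIV. C $ i $ j * adj' d (h y) $ j) * adj c (f y) $ i)) (at y)"
    by (intro DERIV_sum DERIV_mult DERIV_cmult df f h)
  moreover have "(\<Sum>i\<in>UNIV. adj' c (f y) $ i * (\<Sum>j\<in>UNIV. C $ i $ j * adj d (h y) $ j)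
        + (\<Sum>j\<in>UNIV. C $ i $ j * adj' d (h y) $ j) * adj c (f y) $ i)
     = adj' c (f y) \<bullet> (C *v adj d (h y)) + adj c (f y) \<bullet> (C *v adj' d (h y))"
    by (simp add: inner_vec_def matrix_vector_mult_def sum.distrib mult.commute)
  moreover have "\<dots> = - damped_form c d (f y) (h y)"
    unfolding adj'_def damped_form_def by (rule lyapunov_C_Gibbs[OF V alpha])
  ultimately show ?thesis
    by (simp add: gibbs_form_def[abs_def] inner_vec_def matrix_vector_mult_def)
qed

lemma continuous_damped_form: "continuous_on UNIV (\<lambda>(x, y). damped_form c d x y)"
  unfolding damped_form_def split_beta'
  by (intro continuous_intros continuous_on_compose2[OF continuous_adj[of UNIV]]) auto

lemma continuous_gibbs_form:
  "continuous_on UNIV (\<lambda>x. gibbs_form c d x 0)" "continuous_on UNIV (\<lambda>y. gibbs_form c d 0 y)"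
  unfolding gibbs_form_def
  by (intro continuous_intros continuous_adj linear_continuous_on_compose[OF continuous_adj] matrix_vector_mul_linear)+

lemma gibbs_form_bound:
  obtains K r where "r > 0" "\<And>x y. x \<ge> 0 \<Longrightarrow> y \<ge> 0 \<Longrightarrow> \<bar>gibbs_form c d x y\<bar> \<le> K * exp (- r * (x + y))"
proof -
  obtain K r where K: "K > 0" "r > 0" "\<And>t. t \<ge> 0 \<Longrightarrow> norm (flow t) \<le> K * exp (- r * t)"
    by (rule flow_decay) (rule that)
  show thesis
  proof (rule that[OF K(2)])
    fix x y :: real assume xy: "x \<ge> 0" "y \<ge> 0"
    have "\<bar>gibbs_form c d x y\<bar> \<le> norm (adj c x) * (norm C * norm (adj d y))"
      unfolding gibbs_form_def
      by (rule order_trans[OF Cauchy_Schwarz_ineq2]) (intro mult_left_mono norm_matrix_vector_le, simp)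
    also have "\<dots> \<le> (K * exp (- r * x) * norm c) * (norm C * (K * exp (- r * y) * norm d))"
      using K xy by (intro mult_mono adj_bound mult_nonneg_nonneg) auto
    also have "\<dots> = (K * norm c * (norm C * K * norm d)) * exp (- r * (x + y))"
      using exp_add[of "- r * x" "- r * y"] by (simp add: distrib_left mult_ac)
    finally show "\<bar>gibbs_form c d x y\<bar> \<le> (K * norm c * (norm C * K * norm d)) * exp (- r * (x + y))" .
  qed
qed

end

section \<open>Convergence to the stationary law\<close>


context gaussian_noise begin

text \<open>Everything is reduced to scalar covariance limits: every functional of the solution is a
  vanishing deterministic part plus an element of \<open>gspace\<close>, whose characteristic
  function depends on its variance only.\<close>

lemma stationary_limitI:
  fixes sol :: "real^('n::finite + 'n) \<Rightarrow> real \<Rightarrow> 'w \<Rightarrow> real^('n + 'n)"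
    and u :: "real^('n + 'n) \<Rightarrow> real \<Rightarrow> real^('n + 'n)"
  assumes rep: "\<And>c x t \<omega>. t \<ge> 0 \<Longrightarrow> \<omega> \<in> space M \<Longrightarrow> c \<bullet> sol x t \<omega> = c \<bullet> u x t + X c t \<omega>"
    and u: "\<And>x. (u x \<longlongrightarrow> 0) at_top"
    and X: "\<And>c t. t \<ge> 0 \<Longrightarrow> X c t \<in> gspace"
    and lim: "\<And>c d s. ((\<lambda>t. expectation (\<lambda>\<omega>. X c t \<omega> * X d (t + s) \<omega>)) \<longlongrightarrow>
        c \<bullet> ((W s ** C_Gibbs (2 * \<alpha>) V + C_Gibbs (2 * \<alpha>) V ** transpose (W (- s))) *v d)) at_top"
  shows "stationary_limit M \<alpha> V sol W"
proof -
  define S where "S s = W s ** C_Gibbs (2 * \<alpha>) V + C_Gibbs (2 * \<alpha>) V ** transpose (W (- s))" for s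
  note lim = lim[folded S_def]
  have Sij: "S s $ i $ j = axis i 1 \<bullet> (S s *v axis j 1)" for s i j
    by (simp add: inner_axis_matrix)
  have lim0: "((\<lambda>t. expectation (\<lambda>\<omega>. X c t \<omega> * X d t \<omega>)) \<longlongrightarrow> c \<bullet> (S 0 *v d)) at_top" for c d
    using lim[of c d 0] by simp
  \<comment> \<open>Symmetry of \<open>S 0\<close>, and positivity below, are not visible in the
    formula; they are inherited from the covariances that converge to it.\<close>
  have "S 0 $ i $ j = S 0 $ j $ i" for i j
  proof -
    have "(\<lambda>t. expectation (\<lambda>\<omega>. X (axis i 1) t \<omega> * X (axis j 1) t \<omega>))
        = (\<lambda>t. expectation (\<lambda>\<omega>. X (axis j 1) t \<omega> * X (axis i 1) t \<omega>))"
      by (simp add: mult.commute)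
    then show ?thesis
      unfolding Sij using lim0[of "axis i 1" "axis j 1"] lim0[of "axis j 1" "axis i 1"]
      by (auto intro: tendsto_unique[OF trivial_limit_at_top_linorder])
  qed
  then have sym: "transpose (S 0) = S 0" by (simp add: transpose_def vec_eq_iff)
  have psd: "c \<bullet> (S 0 *v c) \<ge> 0" for c
    by (rule tendsto_lowerbound[OF lim0]) (simp_all add: integral_nonneg)
  obtain \<mu> where \<mu>: "normal_law \<mu> (S 0)" using normal_law_exists[OF sym psd] by blast
  have sol_inner: "(\<lambda>\<omega>. c \<bullet> sol x t \<omega>) \<in> borel_measurable M" if "t \<ge> 0" for c x t
  proof -
    have [measurable]: "X c t \<in> borel_measurable M" by (rule gspace_measurable[OF X[OF that]])
    have "(\<lambda>\<omega>. c \<bullet> u x t + X c t \<omega>) \<in> borel_measurable M" by measurable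
    then show ?thesis by (rule measurable_cong[THEN iffD1, rotated]) (simp add: rep that)
  qed
  have solm: "sol x t \<in> borel_measurable M" if "t \<ge> 0" for x t
    by (subst borel_measurable_euclidean_space, intro ballI, subst inner_commute, rule sol_inner[OF that])
  have solc: "sol x t \<omega> $ i = u x t $ i + X (axis i 1) t \<omega>" if "t \<ge> 0" "\<omega> \<in> space M" for x t \<omega> i
    using rep[OF that, of "axis i 1" x] by (simp add: inner_axis')
  have weak: "weak_conv_at_top (\<lambda>t. distr M borel (sol x t)) \<mu>" for x
    unfolding weak_conv_at_top_def
  proof (intro allI impI, elim conjE)
    fix h :: "real^('n + 'n) \<Rightarrow> real" assume h: "continuous_on UNIV h" "bounded (range h)"
    obtain B where B: "\<And>y. \<bar>h y\<bar> \<le> B" using h(2) by (auto simp: bounded_iff)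
    show "((\<lambda>t. \<integral>y. h y \<partial>distr M borel (sol x t)) \<longlongrightarrow> (\<integral>y. h y \<partial>\<mu>)) at_top"
    proof (rule tendsto_at_topI_sequentially)
      fix T :: "nat \<Rightarrow> real" assume T: "filterlim T at_top sequentially"
      \<comment> \<open>The representation holds for nonnegative times only; cutting the sequence
        off at 0 changes finitely many terms.\<close>
      define T' where "T' n = max 0 (T n)" for n
      have T': "filterlim T' at_top sequentially"
        by (rule filterlim_at_top_mono[OF T]) (simp add: T'_def)
      have T0: "T' n \<ge> 0" for n by (simp add: T'_def)
      define P where "P n = distr M borel (sol x (T' n))" for n
      have "(\<lambda>n. \<integral>y. h y \<partial>P n) \<longlonglongrightarrow> (\<integral>y. h y \<partial>\<mu>)"
      proof (rule weak_conv_of_char[OF _ _ _ _ _ h(1) B])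
        show "prob_space (P n)" "sets (P n) = sets borel" for n
          unfolding P_def using solm[OF T0] by (auto intro: prob_space_distr)
        show "prob_space \<mu>" "sets \<mu> = sets borel" using \<mu> by (auto simp: normal_law_def)
        fix c
        have "(CLINT y|P n. iexp (c \<bullet> y)) = iexp (c \<bullet> u x (T' n)) *
            of_real (exp (- expectation (\<lambda>\<omega>. X c (T' n) \<omega> * X c (T' n) \<omega>) / 2))" for n
        proof -
          have "(CLINT y|P n. iexp (c \<bullet> y)) = (CLINT \<omega>|M. iexp (c \<bullet> sol x (T' n) \<omega>))"
            unfolding P_def using solm[OF T0] by (subst integral_distr) auto
          also have "\<dots> = (CLINT \<omega>|M. iexp (c \<bullet> u x (T' n)) * iexp (X c (T' n) \<omega>))"
            by (intro Bochner_Integration.integral_cong refl) (simp add: rep T0 exp_add[symmetric] algebra_simps)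
          also have "\<dots> = iexp (c \<bullet> u x (T' n)) * (CLINT \<omega>|M. iexp (X c (T' n) \<omega>))"
            by (rule integral_mult_right_zero)
          finally show ?thesis using gspace_char[OF X[OF T0]] by (simp add: power2_eq_square)
        qed
        moreover have "(\<lambda>n. iexp (c \<bullet> u x (T' n)) *
            of_real (exp (- expectation (\<lambda>\<omega>. X c (T' n) \<omega> * X c (T' n) \<omega>) / 2)))
          \<longlonglongrightarrow> iexp (c \<bullet> 0) * of_real (exp (- (c \<bullet> (S 0 *v c)) / 2))"
          by (intro tendsto_intros filterlim_compose[OF u T'] filterlim_compose[OF lim0 T']) simp
        ultimately show "(\<lambda>n. CLINT y|P n. iexp (c \<bullet> y)) \<longlonglongrightarrow> (CLINT y|\<mu>. iexp (c \<bullet> y))"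
          using \<mu> by (simp add: normal_law_def)
      qed
      moreover have "\<forall>\<^sub>F n in sequentially. (\<integral>y. h y \<partial>P n) = (\<integral>y. h y \<partial>distr M borel (sol x (T n)))"
      proof -
        have "\<forall>\<^sub>F n in sequentially. T n \<ge> 0" using T by (simp add: filterlim_at_top)
        then show ?thesis by eventually_elim (simp add: P_def T'_def max_def)
      qed
      ultimately show "(\<lambda>n. \<integral>y. h y \<partial>distr M borel (sol x (T n))) \<longlonglongrightarrow> (\<integral>y. h y \<partial>\<mu>)"
        by (rule Lim_transform_eventually)
    qed
  qed
  have covlim: "((\<lambda>t. \<integral>\<omega>. outer (sol x t \<omega>) (sol x (t + s) \<omega>) \<partial>M) \<longlongrightarrow> S s) at_top" for x s
  proof (intro vec_tendstoI)
    fix i j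
    let ?X = "\<lambda>i. X (axis i 1)"
    have shift: "filterlim (\<lambda>t. t + s) at_top at_top"
      using filterlim_tendsto_add_at_top[OF tendsto_const filterlim_ident, of s] by (simp add: add.commute)
    have "((\<lambda>t. u x t $ i * u x (t + s) $ j + expectation (\<lambda>\<omega>. ?X i t \<omega> * ?X j (t + s) \<omega>))
        \<longlongrightarrow> 0 $ i * 0 $ j + axis i 1 \<bullet> (S s *v axis j 1)) at_top"
      by (intro tendsto_add tendsto_mult tendsto_vec_nth u filterlim_compose[OF u shift] lim)
    then have "((\<lambda>t. u x t $ i * u x (t + s) $ j + expectation (\<lambda>\<omega>. ?X i t \<omega> * ?X j (t + s) \<omega>))
        \<longlongrightarrow> S s $ i $ j) at_top" by (simp add: Sij)
    moreover have "\<forall>\<^sub>F t in at_top. u x t $ i * u x (t + s) $ j + expectation (\<lambda>\<omega>. ?X i t \<omega> * ?X j (t + s) \<omega>)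
        = (\<integral>\<omega>. outer (sol x t \<omega>) (sol x (t + s) \<omega>) \<partial>M) $ i $ j"
      \<comment> \<open>The lag may be negative; beyond this bound both \<open>t\<close> and
        \<open>t + s\<close> are nonnegative.\<close>
      using eventually_ge_at_top[of "max 0 (- s)"]
    proof eventually_elim
      case (elim t)
      then have t: "t \<ge> 0" "t + s \<ge> 0" by auto
      have ii: "integrable M (\<lambda>\<omega>. ?X i t \<omega> * ?X j (t + s) \<omega>)" for i j
        by (intro gspace_integrable_mult X t)
      note i1 = gspace_moments(1)[OF X[OF t(1)]] gspace_moments(1)[OF X[OF t(2)]]
      note m1 = gspace_moments(2)[OF X[OF t(1)]] gspace_moments(2)[OF X[OF t(2)]]
      \<comment> \<open>In the expanded product the two mixed terms have expectation 0, since the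
        random parts are centred.\<close>
      have e: "sol x t \<omega> $ i * sol x (t + s) \<omega> $ j = u x t $ i * u x (t + s) $ j + u x t $ i * ?X j (t + s) \<omega>
         + u x (t + s) $ j * ?X i t \<omega> + ?X i t \<omega> * ?X j (t + s) \<omega>" if "\<omega> \<in> space M" for \<omega> i j
        unfolding solc[OF t(1) that] solc[OF t(2) that] by (simp add: algebra_simps)
      have int: "integrable M (\<lambda>\<omega>. sol x t \<omega> $ i * sol x (t + s) \<omega> $ j)" for i j
      proof (rule Bochner_Integration.integrable_cong[THEN iffD2, OF refl])
        show "integrable M (\<lambda>\<omega>. u x t $ i * u x (t + s) $ j + u x t $ i * ?X j (t + s) \<omega>
         + u x (t + s) $ j * ?X i t \<omega> + ?X i t \<omega> * ?X j (t + s) \<omega>)"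
          by (intro Bochner_Integration.integrable_add integrable_mult_right i1 ii) simp
      qed (rule e)
      have "expectation (\<lambda>\<omega>. sol x t \<omega> $ i * sol x (t + s) \<omega> $ j)
        = expectation (\<lambda>\<omega>. u x t $ i * u x (t + s) $ j + u x t $ i * ?X j (t + s) \<omega>
         + u x (t + s) $ j * ?X i t \<omega> + ?X i t \<omega> * ?X j (t + s) \<omega>)"
        by (intro Bochner_Integration.integral_cong refl e)
      also have "\<dots> = u x t $ i * u x (t + s) $ j + expectation (\<lambda>\<omega>. ?X i t \<omega> * ?X j (t + s) \<omega>)"
        using i1 ii m1 by (simp add: prob_space)
      finally show ?case by (simp add: integral_outer_component[OF int])
    qed
    ultimately show "((\<lambda>t. (\<integral>\<omega>. outer (sol x t \<omega>) (sol x (t + s) \<omega>) \<partial>M) $ i $ j) \<longlongrightarrow> S s $ i $ j) at_top"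
      by (rule Lim_transform_eventually)
  qed
  show ?thesis
    unfolding stationary_limit_def
    using normal_law_gaussian_vec[OF \<mu> psd] weak normal_law_covariance[OF \<mu> sym psd] covlim
    unfolding S_def by (auto intro!: exI[of _ \<mu>])
qed

end

section \<open>Forcing by a stationary process\<close>


context prob_space begin

lemma gaussian_measure_integrable:
  assumes "gaussian_measure (distr M borel X)" "X \<in> borel_measurable M"
  shows "integrable M X"
proof -
  obtain \<mu> \<sigma> where *: "\<sigma> \<ge> 0" "distr M borel X = normal_dist \<mu> \<sigma>"
    using assms(1) by (auto simp: gaussian_measure_iff)
  have "integrable (distr M borel X) (\<lambda>x. x)"
    unfolding *(2) by (rule normal_dist_moments(1)[OF *(1)])
  then show ?thesis
    by (rule integrable_distr_eq[OF assms(2), THEN iffD1, rotated]) simp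
qed

text \<open>The set \<open>U\<close> of admissible times is \<open>UNIV\<close> for the stationary
  process and \<open>{0..}\<close> for Brownian motion.\<close>

lemma normal_rv_sum_of_gaussian:
  assumes X: "\<And>t. t \<in> U \<Longrightarrow> X t \<in> borel_measurable M" and m: "\<And>t. t \<in> U \<Longrightarrow> expectation (X t) = 0"
    and g: "\<And>T c. finite T \<Longrightarrow> T \<subseteq> U \<Longrightarrow> gaussian_measure (distr M borel (\<lambda>\<omega>. \<Sum>t\<in>T. c t * X t \<omega>))"
    and T: "finite T" "T \<subseteq> U"
  shows "\<exists>v. normal_rv M v (\<lambda>\<omega>. \<Sum>t\<in>T. c t * X t \<omega>)"
proof (rule normal_rv_of_gaussian_measure[OF g[OF T]])
  have [measurable]: "X t \<in> borel_measurable M" if "t \<in> T" for t using X T that by auto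
  show "(\<lambda>\<omega>. \<Sum>t\<in>T. c t * X t \<omega>) \<in> borel_measurable M" by measurable
  have i: "integrable M (X t)" if "t \<in> T" for t
    using gaussian_measure_integrable[of "X t"] g[of "{t}" "\<lambda>_. 1"] X[of t] T that by auto
  have "expectation (\<lambda>\<omega>. \<Sum>t\<in>T. c t * X t \<omega>) = (\<Sum>t\<in>T. c t * expectation (X t))"
    by (subst Bochner_Integration.integral_sum) (auto intro: i)
  also have "\<dots> = 0" using m T by (intro sum.neutral) auto
  finally show "expectation (\<lambda>\<omega>. \<Sum>t\<in>T. c t * X t \<omega>) = 0" .
qed

lemma measurable_process:
  assumes "\<And>t. f t \<in> borel_measurable M"
  shows "(\<lambda>\<omega> t. f t \<omega>) \<in> measurable M (\<Pi>\<^sub>M t\<in>UNIV. borel)"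
  using assms by (intro measurable_PiM_single') auto

text \<open>Equality of the path laws transfers the distribution of every measurable functional from
  \<open>f\<close> to its copies; only finite combinations and products of two values are needed.
  Continuity is asked of the copies themselves, since it is not an event of the product
  sigma-algebra.\<close>

lemma gaussian_noise_of_process:
  fixes f :: "real \<Rightarrow> 'a \<Rightarrow> real" and g :: "'i \<Rightarrow> real \<Rightarrow> 'a \<Rightarrow> real"
  assumes fin: "finite I"
    and f: "gaussian_process M f" and mean: "\<And>t. expectation (f t) = 0"
    and cov: "\<And>t s. expectation (\<lambda>\<omega>. f t \<omega> * f (t + s) \<omega>) = Cf s"
    and g: "\<And>k t. k \<in> I \<Longrightarrow> g k t \<in> borel_measurable M"
    and law: "\<And>k. k \<in> I \<Longrightarrow> process_law M (g k) = process_law M f"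
    and cont: "\<And>k \<omega>. k \<in> I \<Longrightarrow> \<omega> \<in> space M \<Longrightarrow> continuous_on UNIV (\<lambda>t. g k t \<omega>)"
    and indep: "indep_vars (\<lambda>_. \<Pi>\<^sub>M t\<in>UNIV. borel) (\<lambda>k \<omega> t. g k t \<omega>) I"
  shows "gaussian_noise M I g (\<lambda>s t. Cf (t - s))"
proof unfold_locales
  have fm: "f t \<in> borel_measurable M" for t using f by (simp add: gaussian_process_def)
  have gM: "(\<lambda>\<omega> t. g k t \<omega>) \<in> measurable M (\<Pi>\<^sub>M t\<in>UNIV. borel)" if "k \<in> I" for k
    by (rule measurable_process) (rule g[OF that])
  have fM: "(\<lambda>\<omega> t. f t \<omega>) \<in> measurable M (\<Pi>\<^sub>M t\<in>UNIV. borel)"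
    by (rule measurable_process) (rule fm)
  show "finite I" by (rule fin)
  show "continuous_on {0..} (\<lambda>t. g k t \<omega>)" if "k \<in> I" "\<omega> \<in> space M" for k \<omega>
    using cont[OF that] by (rule continuous_on_subset) simp
  have transfer: "distr M borel (\<lambda>\<omega>. \<phi> (\<lambda>t. g k t \<omega>)) = distr M borel (\<lambda>\<omega>. \<phi> (\<lambda>t. f t \<omega>))"
    if k: "k \<in> I" and \<phi>: "\<phi> \<in> borel_measurable (\<Pi>\<^sub>M t\<in>(UNIV::real set). borel)" for k and \<phi> :: "(real \<Rightarrow> real) \<Rightarrow> real"
    using arg_cong[OF law[OF k], of "\<lambda>N. distr N borel \<phi>"] gM[OF k] fM \<phi>
    by (simp add: process_law_def distr_distr comp_def)
  have transfer_E: "expectation (\<lambda>\<omega>. \<phi> (\<lambda>t. g k t \<omega>)) = expectation (\<lambda>\<omega>. \<phi> (\<lambda>t. f t \<omega>))"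
    if k: "k \<in> I" and \<phi>: "\<phi> \<in> borel_measurable (\<Pi>\<^sub>M t\<in>(UNIV::real set). borel)" for k and \<phi> :: "(real \<Rightarrow> real) \<Rightarrow> real"
  proof -
    have "(\<lambda>\<omega>. \<phi> (\<lambda>t. g k t \<omega>)) \<in> borel_measurable M" "(\<lambda>\<omega>. \<phi> (\<lambda>t. f t \<omega>)) \<in> borel_measurable M"
      by (rule measurable_compose[OF gM[OF k] \<phi>], rule measurable_compose[OF fM \<phi>])
    then show ?thesis
      using arg_cong[OF transfer[OF that], of "\<lambda>N. \<integral>x. x \<partial>N"] by (simp add: integral_distr)
  qed
  show "\<exists>v. normal_rv M v (\<lambda>\<omega>. \<Sum>t\<in>T. c t * g k t \<omega>)" if "finite T" "T \<subseteq> {0..}" "k \<in> I" for T c k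
  proof (rule normal_rv_sum_of_gaussian[where U = UNIV])
    show "expectation (g k t) = 0" for t
      using transfer_E[OF that(3), of "\<lambda>x. x t"] mean by simp
    show "gaussian_measure (distr M borel (\<lambda>\<omega>. \<Sum>t\<in>T. c t * g k t \<omega>))" if "finite T" for T c
      using transfer[OF \<open>k \<in> I\<close>, of "\<lambda>x. \<Sum>t\<in>T. c t * x t"] f that by (simp add: gaussian_process_def)
  qed (use that g in auto)
  show "indep_vars (\<lambda>_. borel) (\<lambda>k \<omega>. \<Sum>t\<in>T. d k t * g k t \<omega>) I" if "finite T" "T \<subseteq> {0..}" for T d
    using indep_vars_compose2[OF indep, of "\<lambda>k x. \<Sum>t\<in>T. d k t * x t" "\<lambda>_. borel"] by simp
  show "expectation (\<lambda>\<omega>. g k s \<omega> * g k t \<omega>) = Cf (t - s)" if "k \<in> I" "0 \<le> s" "0 \<le> t" for k s t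
    using transfer_E[OF that(1), of "\<lambda>x. x s * x t"] cov[of s "t - s"] by simp
qed

text \<open>Evenness comes from shifting the base point, the bound from 2|xy| \<le> x^2 + y^2. Both
  feed the shear of the covariance integral.\<close>

lemma stationary_covariance:
  fixes f :: "real \<Rightarrow> 'a \<Rightarrow> real"
  assumes f: "gaussian_process M f" and mean: "\<And>t. expectation (f t) = 0"
    and cov: "\<And>t s. expectation (\<lambda>\<omega>. f t \<omega> * f (t + s) \<omega>) = Cf s"
  shows "Cf (- s) = Cf s" "\<bar>Cf s\<bar> \<le> Cf 0"
proof -
  show "Cf (- s) = Cf s"
    using cov[of s "- s"] cov[of 0 s] by (simp add: mult.commute)
  have fm: "f t \<in> borel_measurable M" for t using f by (simp add: gaussian_process_def)
  note [measurable] = fm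
  have n: "\<exists>v. normal_rv M v (f t)" for t
  proof (rule normal_rv_of_gaussian_measure[OF _ fm mean])
    have "gaussian_measure (distr M borel (\<lambda>\<omega>. \<Sum>t\<in>{t}. 1 * f t \<omega>))"
      using f[unfolded gaussian_process_def, THEN conjunct2, rule_format, of "{t}" "\<lambda>_. 1"] by simp
    then show "gaussian_measure (distr M borel (f t))" by simp
  qed
  have sq: "integrable M (\<lambda>\<omega>. (f t \<omega>)\<^sup>2)" for t using n normal_rv_moments(3) by blast
  have sqE: "expectation (\<lambda>\<omega>. (f t \<omega>)\<^sup>2) = Cf 0" for t using cov[of t 0] by (simp add: power2_eq_square)
  have le: "\<bar>x * y\<bar> \<le> (x\<^sup>2 + y\<^sup>2) / 2" for x y :: real
    using sum_squares_bound[of "\<bar>x\<bar>" "\<bar>y\<bar>"] by (simp add: abs_mult)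
  have i2: "integrable M (\<lambda>\<omega>. ((f 0 \<omega>)\<^sup>2 + (f s \<omega>)\<^sup>2) / 2)"
    by (intro integrable_divide Bochner_Integration.integrable_add sq)
  have "integrable M (\<lambda>\<omega>. f 0 \<omega> * f s \<omega>)"
    by (rule Bochner_Integration.integrable_bound[OF i2]) (use le in auto)
  then have "\<bar>expectation (\<lambda>\<omega>. f 0 \<omega> * f s \<omega>)\<bar> \<le> expectation (\<lambda>\<omega>. ((f 0 \<omega>)\<^sup>2 + (f s \<omega>)\<^sup>2) / 2)"
    by (rule abs_integral_le[OF _ i2]) (rule le)
  also have "\<dots> = Cf 0" using sq by (simp add: sqE)
  finally show "\<bar>Cf s\<bar> \<le> Cf 0" using cov[of 0 s] by simp
qed

end

text \<open>Exponential decay of the flow against a bounded kernel makes the matrix integral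
  absolutely convergent, so the functional X -> c.(X x) may be moved inside.\<close>

lemma (in damped_network) Wmat_inner:
  assumes \<kappa>[measurable]: "\<kappa> \<in> borel_measurable borel" and B: "\<And>x. \<bar>\<kappa> x\<bar> \<le> B"
  shows "c \<bullet> (Wmat \<alpha> m V \<kappa> s *v x) = (LINT \<tau>:{0..}|lborel. \<kappa> (\<tau> + s) * (adj c \<tau> \<bullet> x))"
proof -
  obtain K r where K: "K > 0" "r > 0" "\<And>t. t \<ge> 0 \<Longrightarrow> norm (flow t) \<le> K * exp (- r * t)"
    by (rule flow_decay) (rule that)
  have B0: "B \<ge> 0" using B[of 0] by linarith
  have [measurable]: "flow \<in> borel_measurable borel"
    by (rule borel_measurable_continuous_onI[OF continuous_flow])
  have int: "integrable lborel (\<lambda>\<tau>. indicator {0..} \<tau> *\<^sub>R (\<kappa> (\<tau> + s) *\<^sub>R flow \<tau>))"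
  proof (rule Bochner_Integration.integrable_bound[OF integrable_mult_right[OF integrable_exp_abs[OF K(2)], of "B * K"]])
    have "norm (indicator {0..} \<tau> *\<^sub>R (\<kappa> (\<tau> + s) *\<^sub>R flow \<tau>)) \<le> norm (B * K * exp (- r * \<bar>\<tau>\<bar>))" for \<tau> :: real
    proof (cases "\<tau> \<ge> 0")
      case True
      have "\<bar>\<kappa> (\<tau> + s)\<bar> * norm (flow \<tau>) \<le> B * (K * exp (- r * \<tau>))"
        using True B0 by (intro mult_mono B K) auto
      then show ?thesis using True B0 K by (simp add: abs_mult mult.assoc)
    qed simp
    then show "AE \<tau> in lborel. norm (indicator {0..} \<tau> *\<^sub>R (\<kappa> (\<tau> + s) *\<^sub>R flow \<tau>)) \<le> norm (B * K * exp (- r * \<bar>\<tau>\<bar>))"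
      by simp
  qed measurable
  have "linear (\<lambda>X :: real^('n + 'n)^('n + 'n). c \<bullet> (X *v x))"
    by (rule linearI) (simp_all add: matrix_vector_mult_add_rdistrib inner_add_right scaleR_matrix_vector_assoc[symmetric])
  then have bl: "bounded_linear (\<lambda>X :: real^('n + 'n)^('n + 'n). c \<bullet> (X *v x))"
    by (rule linear_conv_bounded_linear[THEN iffD1])
  show ?thesis
    unfolding Wmat_def set_lebesgue_integral_def flow_def[symmetric]
    by (subst integral_bounded_linear[OF bl int, symmetric])
       (simp add: scaleR_matrix_vector_assoc[symmetric] inner_flow mult.assoc)
qed

text \<open>Since C is symmetric, the second summand of the covariance formula is the first with
  \<open>c\<close> and \<open>d\<close> exchanged.\<close>

lemma (in damped_network) transpose_Wmat_inner:
  "c \<bullet> (C *v (transpose X *v d)) = d \<bullet> (X *v (C *v c))"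
proof -
  have "c \<bullet> (C *v (transpose X *v d)) = (transpose X *v d) \<bullet> (C *v c)"
    by (rule C_inner_symmetric)
  also have "\<dots> = d \<bullet> (X *v (C *v c))"
    unfolding transpose_matrix_vector dot_lmul_matrix ..
  finally show ?thesis .
qed

lemma inner_Force: "a \<bullet> Force m g s \<omega> = (\<Sum>k\<in>{k. damped m k}. a $ Inr k * g k s \<omega>)"
  by (simp add: inner_vec_def sum_UNIV_Plus Force_def sum.If_cases if_distrib cong: if_cong)

lemma continuous_Force:
  assumes "\<And>k. damped m k \<Longrightarrow> continuous_on S (\<lambda>s. g k s \<omega>)"
  shows "continuous_on S (\<lambda>s. Force m g s \<omega>)"
proof -
  have "continuous_on S (\<lambda>s. \<chi> i. Force m g s \<omega> $ i)"
  proof (intro continuous_on_vec_lambda)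
    fix i show "continuous_on S (\<lambda>s. Force m g s \<omega> $ i)"
    proof (cases i)
      case (Inr k)
      then show ?thesis using assms[of k] by (cases "damped m k") (simp_all add: Force_def)
    qed (simp add: Force_def)
  qed
  then show ?thesis by simp
qed

text \<open>Tested against \<open>c\<close>, the Duhamel integral becomes a scalar convolution,
  because e^{tA} e^{-sA} moves onto \<open>c\<close> as \<open>adj c (t - s)\<close>.\<close>

lemma (in damped_network) inner_convolution:
  assumes F: "continuous_on {0..t} F"
  shows "c \<bullet> (flow t *v integral {0..t} (\<lambda>s. flow (- s) *v F s)) = integral {0..t} (\<lambda>s. adj c (t - s) \<bullet> F s)"
proof -
  have "continuous_on {0..t} (\<lambda>s. flow (- s) *v F s)"
    unfolding matrix_vector_mult_def
    by (intro continuous_intros continuous_on_compose2[OF continuous_flow[of UNIV]] F) auto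
  from integral_linear[OF integrable_continuous_interval[OF this] bounded_linear_inner_right[of "adj c t"]]
  show ?thesis by (simp add: inner_flow[of c] comp_def adj_inner_flow_minus)
qed

lemma integrable_damped_term:
  fixes a b :: "real \<Rightarrow> real"
  assumes a: "continuous_on UNIV a" and b: "continuous_on UNIV b"
  shows "integrable lborel (\<lambda>y. indicator {0..t'} y * indicator {0..t} (y + \<tau>) * (a (y + \<tau>) * b y))"
proof -
  have [measurable]: "a \<in> borel_measurable borel" "b \<in> borel_measurable borel"
    using a b by (auto intro: borel_measurable_continuous_onI)
  have c: "continuous_on {0..t'} (\<lambda>y. a (y + \<tau>) * b y)"
    by (intro continuous_intros continuous_on_compose2[OF a] continuous_on_subset[OF b]) auto
  show ?thesis
    by (rule Bochner_Integration.integrable_bound[OF borel_integrable_compact[OF compact_Icc c]])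
       (auto simp: indicator_def)
qed

text \<open>The random part is a sum over forced coordinates of scalar convolutions; its covariance
  is sheared to an integral over the lag, to which \<open>lag_integral_tendsto\<close> applies with
  \<open>damped_form\<close> and \<open>gibbs_form\<close>.\<close>

theorem (in damped_network) stationary_limit_process:
  fixes f :: "real \<Rightarrow> 'w \<Rightarrow> real" and M :: "'w measure"
  assumes P: "prob_space M"
    and f: "gaussian_process M f" and mean: "\<And>t. (\<integral>\<omega>. f t \<omega> \<partial>M) = 0"
    and Cf: "\<And>t s. (\<integral>\<omega>. f t \<omega> * f (t + s) \<omega> \<partial>M) = Cf s"
    and int: "integrable lborel Cf"
    and g: "\<And>k t. damped m k \<Longrightarrow> g k t \<in> borel_measurable M"
    and law: "\<And>k. damped m k \<Longrightarrow> process_law M (g k) = process_law M f"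
    and cont: "\<And>k \<omega>. damped m k \<Longrightarrow> \<omega> \<in> space M \<Longrightarrow> continuous_on UNIV (\<lambda>t. g k t \<omega>)"
    and indep: "prob_space.indep_vars M (\<lambda>_. \<Pi>\<^sub>M t\<in>UNIV. borel) (\<lambda>k \<omega> t. g k t \<omega>) D"
  shows "stationary_limit M \<alpha> V (solution \<alpha> m V g) (Wmat \<alpha> m V Cf)"
proof -
  interpret prob_space M by fact
  interpret gaussian_noise M D g "\<lambda>s t. Cf (t - s)"
    by (rule gaussian_noise_of_process[OF _ f mean Cf _ _ _ indep]) (use g law cont in auto)
  have Cm[measurable]: "Cf \<in> borel_measurable borel" using int by simp
  have even: "Cf (- x) = Cf x" and bound: "\<bar>Cf x\<bar> \<le> Cf 0" for x
    using stationary_covariance[OF f mean Cf] by auto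
  define a where "a c k t = adj c t $ Inr k" for c k t
  have ac: "continuous_on S (a c k)" for S c k
    unfolding a_def[abs_def] by (intro continuous_intros continuous_adj)
  have acr: "continuous_on S (\<lambda>s. a c k (t - s))" for S c k t
    by (rule continuous_on_compose2[OF ac[of UNIV]]) (intro continuous_intros, simp)
  define X where "X c t \<omega> = (\<Sum>k\<in>D. integral {0..t} (\<lambda>s. a c k (t - s) * g k s \<omega>))" for c t \<omega>
  show ?thesis
  proof (rule stationary_limitI[where u = "\<lambda>x t. flow t *v x" and X = X])
    show "X c t \<in> gspace" if "t \<ge> 0" for c t
      unfolding X_def[abs_def] by (intro gspace_sum gspace_integral acr that)
    show "((\<lambda>t. flow t *v x) \<longlongrightarrow> 0) at_top" for x by (rule flow_tendsto_0)
    show "c \<bullet> solution \<alpha> m V g x t \<omega> = c \<bullet> (flow t *v x) + X c t \<omega>" if t: "t \<ge> 0" and \<omega>: "\<omega> \<in> space M" for c x t \<omega>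
    proof -
      have gc: "continuous_on {0..t} (\<lambda>s. g k s \<omega>)" if "k \<in> D" for k
        using cont[of k \<omega>] that \<omega> by (auto intro: continuous_on_subset)
      have "c \<bullet> (flow t *v integral {0..t} (\<lambda>s. flow (- s) *v Force m g s \<omega>))
         = integral {0..t} (\<lambda>s. adj c (t - s) \<bullet> Force m g s \<omega>)"
        by (intro inner_convolution continuous_Force gc) simp
      also have "\<dots> = integral {0..t} (\<lambda>s. \<Sum>k\<in>D. a c k (t - s) * g k s \<omega>)"
        by (simp add: inner_Force a_def)
      also have "\<dots> = X c t \<omega>"
        unfolding X_def
        by (intro integral_sum integrable_continuous_interval continuous_intros acr gc) auto
      finally show ?thesis
        unfolding solution_def flow_def[symmetric]
        by (simp add: matrix_vector_right_distrib inner_add_right)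
    qed
    fix c d s
    define S where "S k t t' \<tau> = (\<integral>y. indicator {0..t'} y * indicator {0..t} (y + \<tau>) * (a c k (y + \<tau>) * a d k y) \<partial>lborel)"
      for k t t' \<tau>
    define lag where "lag t t' \<tau> = (\<integral>y. indicator {0..t'} y * indicator {0..t} (y + \<tau>) * damped_form c d (y + \<tau>) y \<partial>lborel)"
      for t t' \<tau>
    \<comment> \<open>Distinct coordinates are uncorrelated, so the double sum collapses to its
      diagonal, and summing over the coordinates turns the products of adjoint components into
      \<open>damped_form\<close>.\<close>
    have Xcov: "expectation (\<lambda>\<omega>. X c t \<omega> * X d t' \<omega>)
      = (\<integral>\<tau>. Cf (t' - t + \<tau>) * lag t t' \<tau> \<partial>lborel)"
      if t: "t \<ge> 0" "t' \<ge> 0" for t t'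
    proof -
      have ii: "integrable M (\<lambda>\<omega>. integral {0..t} (\<lambda>s. a c k (t - s) * g k s \<omega>) * integral {0..t'} (\<lambda>s. a d l (t' - s) * g l s \<omega>))"
        if "k \<in> D" "l \<in> D" for k l
        by (intro gspace_integrable_mult gspace_integral acr that t)
      have "expectation (\<lambda>\<omega>. X c t \<omega> * X d t' \<omega>) = (\<Sum>k\<in>D. \<Sum>l\<in>D. expectation (\<lambda>\<omega>.
          integral {0..t} (\<lambda>s. a c k (t - s) * g k s \<omega>) * integral {0..t'} (\<lambda>s. a d l (t' - s) * g l s \<omega>)))"
        unfolding X_def sum_product
        by (subst Bochner_Integration.integral_sum, rule Bochner_Integration.integrable_sum, rule ii, assumption, assumption)
           (intro sum.cong refl Bochner_Integration.integral_sum ii)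
      also have "\<dots> = (\<Sum>k\<in>D. \<Sum>l\<in>D. if k = l then
          integral {0..t} (\<lambda>u. a c k (t - u) * integral {0..t'} (\<lambda>v. a d l (t' - v) * Cf (u - v))) else 0)"
        by (intro sum.cong refl cov_integral_integral acr t)
      also have "\<dots> = (\<Sum>k\<in>D. integral {0..t} (\<lambda>u. a c k (t - u) * integral {0..t'} (\<lambda>v. a d k (t' - v) * Cf (u - v))))"
        by (intro sum.cong refl) (simp add: sum.delta)
      also have "\<dots> = (\<Sum>k\<in>D. \<integral>\<tau>. Cf (t' - t + \<tau>) * S k t t' \<tau> \<partial>lborel)"
        unfolding S_def by (intro sum.cong refl rectangle_integral_shear[OF ac ac Cm bound even])
      also have "\<dots> = (\<integral>\<tau>. (\<Sum>k\<in>D. Cf (t' - t + \<tau>) * S k t t' \<tau>) \<partial>lborel)"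
        unfolding S_def by (rule Bochner_Integration.integral_sum[symmetric])
          (rule integrable_rectangle_shear[OF ac ac Cm bound even])
      also have "\<dots> = (\<integral>\<tau>. Cf (t' - t + \<tau>) * lag t t' \<tau> \<partial>lborel)"
      proof (rule Bochner_Integration.integral_cong[OF refl])
        fix \<tau>
        have "(\<Sum>k\<in>D. S k t t' \<tau>) = (\<integral>y. (\<Sum>k\<in>D. indicator {0..t'} y * indicator {0..t} (y + \<tau>) * (a c k (y + \<tau>) * a d k y)) \<partial>lborel)"
          unfolding S_def by (rule Bochner_Integration.integral_sum[symmetric]) (intro integrable_damped_term ac)
        also have "\<dots> = lag t t' \<tau>"
          by (simp add: lag_def damped_form_def a_def sum_distrib_left)
        finally show "(\<Sum>k\<in>D. Cf (t' - t + \<tau>) * S k t t' \<tau>)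
          = Cf (t' - t + \<tau>) * lag t t' \<tau>"
          by (simp add: sum_distrib_left[symmetric])
      qed
      finally show ?thesis .
    qed
    obtain K r where Kr: "r > 0" "\<And>x y. x \<ge> 0 \<Longrightarrow> y \<ge> 0 \<Longrightarrow> \<bar>gibbs_form c d x y\<bar> \<le> K * exp (- r * (x + y))"
      by (rule gibbs_form_bound[of c d]) (rule that)
    have L: "((\<lambda>t. \<integral>\<tau>. Cf (s + \<tau>) * lag t (t + s) \<tau> \<partial>lborel)
      \<longlongrightarrow> (LINT \<tau>:{0..}|lborel. Cf (\<tau> + s) * gibbs_form c d \<tau> 0) + (LINT \<tau>:{0..}|lborel. Cf (s - \<tau>) * gibbs_form c d 0 \<tau>)) at_top"
      unfolding lag_def
    proof (rule lag_integral_tendsto[OF continuous_damped_form _ continuous_gibbs_form Kr Cm bound])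
      show "((\<lambda>y. gibbs_form c d (y + \<tau>) y) has_real_derivative - damped_form c d (y + \<tau>) y) (at y)" for \<tau> y
        by (rule gibbs_form_derivative) (auto intro!: derivative_eq_intros)
    qed
    \<comment> \<open>On y = 0 the Gibbs form is the integrand of W(s) C. On x = 0, evenness of
      \<open>Cf\<close> and symmetry of C turn it into that of W(-s) C with \<open>c\<close> and
      \<open>d\<close> exchanged.\<close>
    have eq: "(LINT \<tau>:{0..}|lborel. Cf (\<tau> + s) * gibbs_form c d \<tau> 0) + (LINT \<tau>:{0..}|lborel. Cf (s - \<tau>) * gibbs_form c d 0 \<tau>)
      = c \<bullet> ((Wmat \<alpha> m V Cf s ** C + C ** transpose (Wmat \<alpha> m V Cf (- s))) *v d)"
    proof -
      have "Cf (s - \<tau>) = Cf (\<tau> + - s)" for \<tau> using even[of "\<tau> - s"] by simp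
      moreover have "gibbs_form c d 0 \<tau> = adj d \<tau> \<bullet> (C *v c)" for \<tau>
        unfolding gibbs_form_def adj_0 by (rule C_inner_symmetric)
      ultimately show ?thesis
        unfolding matrix_vector_mult_add_rdistrib inner_add_right matrix_vector_mul_assoc[symmetric]
          transpose_Wmat_inner Wmat_inner[OF Cm bound]
        by (simp add: gibbs_form_def adj_0)
    qed
    have ev: "\<forall>\<^sub>F t in at_top. (\<integral>\<tau>. Cf (s + \<tau>) * lag t (t + s) \<tau> \<partial>lborel)
        = expectation (\<lambda>\<omega>. X c t \<omega> * X d (t + s) \<omega>)"
      using eventually_ge_at_top[of "max 0 (- s)"]
      by eventually_elim (simp add: Xcov)
    show "((\<lambda>t. expectation (\<lambda>\<omega>. X c t \<omega> * X d (t + s) \<omega>)) \<longlongrightarrow>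
      c \<bullet> ((Wmat \<alpha> m V Cf s ** C + C ** transpose (Wmat \<alpha> m V Cf (- s))) *v d)) at_top"
      using Lim_transform_eventually[OF L ev] unfolding eq .
  qed
qed

section \<open>Forcing by white noise\<close>


text \<open>Independence is given for paths restricted to \<open>{0..}\<close>; combinations over
  times in \<open>T\<close>, a subset of \<open>{0..}\<close>, are measurable functionals of the
  restricted path.\<close>

lemma (in prob_space) gaussian_noise_of_brownian:
  fixes B :: "'i \<Rightarrow> real \<Rightarrow> 'a \<Rightarrow> real"
  assumes fin: "finite I" and B: "\<And>k. k \<in> I \<Longrightarrow> brownian_motion M (B k)"
    and indep: "indep_vars (\<lambda>_. \<Pi>\<^sub>M t\<in>{0..}. borel) (\<lambda>k \<omega>. \<lambda>t\<in>{0..}. B k t \<omega>) I"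
  shows "gaussian_noise M I B min"
proof unfold_locales
  note B = B[unfolded brownian_motion_def]
  show "finite I" by (rule fin)
  show "continuous_on {0..} (\<lambda>t. B k t \<omega>)" if "k \<in> I" "\<omega> \<in> space M" for k \<omega>
    using B that by blast
  show "\<exists>v. normal_rv M v (\<lambda>\<omega>. \<Sum>t\<in>T. c t * B k t \<omega>)" if "finite T" "T \<subseteq> {0..}" "k \<in> I" for T c k
  proof (rule normal_rv_sum_of_gaussian[where U = "{0..}"])
    show "B k t \<in> borel_measurable M" "expectation (B k t) = 0" if "t \<in> {0..}" for t
      using B[OF \<open>k \<in> I\<close>] that by auto
    show "gaussian_measure (distr M borel (\<lambda>\<omega>. \<Sum>t\<in>T. c t * B k t \<omega>))" if "finite T" "T \<subseteq> {0..}" for T c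
      using B[OF \<open>k \<in> I\<close>] that by blast
  qed (use that in auto)
  show "indep_vars (\<lambda>_. borel) (\<lambda>k \<omega>. \<Sum>t\<in>T. d k t * B k t \<omega>) I" if T: "finite T" "T \<subseteq> {0..}" for T d
  proof -
    have "indep_vars (\<lambda>_. borel) (\<lambda>k \<omega>. \<Sum>t\<in>T. d k t * (\<lambda>t\<in>{0..}. B k t \<omega>) t) I"
    proof (rule indep_vars_compose2[OF indep])
      show "(\<lambda>x. \<Sum>t\<in>T. d k t * x t) \<in> borel_measurable (\<Pi>\<^sub>M t\<in>{0..}. borel)" for k
      proof (intro borel_measurable_sum borel_measurable_times borel_measurable_const)
        fix t assume "t \<in> T"
        then show "(\<lambda>x. x t) \<in> borel_measurable (\<Pi>\<^sub>M t\<in>{0..}. borel)"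
          using T by (intro measurable_component_singleton) auto
      qed
    qed
    moreover have "(\<Sum>t\<in>T. d k t * (\<lambda>t\<in>{0..}. B k t \<omega>) t) = (\<Sum>t\<in>T. d k t * B k t \<omega>)" for k \<omega>
      using T by (intro sum.cong) auto
    ultimately show ?thesis by simp
  qed
  show "expectation (\<lambda>\<omega>. B k s \<omega> * B k t \<omega>) = min s t" if "k \<in> I" "0 \<le> s" "0 \<le> t" for k s t
    using B that by blast
qed

lemma BForce_eq_Force: "BForce m \<sigma> B t \<omega> = Force m (\<lambda>k t \<omega>. \<sigma> * B k t \<omega>) t \<omega>"
  by (simp add: BForce_def Force_def)

text \<open>There is no integral over the lag here: undoing the two integrations by parts gives the
  Ito isometry, and the covariance has a closed form before any limit is taken.\<close>

theorem (in damped_network) stationary_limit_white: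
  fixes M :: "'w measure"
  assumes P: "prob_space M"
    and B: "\<And>k. damped m k \<Longrightarrow> brownian_motion M (B k)"
    and indep: "prob_space.indep_vars M (\<lambda>_. \<Pi>\<^sub>M t\<in>{0..}. borel) (\<lambda>k \<omega>. \<lambda>t\<in>{0..}. B k t \<omega>) D"
  shows "stationary_limit M \<alpha> V (solution_white \<alpha> m V \<sigma> B) (Wmat_white \<alpha> m V \<sigma>)"
proof -
  interpret prob_space M by fact
  interpret gaussian_noise M D B min
    by (rule gaussian_noise_of_brownian[OF _ _ indep]) (use B in auto)
  define a where "a c k t = adj c t $ Inr k" for c k t
  define a' where "a' c k t = adj' c t $ Inr k" for c k t
  have ad: "(a c k has_real_derivative a' c k x) (at x)" for c k x
    unfolding a_def[abs_def] a'_def by (rule adj_derivative)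
  have ac: "continuous_on S (a c k)" for S c k
    unfolding a_def[abs_def] by (intro continuous_intros continuous_adj)
  have ac': "continuous_on S (a' c k)" for S c k
    unfolding a'_def[abs_def] by (intro continuous_intros continuous_adj')
  have acr: "continuous_on S (\<lambda>s. a c k (t - s))" for S c k t
    by (rule continuous_on_compose2[OF ac[of UNIV]]) (intro continuous_intros, simp)
  have acr': "continuous_on S (\<lambda>s. \<sigma> * a' c k (t - s))" for S c k t
    by (rule continuous_on_compose2[OF _ _ subset_UNIV, of "\<lambda>x. \<sigma> * a' c k x"]) (intro continuous_intros ac')+
  \<comment> \<open>One coordinate of the Wiener integral with integrand \<sigma> a(t - s), in the
    pathwise form with boundary term and derivative.\<close>
  define Z where "Z c k t \<omega> = (\<sigma> * a c k 0) * B k t \<omega> + integral {0..t} (\<lambda>s. (\<sigma> * a' c k (t - s)) * B k s \<omega>)" for c k t \<omega>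
  define X where "X c t \<omega> = (\<Sum>k\<in>D. Z c k t \<omega>)" for c t \<omega>
  have Zg: "Z c k t \<in> gspace" if "k \<in> D" "t \<ge> 0" for c k t
    unfolding Z_def[abs_def] by (intro gspace_add gspace_scale gspace_G gspace_integral acr' that)
  show ?thesis
  proof (rule stationary_limitI[where u = "\<lambda>x t. flow t *v x" and X = X])
    show "X c t \<in> gspace" if "t \<ge> 0" for c t
      unfolding X_def[abs_def] by (intro gspace_sum Zg that)
    show "((\<lambda>t. flow t *v x) \<longlongrightarrow> 0) at_top" for x by (rule flow_tendsto_0)
    show "c \<bullet> solution_white \<alpha> m V \<sigma> B x t \<omega> = c \<bullet> (flow t *v x) + X c t \<omega>"
      if t: "t \<ge> 0" and \<omega>: "\<omega> \<in> space M" for c x t \<omega>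
    proof -
      have Bc: "continuous_on {0..t} (\<lambda>s. B k s \<omega>)" if "k \<in> D" for k
        using cont[OF that \<omega>] by (rule continuous_on_subset) auto
      have "continuous_on {0..t} (\<lambda>s. A *v BForce m \<sigma> B s \<omega>)"
        unfolding BForce_eq_Force
        by (rule linear_continuous_on_compose[OF continuous_Force matrix_vector_mul_linear])
           (intro continuous_on_mult_left Bc, simp)
      from inner_convolution[OF this]
      have "c \<bullet> (flow t *v integral {0..t} (\<lambda>s. flow (- s) *v (A *v BForce m \<sigma> B s \<omega>)))
         = integral {0..t} (\<lambda>s. adj c (t - s) \<bullet> (A *v BForce m \<sigma> B s \<omega>))" .
      also have "\<dots> = integral {0..t} (\<lambda>s. \<Sum>k\<in>D. (\<sigma> * a' c k (t - s)) * B k s \<omega>)"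
        by (simp add: adj'_inner BForce_eq_Force inner_Force a'_def mult_ac)
      also have "\<dots> = (\<Sum>k\<in>D. integral {0..t} (\<lambda>s. (\<sigma> * a' c k (t - s)) * B k s \<omega>))"
        by (intro integral_sum integrable_continuous_interval continuous_on_mult acr' Bc) auto
      finally have 1: "c \<bullet> (flow t *v integral {0..t} (\<lambda>s. flow (- s) *v (A *v BForce m \<sigma> B s \<omega>))) = \<dots>" .
      have 2: "c \<bullet> (flow t *v (flow (- t) *v BForce m \<sigma> B t \<omega>)) = (\<Sum>k\<in>D. (\<sigma> * a c k 0) * B k t \<omega>)"
        unfolding inner_flow[of c] adj_inner_flow_minus by (simp add: BForce_eq_Force inner_Force a_def mult_ac)
      show ?thesis
        unfolding solution_white_def flow_def[symmetric] matrix_vector_right_distrib inner_add_right 1 2 X_def Z_def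
        by (simp add: sum.distrib)
    qed
    \<comment> \<open>Ordering the two times selects the shorter range of integration; the opposite
      order follows by exchanging \<open>c\<close> and \<open>d\<close>.\<close>
    have cov_le: "expectation (\<lambda>\<omega>. X c t \<omega> * X d t' \<omega>) = \<sigma>\<^sup>2 * (gibbs_form c d 0 (t' - t) - gibbs_form c d t t')"
      if t: "0 \<le> t" "t \<le> t'" for c d t t'
    proof -
      have t': "t' \<ge> 0" using t by simp
      \<comment> \<open>Integration by parts in the later variable: the correlation of the path at
        \<open>u\<close> with the Wiener integral is the integrand accumulated up to
        \<open>u\<close>.\<close>
      have GZ: "expectation (\<lambda>\<omega>. B k u \<omega> * Z d l t' \<omega>) = (if k = l then \<sigma> * integral {0..u} (\<lambda>v. a d l (t' - v)) else 0)"
        if kl: "k \<in> D" "l \<in> D" and u: "0 \<le> u" "u \<le> t'" for k l u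
      proof -
        have "expectation (\<lambda>\<omega>. B k u \<omega> * Z d l t' \<omega>)
          = expectation (\<lambda>\<omega>. (\<sigma> * a d l 0) * (B k u \<omega> * B l t' \<omega>) + B k u \<omega> * integral {0..t'} (\<lambda>s. (\<sigma> * a' d l (t' - s)) * B l s \<omega>))"
          unfolding Z_def by (simp add: algebra_simps)
        also have "\<dots> = (\<sigma> * a d l 0) * expectation (\<lambda>\<omega>. B k u \<omega> * B l t' \<omega>)
            + expectation (\<lambda>\<omega>. B k u \<omega> * integral {0..t'} (\<lambda>s. (\<sigma> * a' d l (t' - s)) * B l s \<omega>))"
          using gspace_integrable_mult[OF gspace_G[OF kl(1) u(1)] gspace_G[OF kl(2) t']]
            gspace_integrable_mult[OF gspace_G[OF kl(1) u(1)] gspace_integral[OF kl(2) acr' t']]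
          by simp
        also have "\<dots> = (if k = l then (\<sigma> * a d l 0) * u + integral {0..t'} (\<lambda>v. (\<sigma> * a' d l (t' - v)) * min v u) else 0)"
          using u by (simp add: cov_G[OF kl u(1) t'] cov_G_integral[OF kl u(1) t' acr'])
        also have "\<dots> = (if k = l then \<sigma> * (a d l 0 * u + integral {0..t'} (\<lambda>v. a' d l (t' - v) * min v u)) else 0)"
          by (simp add: distrib_left mult.assoc)
        also have "\<dots> = (if k = l then \<sigma> * integral {0..u} (\<lambda>v. a d l (t' - v)) else 0)"
          by (simp only: integral_min_by_parts[OF ad ac' u])
        finally show ?thesis .
      qed
      \<comment> \<open>Integration by parts in the earlier variable; the result is the Ito isometry
        on the common interval \<open>{0..t}\<close>.\<close>
      have ZZ: "expectation (\<lambda>\<omega>. Z c k t \<omega> * Z d l t' \<omega>)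
          = (if k = l then \<sigma>\<^sup>2 * integral {0..t} (\<lambda>u. a c k (t - u) * a d k (t' - u)) else 0)"
        if kl: "k \<in> D" "l \<in> D" for k l
      proof -
        note Zl = Zg[OF kl(2) t']
        have "expectation (\<lambda>\<omega>. Z c k t \<omega> * Z d l t' \<omega>)
          = expectation (\<lambda>\<omega>. (\<sigma> * a c k 0) * (B k t \<omega> * Z d l t' \<omega>) + integral {0..t} (\<lambda>s. (\<sigma> * a' c k (t - s)) * B k s \<omega>) * Z d l t' \<omega>)"
          unfolding Z_def[of c] by (simp add: algebra_simps)
        also have "\<dots> = (\<sigma> * a c k 0) * expectation (\<lambda>\<omega>. B k t \<omega> * Z d l t' \<omega>)
            + expectation (\<lambda>\<omega>. integral {0..t} (\<lambda>s. (\<sigma> * a' c k (t - s)) * B k s \<omega>) * Z d l t' \<omega>)"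
          using gspace_integrable_mult[OF gspace_G[OF kl(1) t(1)] Zl]
            gspace_integrable_mult[OF gspace_integral[OF kl(1) acr' t(1)] Zl]
          by simp
        also have "\<dots> = (\<sigma> * a c k 0) * expectation (\<lambda>\<omega>. B k t \<omega> * Z d l t' \<omega>)
            + integral {0..t} (\<lambda>s. (\<sigma> * a' c k (t - s)) * expectation (\<lambda>\<omega>. B k s \<omega> * Z d l t' \<omega>))"
          unfolding gspace_integral_cov[OF kl(1) acr' t(1) Zl] ..
        also have "integral {0..t} (\<lambda>s. (\<sigma> * a' c k (t - s)) * expectation (\<lambda>\<omega>. B k s \<omega> * Z d l t' \<omega>))
            = integral {0..t} (\<lambda>s. (\<sigma> * a' c k (t - s)) * (if k = l then \<sigma> * integral {0..s} (\<lambda>v. a d l (t' - v)) else 0))"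
          using t by (intro integral_cong) (simp add: GZ[OF kl])
        also have "expectation (\<lambda>\<omega>. B k t \<omega> * Z d l t' \<omega>) = (if k = l then \<sigma> * integral {0..t} (\<lambda>v. a d l (t' - v)) else 0)"
          by (rule GZ[OF kl t])
        also have "(\<sigma> * a c k 0) * (if k = l then \<sigma> * integral {0..t} (\<lambda>v. a d l (t' - v)) else 0)
            + integral {0..t} (\<lambda>s. (\<sigma> * a' c k (t - s)) * (if k = l then \<sigma> * integral {0..s} (\<lambda>v. a d l (t' - v)) else 0))
          = (if k = l then \<sigma>\<^sup>2 * (a c k 0 * integral {0..t} (\<lambda>v. a d k (t' - v))
              + integral {0..t} (\<lambda>s. a' c k (t - s) * integral {0..s} (\<lambda>v. a d k (t' - v)))) else 0)"
        proof (cases "k = l")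
          case True
          have "integral {0..t} (\<lambda>s. (\<sigma> * a' c k (t - s)) * (\<sigma> * integral {0..s} (\<lambda>v. a d k (t' - v))))
            = integral {0..t} (\<lambda>s. \<sigma>\<^sup>2 * (a' c k (t - s) * integral {0..s} (\<lambda>v. a d k (t' - v))))"
            by (intro integral_cong) (simp add: power2_eq_square mult_ac)
          also have "\<dots> = \<sigma>\<^sup>2 * integral {0..t} (\<lambda>s. a' c k (t - s) * integral {0..s} (\<lambda>v. a d k (t' - v)))"
            by (rule integral_mult_right)
          finally show ?thesis using True by (simp add: power2_eq_square algebra_simps)
        qed simp
        also have "\<dots> = (if k = l then \<sigma>\<^sup>2 * integral {0..t} (\<lambda>u. a c k (t - u) * a d k (t' - u)) else 0)"
          by (simp only: integral_by_parts_antiderivative[OF ad ac' acr t(1)])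
        finally show ?thesis .
      qed
      have "expectation (\<lambda>\<omega>. X c t \<omega> * X d t' \<omega>) = (\<Sum>k\<in>D. \<Sum>l\<in>D. expectation (\<lambda>\<omega>. Z c k t \<omega> * Z d l t' \<omega>))"
      proof -
        have ii: "integrable M (\<lambda>\<omega>. Z c k t \<omega> * Z d l t' \<omega>)" if "k \<in> D" "l \<in> D" for k l
          by (intro gspace_integrable_mult Zg that t t')
        show ?thesis unfolding X_def sum_product
          by (subst Bochner_Integration.integral_sum, rule Bochner_Integration.integrable_sum, rule ii, assumption, assumption)
             (intro sum.cong refl Bochner_Integration.integral_sum ii)
      qed
      also have "\<dots> = (\<Sum>k\<in>D. \<Sum>l\<in>D. if k = l then \<sigma>\<^sup>2 * integral {0..t} (\<lambda>u. a c k (t - u) * a d k (t' - u)) else 0)"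
        by (intro sum.cong refl ZZ)
      also have "\<dots> = (\<Sum>k\<in>D. \<sigma>\<^sup>2 * integral {0..t} (\<lambda>u. a c k (t - u) * a d k (t' - u)))"
        by (intro sum.cong refl) (simp add: sum.delta)
      also have "\<dots> = \<sigma>\<^sup>2 * integral {0..t} (\<lambda>u. damped_form c d (t - u) (t' - u))"
        unfolding damped_form_def a_def sum_distrib_left[symmetric]
        by (subst integral_sum) (auto intro!: integrable_continuous_interval continuous_intros acr[unfolded a_def])
      \<comment> \<open>As \<open>u\<close> grows both arguments decrease at unit speed, so the
        integrand is a derivative of the Gibbs form; at u = t only the lag is left.\<close>
      also have "integral {0..t} (\<lambda>u. damped_form c d (t - u) (t' - u)) = gibbs_form c d (t - t) (t' - t) - gibbs_form c d (t - 0) (t' - 0)"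
      proof (intro integral_unique fundamental_theorem_of_calculus t)
        fix u
        have G: "((\<lambda>u. gibbs_form c d (t + u) (t' + u)) has_real_derivative - damped_form c d (t + (- u)) (t' + (- u))) (at (- u))"
          by (rule gibbs_form_derivative) (auto intro!: derivative_eq_intros)
        have "((\<lambda>u. gibbs_form c d (t + (- u)) (t' + (- u))) has_real_derivative
            - damped_form c d (t + (- u)) (t' + (- u)) * (- 1)) (at u)"
          by (rule DERIV_chain2[where f = "\<lambda>v. gibbs_form c d (t + v) (t' + v)" and g = uminus, OF G])
             (auto intro!: derivative_eq_intros)
        then have "((\<lambda>u. gibbs_form c d (t - u) (t' - u)) has_real_derivative damped_form c d (t - u) (t' - u)) (at u)"
          by simp
        then show "((\<lambda>u. gibbs_form c d (t - u) (t' - u)) has_vector_derivative damped_form c d (t - u) (t' - u)) (at u within {0..t})"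
          unfolding has_real_derivative_iff_has_vector_derivative[symmetric] by (rule DERIV_subset) simp
      qed
      finally show ?thesis by simp
    qed
    have lim_pos: "((\<lambda>t. expectation (\<lambda>\<omega>. X c t \<omega> * X d (t + s) \<omega>)) \<longlongrightarrow> \<sigma>\<^sup>2 * gibbs_form c d 0 s) at_top"
      if s: "s \<ge> 0" for c d s
    proof -
      have "((\<lambda>t. gibbs_form c d t (t + s)) \<longlongrightarrow> 0) at_top"
      proof -
        have "((\<lambda>t. C *v (flow' t)) \<longlongrightarrow> C *v 0) at_top" if "(flow' \<longlongrightarrow> 0) at_top" for flow' :: "real \<Rightarrow> real^('n + 'n)"
          by (rule bounded_linear.tendsto[OF matrix_vector_mul_bounded_linear that])
        moreover have ad0: "((\<lambda>t. adj c t) \<longlongrightarrow> 0) at_top" for c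
        proof (rule Lim_null_comparison)
          show "\<forall>\<^sub>F t in at_top. norm (adj c t) \<le> norm (flow t) * norm c" by (simp add: adj_bound)
          show "((\<lambda>t. norm (flow t) * norm c) \<longlongrightarrow> 0) at_top"
            using mexp_Amat_tendsto_0[OF V L0] unfolding flow_def
            by (intro tendsto_mult_left_zero tendsto_norm_zero)
        qed
        moreover have "((\<lambda>t. adj d (t + s)) \<longlongrightarrow> 0) at_top"
          by (rule filterlim_compose[OF ad0])
             (use filterlim_tendsto_add_at_top[OF tendsto_const filterlim_ident, of s] in \<open>simp add: add.commute\<close>)
        ultimately have "((\<lambda>t. adj c t \<bullet> (C *v adj d (t + s))) \<longlongrightarrow> 0 \<bullet> (C *v 0)) at_top"
          by (intro tendsto_inner)
        then show ?thesis by (simp add: gibbs_form_def)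
      qed
      then have "((\<lambda>t. \<sigma>\<^sup>2 * (gibbs_form c d 0 s - gibbs_form c d t (t + s))) \<longlongrightarrow> \<sigma>\<^sup>2 * (gibbs_form c d 0 s - 0)) at_top"
        by (intro tendsto_intros)
      then have L: "((\<lambda>t. \<sigma>\<^sup>2 * (gibbs_form c d 0 s - gibbs_form c d t (t + s))) \<longlongrightarrow> \<sigma>\<^sup>2 * gibbs_form c d 0 s) at_top" by simp
      have "\<forall>\<^sub>F t in at_top. \<sigma>\<^sup>2 * (gibbs_form c d 0 s - gibbs_form c d t (t + s)) = expectation (\<lambda>\<omega>. X c t \<omega> * X d (t + s) \<omega>)"
        using eventually_ge_at_top[of 0] by eventually_elim (simp add: cov_le s)
      from Lim_transform_eventually[OF L this] show ?thesis .
    qed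
    fix c d s
    show "((\<lambda>t. expectation (\<lambda>\<omega>. X c t \<omega> * X d (t + s) \<omega>)) \<longlongrightarrow>
      c \<bullet> ((Wmat_white \<alpha> m V \<sigma> s ** C + C ** transpose (Wmat_white \<alpha> m V \<sigma> (- s))) *v d)) at_top"
    proof -
      have W: "Wmat_white \<alpha> m V \<sigma> s = (if s < 0 then \<sigma>\<^sup>2 *\<^sub>R flow (- s) else if s = 0 then (\<sigma>\<^sup>2 / 2) *\<^sub>R mat 1 else 0)" for s
        by (simp add: Wmat_white_def flow_def)
      have R: "c \<bullet> ((Wmat_white \<alpha> m V \<sigma> s ** C + C ** transpose (Wmat_white \<alpha> m V \<sigma> (- s))) *v d)
         = c \<bullet> (Wmat_white \<alpha> m V \<sigma> s *v (C *v d)) + d \<bullet> (Wmat_white \<alpha> m V \<sigma> (- s) *v (C *v c))"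
        unfolding matrix_vector_mult_add_rdistrib inner_add_right matrix_vector_mul_assoc[symmetric]
          transpose_Wmat_inner ..
      \<comment> \<open>For s > 0 only the term with W(-s) survives, for s < 0 only the one with
        W(s); at s = 0 the two half masses of the delta function add up to a full one.\<close>
      have R2: "c \<bullet> ((Wmat_white \<alpha> m V \<sigma> s ** C + C ** transpose (Wmat_white \<alpha> m V \<sigma> (- s))) *v d)
         = (if s \<ge> 0 then \<sigma>\<^sup>2 * gibbs_form c d 0 s else \<sigma>\<^sup>2 * gibbs_form d c 0 (- s))"
        unfolding R unfolding W using C_inner_symmetric[of c d] C_inner_symmetric[of c "adj d s"] C_inner_symmetric[of d "adj c (- s)"]
        by (auto simp: scaleR_matrix_vector_assoc[symmetric] inner_flow gibbs_form_commute[of _ _ 0] gibbs_form_def adj_0)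
      show ?thesis
      proof (cases "s \<ge> 0")
        case True
        then show ?thesis unfolding R2 using lim_pos[OF True] by simp
      next
        case False
        have shift: "filterlim (\<lambda>t. t + s) at_top at_top"
          using filterlim_tendsto_add_at_top[OF tendsto_const filterlim_ident, of s] by (simp add: add.commute)
        \<comment> \<open>For a negative lag, t + s is the earlier time: the case of lag -s is used
          with base point t + s and with \<open>c\<close> and \<open>d\<close> exchanged.\<close>
        show ?thesis unfolding R2
          using filterlim_compose[OF lim_pos[of "- s" d c] shift] False by (simp add: mult.commute)
      qed
    qed
  qed
qed

theorem theorem1:
  fixes E :: "'n::{finite,linorder} \<Rightarrow> 'n \<Rightarrow> bool"
    and m :: nat and \<alpha> :: real and V :: "real^('n::{finite,linorder})^('n::{finite,linorder})"
    and M :: "'w measure"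
  assumes graph: "graph_ok E" and conn: "graph_connected E"
    and m: "1 \<le> m" "m \<le> CARD('n)"
    and alpha: "\<alpha> > 0"
    and P: "prob_space M"
    and V: "V \<in> H_Gamma E"
    and L0: "L_zero \<alpha> m V = {0}"
  shows
    \<comment> \<open>f with continuous trajectories and integrable covariance; g k (k damped) independent copies of f\<close>
    "(\<forall>(f :: real \<Rightarrow> 'w \<Rightarrow> real) (Cf :: real \<Rightarrow> real) (g :: 'n \<Rightarrow> real \<Rightarrow> 'w \<Rightarrow> real).
        gaussian_process M f
      \<and> (\<forall>t. (\<integral>\<omega>. f t \<omega> \<partial>M) = 0)
      \<and> (\<forall>t s. (\<integral>\<omega>. f t \<omega> * f (t + s) \<omega> \<partial>M) = Cf s)
      \<and> (\<forall>\<omega>\<in>space M. continuous_on UNIV (\<lambda>t. f t \<omega>))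
      \<and> integrable lborel Cf
      \<and> (\<forall>k. damped m k \<longrightarrow> (\<forall>t. g k t \<in> borel_measurable M) \<and> process_law M (g k) = process_law M f)
      \<and> (\<forall>k. damped m k \<longrightarrow> (\<forall>\<omega>\<in>space M. continuous_on UNIV (\<lambda>t. g k t \<omega>)))
      \<and> prob_space.indep_vars M (\<lambda>_. \<Pi>\<^sub>M t\<in>UNIV. borel) (\<lambda>k \<omega> t. g k t \<omega>) {k. damped m k}
      \<longrightarrow> stationary_limit M \<alpha> V (solution \<alpha> m V g) (Wmat \<alpha> m V Cf))
   \<and> \<comment> \<open>white noise with C_f(s) = sigma^2 delta(s): F_t dt = sigma dB_t on the damped p-coordinates\<close>
    (\<forall>(\<sigma> :: real) (B :: 'n \<Rightarrow> real \<Rightarrow> 'w \<Rightarrow> real).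
        (\<forall>k. damped m k \<longrightarrow> brownian_motion M (B k))
      \<and> prob_space.indep_vars M (\<lambda>_. \<Pi>\<^sub>M t\<in>{0..}. borel) (\<lambda>k \<omega>. \<lambda>t\<in>{0..}. B k t \<omega>) {k. damped m k}
      \<longrightarrow> stationary_limit M \<alpha> V (solution_white \<alpha> m V \<sigma> B) (Wmat_white \<alpha> m V \<sigma>))"
proof (intro conjI allI impI, goal_cases)
  case (1 f Cf g)
  interpret damped_network E m \<alpha> V by unfold_locales (fact V alpha L0)+
  from 1 show ?case by (intro stationary_limit_process[OF P, of f]) auto
next
  case (2 \<sigma> B)
  interpret damped_network E m \<alpha> V by unfold_locales (fact V alpha L0)+
  from 2 show ?case by (intro stationary_limit_white[OF P]) auto
qed

end
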